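(* Consider the fully-discrete $N$-phase scheme (S) defined in the context, and let $(\{\phi_{\alpha,h}^{n}\}_{\alpha=1}^N,\mathbf v_h^{n})_{0\le n\le n_T}$, $(\{g_{\alpha,h}^{n+1}\}_{\alpha=1}^N,\lambda_h^{n+1})_{0\le n<n_T}$ be any solution of (S) with initial data $(\{\phi_{\alpha,h}^0\},\mathbf v_h^0)\in\mathcal V_h^N\times\mathcal X_h$. Then for all $\alpha=1,\dots,N$ and all $0\le n\le n_T-1$: (phase volume conservation) $\langle \phi_{\alpha,h}^{n+1},1\rangle=\langle\phi_{\alpha,h}^{0},1\rangle$; (phase mass conservation) $\langle \rho_\alpha\phi_{\alpha,h}^{n+1},1\rangle=\langle\rho_\alpha\phi_{\alpha,h}^{0},1\rangle$; (total volume conservation) $\langle \sum_\alpha\phi_{\alpha,h}^{n+1},1\rangle=\langle\sum_\alpha\phi_{\alpha,h}^{0},1\rangle$; (total mass conservation) $\langle \rho_h^{n+1},1\rangle=\langle\rho_h^{0},1\rangle$, where $\rho_h^{k}=\sum_\alpha\rho_\alpha\phi_{\alpha,h}^{k}$; (energy dissipation) $\tilde{\mathcal E}(\mathbf v_h^{n+1},\{\phi_{\alpha,h}^{n+1}\})+\tau_n\,\mathcal D_h^{n+1}\le \tilde{\mathcal E}(\mathbf v_h^{n},\{\phi_{\alpha,h}^{n}\})$, where $$\mathcal D_h^{n+1}:=\langle \mathbf S(\{\phi_{\alpha,h}^{\dagger}\},\nabla\mathbf v_h^{n+1}),\nabla\mathbf v_h^{n+1}\rangle+\sum_{\alpha,\beta}\langle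 \tilde M_{\alpha\beta}^{\ddagger}\nabla g_{\beta,h}^{n+1},\nabla g_{\alpha,h}^{n+1}\rangle .$$ In addition, if $\sum_\alpha\phi_{\alpha,h}^0(x)=1$ for all $x\in\Omega$, then $\sum_\alpha\phi_{\alpha,h}^k(x)=1$ for all $x\in\Omega$ and all $k=1,\dots,n_T$.
   Context: Notation. $\langle a,b\rangle=\int_\Omega a\cdot b\,dx$ (with the Euclidean or Frobenius product for vectors or matrices). Indices $\alpha,\beta$ run over $1,\dots,N$. Domain and boundary conditions. $\Omega\subset\mathbb R^d$, $d\in\{2,3\}$, is a spatial domain with outward unit normal $\mathbf n$. The boundary conditions are either periodic ($\Omega$ is a hypercube identified with the $d$-torus), or: $\partial\Omega=\partial\Omega_1\cup\partial\Omega_2$ with $\mathbf v=0$ on $\partial\Omega_1$ and $\mathbf v\cdot\mathbf n=0$ on $\partial\Omega_2$, together with the homogeneous natural conditions $\sum_\beta\bar\kappa_{\alpha\beta}\nabla\phi_\beta\cdot\mathbf n=0$ and $\sum_\beta M_{\alpha\beta}\nabla g_\beta\cdot\mathbf n=0$ on $\partial\Omega$ (with $\bar\kappa_{\alpha\beta}$ the capillarity matrix and $M_{\alpha\beta}$ the mobility matrix, both specified below). Finite element spaces. $\mathcal T_h$ is a geometrically conforming partition of $\Omega$ into elements; $P_k(K)$ denotes polynomials of degree at most $k$ on $K$. Set $\mathcal V_h=\{v\in H^1(\Omega)\cap C^0(\bar\Omega): v|_K\in P_1(K)\ \forall K\in\mathcal T_h\}$; $\mathcal X_h=\{\mathbf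 v\in H^1(\Omega)^d\cap C^0(\bar\Omega)^d:\mathbf v|_K\in P_2(K)^d\ \forall K\in\mathcal T_h\}\cap\{\mathbf v|_{\partial\Omega_1}=0,\ \mathbf v\cdot\mathbf n|_{\partial\Omega_2}=0\}$ (in the periodic case the spaces are understood on the torus and the boundary conditions in $\mathcal X_h$ are omitted); $\mathcal Q_h=\{v\in\mathcal V_h:\langle v,1\rangle=0\}$. Time grid. $0=t^0<t^1<\dots<t^{n_T}=T$, $\tau_n=t^{n+1}-t^n>0$, and $d_\tau^{n+1}a=(a^{n+1}-a^n)/\tau_n$. The unknowns $\phi_{\alpha,h},\mathbf v_h$ are continuous piecewise linear in time (determined by their nodal values), while $g_{\alpha,h},\lambda_h$ are piecewise constant in time (value with superscript $n+1$ on the step from $t^n$ to $t^{n+1}$). The superscripts $*,\dagger,\ddagger$ are placeholders for the time level used in, respectively, the convection term, the stress tensor and the mobility; each stands for time level $n$ or time level $n+1$. Physical data. Constants $\rho_\alpha>0$ (phase densities); $\rho(\{\phi_\alpha\})=\sum_\alpha\rho_\alpha\phi_\alpha$; $\rho_h^*\mathbf v_h^*=\rho(\{\phi_{\alpha,h}^*\})\mathbf v_h^*$. Gravity: gravitational constant $g$, vertical coordinate $y$, $\mathbf j=\nabla y$. Viscous stress: $\mathbf S(\{\phi_\alpha\},\nabla\mathbf v)=\nu\,(2\nabla^s\mathbf v+\bar\lambda(\operatorname{div}\mathbf v)\mathbf I)$ with dynamic viscosity $\nu=\nu(\{\phi_\alpha\})$, $\bar\lambda=-2/d$, $\nabla^s\mathbf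 v=(\nabla\mathbf v+\nabla\mathbf v^T)/2$. Regularization. With a parameter $\delta\in(0,1)$, $\tilde\phi_\alpha=\min\{1,\max\{\delta,\phi_\alpha\}\}$ and $\tilde\rho=\sum_\alpha\rho_\alpha\tilde\phi_\alpha$ (so $\tilde\rho>0$); $\tilde\rho_h^n$ denotes $\tilde\rho$ evaluated at $\{\phi^n_{\alpha,h}\}$. Mobility: with pairwise mobility coefficients $m_{\alpha\beta}=m_{\beta\alpha}$, $M_{\alpha\beta}=-m_{\alpha\beta}\phi_\alpha\phi_\beta$ for $\alpha\ne\beta$ and $M_{\alpha\alpha}=\phi_\alpha\sum_{\beta\ne\alpha}m_{\alpha\beta}\phi_\beta$; the regularized mobility is $\tilde M_{\alpha\beta}=-m_{\alpha\beta}\tilde\phi_\alpha\tilde\phi_\beta$ for $\alpha\ne\beta$ and $\tilde M_{\alpha\alpha}=\tilde\phi_\alpha\sum_{\beta\neq\alpha}m_{\alpha\beta}\tilde\phi_\beta$ (so all row and column sums vanish); $\tilde M^\ddagger_{\alpha\beta}$ is its value at $\{\phi_{\alpha,h}^\ddagger\}$. Free energy. $\Psi(\{\phi_\alpha\},\{\nabla\phi_\alpha\})=\Psi_0(\{\phi_\alpha\})+\Psi_\nabla(\{\nabla\phi_\alpha\})$, with $\Psi_\nabla=\frac{\varepsilon_0}{2}\sum_{\alpha,\beta}\bar\kappa_{\alpha\beta}\nabla\phi_\alpha\cdot\nabla\phi_\beta$, $\varepsilon_0>0$, $(\bar\kappa_{\alpha\beta})$ symmetric positive semi-definite. The bulk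 energy is the Flory–Huggins-type energy $\Psi_0=\frac{\bar W}{\varepsilon_0}\big(\sum_\alpha\phi_\alpha\log\phi_\alpha-\sum_{\alpha,\beta}\chi_{\alpha\beta}\phi_\alpha\phi_\beta\big)$ with a constant $\bar W$ and symmetric interaction parameters $\chi_{\alpha\beta}=\chi_{\beta\alpha}$, and in the scheme and in the energy $\Psi_0$ is understood as a polynomial regularization of this function, so that it and its derivatives are defined also for values $\phi_\alpha$ outside $[0,1]$. Thus $\partial_{\nabla\phi_\alpha}\Psi(\{\phi_{\alpha,h}^{n+1}\})=\varepsilon_0\sum_\beta\bar\kappa_{\alpha\beta}\nabla\phi_{\beta,h}^{n+1}$. The bulk derivative is time-averaged: $$\partial_{\phi_\alpha}\Psi(\{\phi^n\},\{\phi^{n+1}\}):=\frac1{\tau_n}\int_{t^n}^{t^{n+1}}\partial_{\phi_\alpha}\Psi_0(\{\phi_\beta(s)\})\,ds,\qquad \phi_\beta(s)=\phi_\beta^{n+1}+(\phi_\beta^{n+1}-\phi_\beta^n)\frac{s-t^{n+1}}{\tau_n}.$$ Regularized energy. $\tilde{\mathcal E}(\mathbf v,\{\phi_\alpha\})=\int_\Omega \Psi(\{\phi_\alpha\},\{\nabla\phi_\alpha\})+\frac{\tilde\rho}{2}|\mathbf v|^2+\rho(\{\phi_\alpha\})\,g\,y\;dx$. Convection form. $\mathbf c_{\rm skw}(\mathbf u,\mathbf v,\mathbf w)=\frac12\langle(\mathbf u\cdot\nabla)\mathbf v,\mathbf w\rangle-\frac12\langle(\mathbf u\cdot\nabla)\mathbf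 w,\mathbf v\rangle$. Scheme (S). Given $(\{\phi_{\alpha,h}^0\},\mathbf v_h^0)\in\mathcal V_h^N\times\mathcal X_h$, a solution consists of $\phi_{\alpha,h}^{n}\in\mathcal V_h$, $\mathbf v_h^n\in\mathcal X_h$ ($0\le n\le n_T$) and $g_{\alpha,h}^{n+1}\in\mathcal V_h$, $\lambda_h^{n+1}\in\mathcal Q_h$ ($0\le n<n_T$) such that for all $0\le n<n_T$ and all $(\{\psi_{\alpha,h}\},\{\xi_{\alpha,h}\},\mathbf w_h,q_h)\in\mathcal V_h^N\times\mathcal V_h^N\times\mathcal X_h\times\mathcal Q_h$ (and every $\alpha$ in the second and third equations): $$\begin{aligned} &\langle\tfrac{\mathbf v_h^{n+1}}2 d_\tau^{n+1}\tilde\rho_h+\tilde\rho_h^n d_\tau^{n+1}\mathbf v_h,\mathbf w_h\rangle+\mathbf c_{\rm skw}(\rho_h^*\mathbf v_h^*,\mathbf v_h^{n+1},\mathbf w_h)+\langle\mathbf S(\{\phi_{\alpha,h}^\dagger\},\nabla\mathbf v_h^{n+1}),\nabla\mathbf w_h\rangle\\ &\quad-\langle\lambda_h^{n+1},\operatorname{div}\mathbf w_h\rangle+\sum_\alpha\langle\phi_{\alpha,h}^n\nabla(\rho_\alpha g_{\alpha,h}^{n+1}-\lambda_h^{n+1}),\mathbf w_h\rangle+\langle\rho(\{\phi_{\alpha,h}^n\})g\,\mathbf j,\mathbf w_h\rangle=0,\\ &\langle d_\tau^{n+1}\phi_{\alpha,h},\psi_{\alpha,h}\rangle-\langle\phi_{\alpha,h}^n\mathbf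 v_h^{n+1},\nabla\psi_{\alpha,h}\rangle+\langle\tfrac1{\rho_\alpha}\sum_\beta\tilde M_{\alpha\beta}^\ddagger\nabla g_{\beta,h}^{n+1},\nabla\psi_{\alpha,h}\rangle=0,\\ &\langle\rho_\alpha g_{\alpha,h}^{n+1},\xi_{\alpha,h}\rangle-\langle\partial_{\phi_\alpha}\Psi(\{\phi_{\alpha,h}^n\},\{\phi_{\alpha,h}^{n+1}\}),\xi_{\alpha,h}\rangle-\langle\partial_{\nabla\phi_\alpha}\Psi(\{\phi_{\alpha,h}^{n+1}\}),\nabla\xi_{\alpha,h}\rangle-\langle\lambda_h^{n+1},\xi_{\alpha,h}\rangle=0,\\ &\langle\operatorname{div}\mathbf v_h^{n+1},q_h\rangle+\langle\sum_{\alpha,\beta}\tfrac1{\rho_\alpha}\tilde M_{\alpha\beta}^\ddagger\nabla g_{\beta,h}^{n+1},\nabla q_h\rangle=0. \end{aligned}$$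
   Formalization: Under periodic boundary conditions the energy dissipation inequality is stated only for zero gravity (g = 0); with nonzero gravity on the torus a uniform flow at rest accelerates and the inequality fails. *)

theory Defs
  imports "HOL-Analysis.Analysis" "HOL-Computational_Algebra.Polynomial"
begin

text \<open>
  All derivatives below are classical pointwise derivatives. On the finite element spaces they
  exist off the element boundaries, i.e. almost everywhere, and agree there with the weak ones.
\<close>

definition gradient :: "(real^'d \<Rightarrow> real) \<Rightarrow> real^'d \<Rightarrow> real^'d" where
  "gradient f x = (\<chi> i. frechet_derivative f (at x) (axis i 1))"

text \<open>The entry in row \<open>i\<close> and column \<open>j\<close> is the derivative of component \<open>i\<close> in direction \<open>j\<close>.\<close>

definition vgradient :: "(real^'d \<Rightarrow> real^'d) \<Rightarrow> real^'d \<Rightarrow> real^'d^'d" where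
  "vgradient v x = jacobian v (at x)"

definition divergence :: "(real^'d \<Rightarrow> real^'d) \<Rightarrow> real^'d \<Rightarrow> real" where
  "divergence v x = trace (vgradient v x)"

text \<open>
  The inner product on \<open>real^'d^'d\<close> is the Frobenius product, the one on \<open>real\<close> is multiplication.
\<close>

definition pairing :: "(real^'d) set \<Rightarrow> (real^'d \<Rightarrow> 'b::real_inner) \<Rightarrow> (real^'d \<Rightarrow> 'b) \<Rightarrow> real" where
  "pairing \<Omega> a b = (LINT x|lebesgue_on \<Omega>. a x \<bullet> b x)"

definition convection ::
  "(real^'d) set \<Rightarrow> (real^'d \<Rightarrow> real^'d) \<Rightarrow> (real^'d \<Rightarrow> real^'d) \<Rightarrow> (real^'d \<Rightarrow> real^'d) \<Rightarrow> real" where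
  "convection \<Omega> u v w =
     1/2 * pairing \<Omega> (\<lambda>x. vgradient v x *v u x) w
   - 1/2 * pairing \<Omega> (\<lambda>x. vgradient w x *v u x) v"

text \<open>
  \<open>Torus L\<close>: the domain is a cube of side \<open>L\<close> with opposite faces identified. Functions on the
  torus are represented by functions on the whole space that are periodic with respect to
  \<open>torus_lattice L\<close>.
  \<open>Walls \<Gamma>\<^sub>1 \<Gamma>\<^sub>2\<close>: no-slip on \<open>\<Gamma>\<^sub>1\<close>, no-penetration on \<open>\<Gamma>\<^sub>2\<close>.
\<close>

datatype 'd boundary = Torus real | Walls "(real^'d) set" "(real^'d) set"

record 'd discretization =
  Omega :: "(real^'d) set"
  bdry :: "'d boundary"
  elements :: "(real^'d) set set"

definition torus_lattice :: "real \<Rightarrow> (real^'d) set" where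
  "torus_lattice L = {z. \<forall>i. \<exists>k::int. z $ i = L * of_int k}"

definition periodic_fun :: "real \<Rightarrow> (real^'d \<Rightarrow> 'b) \<Rightarrow> bool" where
  "periodic_fun L f \<longleftrightarrow> (\<forall>x. \<forall>z\<in>torus_lattice L. f (x + z) = f x)"

definition element :: "(real^'d) set \<Rightarrow> bool" where
  "element K \<longleftrightarrow> polytope K \<and> interior K \<noteq> {}"

text \<open>
  Geometrically conforming: two elements meet in a common (possibly empty) face. On the torus this
  is required of all lattice translates of the finitely many elements.
\<close>

definition conforming_partition :: "(real^'d) set \<Rightarrow> (real^'d) set set \<Rightarrow> bool" where
  "conforming_partition \<Omega> Th \<longleftrightarrow>
     finite Th \<and> (\<forall>K\<in>Th. element K) \<and>
     (\<forall>K\<in>Th. \<forall>K'\<in>Th. K \<inter> K' face_of K \<and> K \<inter> K' face_of K') \<and>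
     \<Omega> = interior (\<Union>Th)"

definition conforming_torus_partition :: "real \<Rightarrow> (real^'d) set set \<Rightarrow> bool" where
  "conforming_torus_partition L Th \<longleftrightarrow>
     finite Th \<and> (\<forall>K\<in>Th. element K) \<and>
     (\<forall>K\<in>Th. \<forall>K'\<in>Th. \<forall>z\<in>torus_lattice L.
        K \<inter> (+) z ` K' face_of K \<and> K \<inter> (+) z ` K' face_of (+) z ` K') \<and>
     (\<Union>K\<in>Th. \<Union>z\<in>torus_lattice L. (+) z ` K) = UNIV"

definition discretization_ok :: "('d::finite) discretization \<Rightarrow> bool" where
  "discretization_ok D \<longleftrightarrow>
     (case bdry D of
        Torus L \<Rightarrow> L > 0 \<and> (\<exists>a. Omega D = box a (a + (\<chi> i. L))) \<and>
                   conforming_torus_partition L (elements D)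
      | Walls \<Gamma>\<^sub>1 \<Gamma>\<^sub>2 \<Rightarrow> Omega D \<noteq> {} \<and> open (Omega D) \<and> connected (Omega D) \<and>
                   frontier (Omega D) = \<Gamma>\<^sub>1 \<union> \<Gamma>\<^sub>2 \<and>
                   conforming_partition (Omega D) (elements D))"

text \<open>
  A domain partitioned into polytopes has a polyhedral boundary, so the normal exists exactly at the
  boundary points near which the domain is an open half-space; it is then unique.
\<close>

definition outward_normal :: "(real^'d) set \<Rightarrow> real^'d \<Rightarrow> real^'d \<Rightarrow> bool" where
  "outward_normal \<Omega> x n \<longleftrightarrow>
     norm n = 1 \<and> (\<exists>r>0. \<Omega> \<inter> ball x r = {y \<in> ball x r. (y - x) \<bullet> n < 0})"

definition polynomial_on :: "nat \<Rightarrow> (real^'d) set \<Rightarrow> (real^'d \<Rightarrow> real) \<Rightarrow> bool" where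
  "polynomial_on k K f \<longleftrightarrow>
     (\<exists>c :: ('d \<Rightarrow> nat) \<Rightarrow> real. \<forall>x\<in>K.
        f x = (\<Sum>m | (\<Sum>i\<in>UNIV. m i) \<le> k. c m * (\<Prod>i\<in>UNIV. (x $ i) ^ m i)))"

definition continuous_field ::
  "('d::finite) discretization \<Rightarrow> (real^'d \<Rightarrow> 'b::topological_space) \<Rightarrow> bool" where
  "continuous_field D f \<longleftrightarrow>
     (case bdry D of
        Torus L \<Rightarrow> continuous_on UNIV f \<and> periodic_fun L f
      | Walls \<Gamma>\<^sub>1 \<Gamma>\<^sub>2 \<Rightarrow> continuous_on (closure (Omega D)) f)"

text \<open>For first-order weak derivatives \<open>C\<^sup>1\<close> test functions suffice.\<close>

definition test_function :: "('d::finite) discretization \<Rightarrow> (real^'d \<Rightarrow> real) \<Rightarrow> bool" where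
  "test_function D \<psi> \<longleftrightarrow>
     (\<forall>x. \<psi> differentiable (at x)) \<and> continuous_on UNIV (gradient \<psi>) \<and>
     (case bdry D of
        Torus L \<Rightarrow> periodic_fun L \<psi>
      | Walls \<Gamma>\<^sub>1 \<Gamma>\<^sub>2 \<Rightarrow> compact (closure {x. \<psi> x \<noteq> 0}) \<and> closure {x. \<psi> x \<noteq> 0} \<subseteq> Omega D)"

definition square_integrable :: "(real^'d) set \<Rightarrow> (real^'d \<Rightarrow> real) \<Rightarrow> bool" where
  "square_integrable \<Omega> f \<longleftrightarrow>
     f \<in> borel_measurable (lebesgue_on \<Omega>) \<and> integrable (lebesgue_on \<Omega>) (\<lambda>x. (f x)\<^sup>2)"

definition H1 :: "('d::finite) discretization \<Rightarrow> (real^'d \<Rightarrow> real) set" where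
  "H1 D = {f. square_integrable (Omega D) f \<and>
     (\<exists>G :: real^'d \<Rightarrow> real^'d. \<forall>i. square_integrable (Omega D) (\<lambda>x. G x $ i) \<and>
        (\<forall>\<psi>. test_function D \<psi> \<longrightarrow>
           pairing (Omega D) f (\<lambda>x. gradient \<psi> x $ i) = - pairing (Omega D) (\<lambda>x. G x $ i) \<psi>))}"

definition V_h :: "('d::finite) discretization \<Rightarrow> (real^'d \<Rightarrow> real) set" where
  "V_h D = {f \<in> H1 D. continuous_field D f \<and> (\<forall>K\<in>elements D. polynomial_on 1 K f)}"

definition X_h :: "('d::finite) discretization \<Rightarrow> (real^'d \<Rightarrow> real^'d) set" where
  "X_h D = {v. (\<forall>i. (\<lambda>x. v x $ i) \<in> H1 D) \<and> continuous_field D v \<and>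
     (\<forall>K\<in>elements D. \<forall>i. polynomial_on 2 K (\<lambda>x. v x $ i)) \<and>
     (case bdry D of
        Torus L \<Rightarrow> True
      | Walls \<Gamma>\<^sub>1 \<Gamma>\<^sub>2 \<Rightarrow> (\<forall>x\<in>\<Gamma>\<^sub>1. v x = 0) \<and>
                   (\<forall>x\<in>\<Gamma>\<^sub>2. \<forall>n. outward_normal (Omega D) x n \<longrightarrow> v x \<bullet> n = 0))}"

definition Q_h :: "('d::finite) discretization \<Rightarrow> (real^'d \<Rightarrow> real) set" where
  "Q_h D = {q \<in> V_h D. pairing (Omega D) q (\<lambda>_. 1) = 0}"

record ('d, 'n) physics =
  dens :: "'n \<Rightarrow> real"
  viscosity :: "('n \<Rightarrow> real) \<Rightarrow> real"
  grav :: real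
  vert :: 'd
  cutoff :: real
  mob :: "'n \<Rightarrow> 'n \<Rightarrow> real"
  eps0 :: real
  Wbar :: real
  cap :: "'n \<Rightarrow> 'n \<Rightarrow> real"
  chi :: "'n \<Rightarrow> 'n \<Rightarrow> real"
  slogs :: "real \<Rightarrow> real"

text \<open>
  \<open>slogs\<close> replaces \<open>s log s\<close> in the Flory--Huggins energy. The replacement is continuously
  differentiable on the whole line and made up of pieces of \<open>s log s\<close> and of finitely many
  polynomials; both a cut-off with polynomial continuation and a single global polynomial qualify.
\<close>

definition polynomial_regularization :: "(real \<Rightarrow> real) \<Rightarrow> bool" where
  "polynomial_regularization f \<longleftrightarrow>
     (\<exists>f'. continuous_on UNIV f' \<and> (\<forall>s. (f has_real_derivative f' s) (at s))) \<and>
     (\<exists>P :: real poly set. finite P \<and> (\<forall>s. s > 0 \<and> f s = s * ln s \<or> (\<exists>p\<in>P. f s = poly p s)))"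

definition physics_ok :: "('d, 'n::finite) physics \<Rightarrow> bool" where
  "physics_ok P \<longleftrightarrow>
     (\<forall>\<alpha>. dens P \<alpha> > 0) \<and>
     0 < cutoff P \<and> cutoff P < 1 \<and>
     (\<forall>\<alpha> \<beta>. mob P \<alpha> \<beta> = mob P \<beta> \<alpha>) \<and>
     eps0 P > 0 \<and>
     (\<forall>\<alpha> \<beta>. cap P \<alpha> \<beta> = cap P \<beta> \<alpha>) \<and>
     (\<forall>z :: 'n \<Rightarrow> real. (\<Sum>\<alpha>\<in>UNIV. \<Sum>\<beta>\<in>UNIV. cap P \<alpha> \<beta> * z \<alpha> * z \<beta>) \<ge> 0) \<and>
     (\<forall>\<alpha> \<beta>. chi P \<alpha> \<beta> = chi P \<beta> \<alpha>) \<and>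
     polynomial_regularization (slogs P)"

text \<open>In the following, \<open>s :: 'n \<Rightarrow> real\<close> is the tuple of phase values at one point.\<close>

definition mixture_density :: "('d, 'n::finite) physics \<Rightarrow> ('n \<Rightarrow> real) \<Rightarrow> real" where
  "mixture_density P s = (\<Sum>\<alpha>\<in>UNIV. dens P \<alpha> * s \<alpha>)"

definition truncate :: "('d, 'n) physics \<Rightarrow> real \<Rightarrow> real" where
  "truncate P r = min 1 (max (cutoff P) r)"

definition mixture_density_reg :: "('d, 'n::finite) physics \<Rightarrow> ('n \<Rightarrow> real) \<Rightarrow> real" where
  "mixture_density_reg P s = (\<Sum>\<alpha>\<in>UNIV. dens P \<alpha> * truncate P (s \<alpha>))"

definition mobility_reg :: "('d, 'n::finite) physics \<Rightarrow> ('n \<Rightarrow> real) \<Rightarrow> 'n \<Rightarrow> 'n \<Rightarrow> real" where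
  "mobility_reg P s \<alpha> \<beta> =
     (if \<alpha> = \<beta> then truncate P (s \<alpha>) * (\<Sum>\<gamma>\<in>UNIV - {\<alpha>}. mob P \<alpha> \<gamma> * truncate P (s \<gamma>))
      else - mob P \<alpha> \<beta> * truncate P (s \<alpha>) * truncate P (s \<beta>))"

definition stress :: "('d, 'n) physics \<Rightarrow> ('n \<Rightarrow> real) \<Rightarrow> real^'d^'d \<Rightarrow> real^'d^'d" where
  "stress P s A =
     viscosity P s *\<^sub>R (2 *\<^sub>R ((1/2) *\<^sub>R (A + transpose A)) + (- 2 / real CARD('d) * trace A) *\<^sub>R mat 1)"

definition height :: "('d, 'n) physics \<Rightarrow> real^'d \<Rightarrow> real" where
  "height P x = x $ vert P"

definition Psi0 :: "('d, 'n::finite) physics \<Rightarrow> ('n \<Rightarrow> real) \<Rightarrow> real" where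
  "Psi0 P s = Wbar P / eps0 P *
     ((\<Sum>\<alpha>\<in>UNIV. slogs P (s \<alpha>)) - (\<Sum>\<alpha>\<in>UNIV. \<Sum>\<beta>\<in>UNIV. chi P \<alpha> \<beta> * s \<alpha> * s \<beta>))"

definition dPsi0 :: "('d, 'n::finite) physics \<Rightarrow> 'n \<Rightarrow> ('n \<Rightarrow> real) \<Rightarrow> real" where
  "dPsi0 P \<alpha> s = deriv (\<lambda>r. Psi0 P (s(\<alpha> := r))) (s \<alpha>)"

definition Psi_grad :: "('d, 'n::finite) physics \<Rightarrow> ('n \<Rightarrow> real^'d) \<Rightarrow> real" where
  "Psi_grad P p = eps0 P / 2 * (\<Sum>\<alpha>\<in>UNIV. \<Sum>\<beta>\<in>UNIV. cap P \<alpha> \<beta> * (p \<alpha> \<bullet> p \<beta>))"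

definition dPsi_grad :: "('d, 'n::finite) physics \<Rightarrow> 'n \<Rightarrow> ('n \<Rightarrow> real^'d) \<Rightarrow> real^'d" where
  "dPsi_grad P \<alpha> p = eps0 P *\<^sub>R (\<Sum>\<beta>\<in>UNIV. cap P \<alpha> \<beta> *\<^sub>R p \<beta>)"

definition energy ::
  "('d::finite) discretization \<Rightarrow> ('d, 'n::finite) physics
    \<Rightarrow> (real^'d \<Rightarrow> real^'d) \<Rightarrow> ('n \<Rightarrow> real^'d \<Rightarrow> real) \<Rightarrow> real" where
  "energy D P v \<phi> =
     (LINT x|lebesgue_on (Omega D).
        Psi0 P (\<lambda>\<alpha>. \<phi> \<alpha> x) + Psi_grad P (\<lambda>\<alpha>. gradient (\<phi> \<alpha>) x)
      + mixture_density_reg P (\<lambda>\<alpha>. \<phi> \<alpha> x) / 2 * (norm (v x))\<^sup>2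
      + mixture_density P (\<lambda>\<alpha>. \<phi> \<alpha> x) * grav P * height P x)"

text \<open>\<open>s\<^sub>0\<close> and \<open>s\<^sub>1\<close> are the phase values at one point in space at the times \<open>a\<close> and \<open>b\<close>.\<close>

definition dPsi0_avg ::
  "('d, 'n::finite) physics \<Rightarrow> 'n \<Rightarrow> real \<Rightarrow> real \<Rightarrow> ('n \<Rightarrow> real) \<Rightarrow> ('n \<Rightarrow> real) \<Rightarrow> real" where
  "dPsi0_avg P \<alpha> a b s\<^sub>0 s\<^sub>1 =
     1 / (b - a) *
     integral {a..b} (\<lambda>r. dPsi0 P \<alpha> (\<lambda>\<beta>. s\<^sub>1 \<beta> + (s\<^sub>1 \<beta> - s\<^sub>0 \<beta>) * ((r - b) / (b - a))))"

text \<open>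
  \<open>c\<close>, \<open>d\<close>, \<open>e\<close> give the time levels marked by a star, a dagger and a double dagger on each step.
  \<open>g\<close> and \<open>lam\<close> are used at the indices \<open>1, \<dots>, nT\<close> only.
\<close>

definition is_solution ::
  "('d::finite) discretization \<Rightarrow> ('d, 'n::finite) physics \<Rightarrow> (nat \<Rightarrow> real) \<Rightarrow> nat
    \<Rightarrow> (nat \<Rightarrow> nat) \<Rightarrow> (nat \<Rightarrow> nat) \<Rightarrow> (nat \<Rightarrow> nat)
    \<Rightarrow> (nat \<Rightarrow> 'n \<Rightarrow> real^'d \<Rightarrow> real) \<Rightarrow> (nat \<Rightarrow> real^'d \<Rightarrow> real^'d)
    \<Rightarrow> (nat \<Rightarrow> 'n \<Rightarrow> real^'d \<Rightarrow> real) \<Rightarrow> (nat \<Rightarrow> real^'d \<Rightarrow> real) \<Rightarrow> bool" where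
  "is_solution D P t nT c d e \<phi> v g lam \<longleftrightarrow>
    (\<forall>n\<le>nT. (\<forall>\<alpha>. \<phi> n \<alpha> \<in> V_h D) \<and> v n \<in> X_h D) \<and>
    (\<forall>n<nT. (\<forall>\<alpha>. g (Suc n) \<alpha> \<in> V_h D) \<and> lam (Suc n) \<in> Q_h D) \<and>
    (\<forall>n<nT.
      let \<Omega> = Omega D; \<tau> = t (Suc n) - t n;
          \<Phi> = (\<lambda>k x \<alpha>. \<phi> k \<alpha> x);
          M = (\<lambda>\<alpha> \<beta> x. mobility_reg P (\<Phi> (e n) x) \<alpha> \<beta>)
      in
      (\<forall>w\<in>X_h D.
         pairing \<Omega>
           (\<lambda>x. ((mixture_density_reg P (\<Phi> (Suc n) x) - mixture_density_reg P (\<Phi> n x)) / \<tau>) *\<^sub>R ((1/2) *\<^sub>R v (Suc n) x)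
              + mixture_density_reg P (\<Phi> n x) *\<^sub>R ((1/\<tau>) *\<^sub>R (v (Suc n) x - v n x))) w
         + convection \<Omega> (\<lambda>x. mixture_density P (\<Phi> (c n) x) *\<^sub>R v (c n) x) (v (Suc n)) w
         + pairing \<Omega> (\<lambda>x. stress P (\<Phi> (d n) x) (vgradient (v (Suc n)) x)) (vgradient w)
         - pairing \<Omega> (lam (Suc n)) (divergence w)
         + (\<Sum>\<alpha>\<in>UNIV. pairing \<Omega>
              (\<lambda>x. \<phi> n \<alpha> x *\<^sub>R gradient (\<lambda>x. dens P \<alpha> * g (Suc n) \<alpha> x - lam (Suc n) x) x) w)
         + pairing \<Omega> (\<lambda>x. (mixture_density P (\<Phi> n x) * grav P) *\<^sub>R gradient (height P) x) w
         = 0) \<and>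
      (\<forall>\<alpha>. \<forall>\<psi>\<in>V_h D.
         pairing \<Omega> (\<lambda>x. (\<phi> (Suc n) \<alpha> x - \<phi> n \<alpha> x) / \<tau>) \<psi>
         - pairing \<Omega> (\<lambda>x. \<phi> n \<alpha> x *\<^sub>R v (Suc n) x) (gradient \<psi>)
         + pairing \<Omega>
             (\<lambda>x. (1 / dens P \<alpha>) *\<^sub>R (\<Sum>\<beta>\<in>UNIV. M \<alpha> \<beta> x *\<^sub>R gradient (g (Suc n) \<beta>) x)) (gradient \<psi>)
         = 0) \<and>
      (\<forall>\<alpha>. \<forall>\<xi>\<in>V_h D.
         pairing \<Omega> (\<lambda>x. dens P \<alpha> * g (Suc n) \<alpha> x) \<xi>
         - pairing \<Omega> (\<lambda>x. dPsi0_avg P \<alpha> (t n) (t (Suc n)) (\<Phi> n x) (\<Phi> (Suc n) x)) \<xi>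
         - pairing \<Omega> (\<lambda>x. dPsi_grad P \<alpha> (\<lambda>\<beta>. gradient (\<phi> (Suc n) \<beta>) x)) (gradient \<xi>)
         - pairing \<Omega> (lam (Suc n)) \<xi>
         = 0) \<and>
      (\<forall>q\<in>Q_h D.
         pairing \<Omega> (divergence (v (Suc n))) q
         + pairing \<Omega>
             (\<lambda>x. \<Sum>\<alpha>\<in>UNIV. \<Sum>\<beta>\<in>UNIV. (M \<alpha> \<beta> x / dens P \<alpha>) *\<^sub>R gradient (g (Suc n) \<beta>) x) (gradient q)
         = 0))"

text \<open>
  \<open>d\<close> and \<open>e\<close> are the time levels of the stress and of the mobility, \<open>k\<close> that of the velocity and of
  the potentials.
\<close>

definition dissipation ::
  "('d::finite) discretization \<Rightarrow> ('d, 'n::finite) physics \<Rightarrow> nat \<Rightarrow> nat \<Rightarrow> nat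
    \<Rightarrow> (nat \<Rightarrow> 'n \<Rightarrow> real^'d \<Rightarrow> real) \<Rightarrow> (nat \<Rightarrow> real^'d \<Rightarrow> real^'d)
    \<Rightarrow> (nat \<Rightarrow> 'n \<Rightarrow> real^'d \<Rightarrow> real) \<Rightarrow> real" where
  "dissipation D P d e k \<phi> v g =
     pairing (Omega D) (\<lambda>x. stress P (\<lambda>\<alpha>. \<phi> d \<alpha> x) (vgradient (v k) x)) (vgradient (v k))
     + (\<Sum>\<alpha>\<in>UNIV. \<Sum>\<beta>\<in>UNIV.
          pairing (Omega D) (\<lambda>x. mobility_reg P (\<lambda>\<gamma>. \<phi> e \<gamma> x) \<alpha> \<beta> *\<^sub>R gradient (g k \<beta>) x) (gradient (g k \<alpha>)))"

end

theory Submission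
  imports Defs
begin

text \<open>
  Testing the momentum equation with the new velocity, the phase equations with
  \<open>\<rho>\<^sub>\<alpha> g\<^sub>\<alpha> - \<lambda>\<close>, the potential equations with the discrete time derivatives of the phases and the
  constraint with \<open>\<lambda>\<close> makes all coupling terms cancel; what remains is estimated by convexity of the
  gradient energy and of \<open>|v|\<^sup>2\<close>, while the time average turns the bulk term into an exact difference.
  Gravity is handled by the test function \<open>\<rho>\<^sub>\<alpha> g y\<close>, whose diffusive contribution vanishes since the
  columns of the mobility matrix sum to zero.

  If the phases sum to one, then the increment \<open>s\<close> of their sum lies in \<open>Q\<^sub>h\<close>; testing with \<open>s\<close> gives
  \<open>\<langle>s, s\<rangle> = 0\<close>, provided that \<open>\<langle>v, \<nabla>s\<rangle> = - \<langle>div v, s\<rangle>\<close>. This is the only place where a divergence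
  theorem is needed. On a polyhedral domain it is proved without surface integrals: the zero
  extension of \<open>s v\<close> is smooth off finitely many hyperplanes, and away from their pairwise
  intersections its component normal to each hyperplane is continuous. A partition of unity isolates
  a single hyperplane, where the divergence splits into derivatives along it and one derivative of
  the normal component, each with vanishing integral. The cut-off that removes an
  \<open>\<epsilon>\<close>-neighbourhood of the intersections has gradient \<open>O(1/\<epsilon>)\<close> on a set of measure \<open>O(\<epsilon>\<^sup>2)\<close>.
\<close>

section \<open>Gradients and integrals of directional derivatives\<close>

text \<open>Finite element functions are differentiated pointwise, and on the element boundaries
  these derivatives mean nothing. Identities between integrands therefore hold only off a null set,
  and every splitting of an integral needs integrability. Both points are settled by showing that
  the integrands concerned are essentially bounded. The obstacle is a wall on which only the normal
  component of the velocity vanishes: the zero extension then jumps tangentially, and where several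
  faces meet there is no normal and hence no information beyond boundedness. What saves the argument
  is that those places have codimension two. All integrals of derivatives, on the torus as well, go
  back to one principle: difference quotients integrate to zero wherever the integral is invariant
  under small shifts, and dominated convergence carries this over to the derivative. The height is
  not a periodic function, so the test function for gravity exists only between walls; this is why
  the energy inequality on a torus is stated for vanishing gravity.\<close>

abbreviation has_gradient :: "(real^'d \<Rightarrow> real) \<Rightarrow> real^'d \<Rightarrow> real^'d \<Rightarrow> bool" where
  "has_gradient f G x \<equiv> (f has_derivative (\<lambda>y. G \<bullet> y)) (at x)"

lemma gradient_eqI:
  assumes "has_gradient f G x" shows "gradient f x = G"
proof -
  have "frechet_derivative f (at x) = (\<lambda>y. G \<bullet> y)"
    using assms frechet_derivative_at by metis
  then show ?thesis
    by (simp add: gradient_def vec_eq_iff inner_axis)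
qed

text \<open>A linear functional is determined by its values on the axes, and those are the entries
  of \<open>gradient\<close>.\<close>

lemma has_gradient_gradient:
  assumes "f differentiable (at x)" shows "has_gradient f (gradient f x) x"
proof -
  let ?L = "frechet_derivative f (at x)"
  have L: "(f has_derivative ?L) (at x)"
    using assms frechet_derivative_works by blast
  then have lin: "linear ?L"
    using has_derivative_linear by blast
  have "?L y = gradient f x \<bullet> y" for y
  proof -
    have "?L y = ?L (\<Sum>i\<in>UNIV. y $ i *\<^sub>R axis i 1)"
      using basis_expansion[of y] by (simp add: scalar_mult_eq_scaleR)
    also have "\<dots> = (\<Sum>i\<in>UNIV. y $ i * ?L (axis i 1))"
      using lin by (simp add: linear_sum linear_scale)
    also have "\<dots> = gradient f x \<bullet> y"
      by (simp add: gradient_def inner_vec_def mult.commute)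
    finally show ?thesis .
  qed
  then show ?thesis
    using L by (metis (no_types, lifting) ext)
qed

lemma has_gradient_imp_differentiable: "has_gradient f G x \<Longrightarrow> f differentiable (at x)"
  by (auto simp: differentiable_def)

lemma has_gradient_const: "has_gradient (\<lambda>x. c) 0 x"
  by simp

lemma has_gradient_inner: "has_gradient (\<lambda>x. a \<bullet> x) a x"
  by (auto intro!: derivative_eq_intros)

lemma has_gradient_nth: "has_gradient (\<lambda>x. x $ i) (axis i 1) x"
  using has_gradient_inner[of "axis i 1"] by (simp add: inner_axis')

lemma has_gradient_add:
  "has_gradient f F x \<Longrightarrow> has_gradient g G x \<Longrightarrow> has_gradient (\<lambda>x. f x + g x) (F + G) x"
  by (auto intro!: derivative_eq_intros simp: inner_add_left)

lemma has_gradient_mult: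
  "has_gradient f F x \<Longrightarrow> has_gradient g G x \<Longrightarrow>
   has_gradient (\<lambda>x. f x * g x) (f x *\<^sub>R G + g x *\<^sub>R F) x"
  by (auto intro!: derivative_eq_intros simp: inner_add_left)

lemma has_gradient_cmult: "has_gradient f F x \<Longrightarrow> has_gradient (\<lambda>x. c * f x) (c *\<^sub>R F) x"
  by (auto intro!: derivative_eq_intros)

lemma has_gradient_diff:
  "has_gradient f F x \<Longrightarrow> has_gradient g G x \<Longrightarrow> has_gradient (\<lambda>x. f x - g x) (F - G) x"
  by (auto intro!: derivative_eq_intros simp: inner_diff_left)

lemma has_gradient_sum:
  "(\<And>i. i \<in> I \<Longrightarrow> has_gradient (f i) (F i) x) \<Longrightarrow> has_gradient (\<lambda>x. \<Sum>i\<in>I. f i x) (\<Sum>i\<in>I. F i) x"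
  unfolding inner_sum_left by (rule has_derivative_sum)

lemma has_gradient_prod:
  assumes "\<And>i. i \<in> I \<Longrightarrow> has_gradient (f i) (F i) x"
  shows "has_gradient (\<lambda>x. \<Prod>i\<in>I. f i x) (\<Sum>i\<in>I. (\<Prod>j\<in>I - {i}. f j x) *\<^sub>R F i) x"
  using has_derivative_prod[of I f "\<lambda>i y. F i \<bullet> y" x UNIV] assms
  by (simp add: inner_sum_left mult.commute)

lemma has_gradient_compose:
  assumes "(\<theta> has_real_derivative \<theta>') (at (f x))" "has_gradient f F x"
  shows "has_gradient (\<lambda>x. \<theta> (f x)) (\<theta>' *\<^sub>R F) x"
proof -
  have "(\<theta> \<circ> f has_derivative (\<lambda>y. \<theta>' * y) \<circ> (\<lambda>y. F \<bullet> y)) (at x)"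
    using assms by (intro diff_chain_at) (simp_all add: has_field_derivative_def)
  then show ?thesis by (simp add: o_def)
qed

lemma has_gradient_transform:
  assumes "has_gradient f F x" "open S" "x \<in> S" "\<And>y. y \<in> S \<Longrightarrow> f y = g y"
  shows "has_gradient g F x"
  using assms has_derivative_transform_within_open by blast

text \<open>Reduces derivatives in space to one real variable, where the mean value inequality is at
  hand.\<close>

lemma has_gradient_line:
  assumes "has_gradient f G (x + s *\<^sub>R e)"
  shows "((\<lambda>s. f (x + s *\<^sub>R e)) has_real_derivative (G \<bullet> e)) (at s)"
proof -
  have "((\<lambda>s. x + s *\<^sub>R e) has_derivative (\<lambda>h. h *\<^sub>R e)) (at s)"
    by (auto intro!: derivative_eq_intros)
  from diff_chain_at[OF this assms] show ?thesis
    by (simp add: o_def has_field_derivative_def mult.commute[of _ "G \<bullet> e"])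
qed

lemma has_gradient_continuous: "has_gradient f G x \<Longrightarrow> isCont f x"
  using has_derivative_continuous by blast

section \<open>Continuously differentiable functions\<close>

definition C1 :: "(real^'d \<Rightarrow> real) \<Rightarrow> bool" where
  "C1 f \<longleftrightarrow> (\<forall>x. f differentiable (at x)) \<and> continuous_on UNIV (gradient f)"

lemma C1I:
  assumes "\<And>x. has_gradient f (G x) x" "continuous_on UNIV G"
  shows "C1 f"
proof -
  have "gradient f = G" using assms(1) gradient_eqI by blast
  then show ?thesis using assms has_gradient_imp_differentiable unfolding C1_def by metis
qed

lemma C1_has_gradient: "C1 f \<Longrightarrow> has_gradient f (gradient f x) x"
  by (simp add: C1_def has_gradient_gradient)

lemma C1_continuous: "C1 f \<Longrightarrow> continuous_on S f"
  unfolding C1_def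
  by (meson continuous_at_imp_continuous_on differentiable_imp_continuous_within)

lemma C1_gradient_continuous: "C1 f \<Longrightarrow> continuous_on S (gradient f)"
  unfolding C1_def by (meson continuous_on_subset subset_UNIV)

lemma C1_const: "C1 (\<lambda>x. c)"
  by (rule C1I[OF has_gradient_const]) simp

lemma C1_nth: "C1 (\<lambda>x. x $ i)"
  by (rule C1I[OF has_gradient_nth]) simp

lemma C1_add: "C1 f \<Longrightarrow> C1 g \<Longrightarrow> C1 (\<lambda>x. f x + g x)"
  by (rule C1I[OF has_gradient_add[OF C1_has_gradient C1_has_gradient]])
    (auto intro!: continuous_intros C1_gradient_continuous)

lemma C1_mult: "C1 f \<Longrightarrow> C1 g \<Longrightarrow> C1 (\<lambda>x. f x * g x)"
  by (rule C1I[OF has_gradient_mult[OF C1_has_gradient C1_has_gradient]])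
    (auto intro!: continuous_intros C1_gradient_continuous C1_continuous)

lemma C1_sum: "(\<And>i. i \<in> I \<Longrightarrow> C1 (f i)) \<Longrightarrow> C1 (\<lambda>x. \<Sum>i\<in>I. f i x)"
  by (induction I rule: infinite_finite_induct) (auto simp: C1_const intro!: C1_add)

lemma C1_prod: "(\<And>i. i \<in> I \<Longrightarrow> C1 (f i)) \<Longrightarrow> C1 (\<lambda>x. \<Prod>i\<in>I. f i x)"
  by (induction I rule: infinite_finite_induct) (auto simp: C1_const intro!: C1_mult)

lemma C1_power: "C1 f \<Longrightarrow> C1 (\<lambda>x. f x ^ k)"
  by (induction k) (auto simp: C1_const intro!: C1_mult)

text \<open>Meant for the torus: on a lattice translate of an element, a periodic function is the
  translate of its polynomial on that element.\<close>

lemma C1_translate: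
  assumes "C1 f" shows "C1 (\<lambda>x. f (x - z))"
proof (rule C1I)
  fix x
  have "((\<lambda>x. x - z) has_derivative (\<lambda>y. y)) (at x)"
    by (auto intro!: derivative_eq_intros)
  from diff_chain_at[OF this C1_has_gradient[OF assms]]
  show "has_gradient (\<lambda>x. f (x - z)) (gradient f (x - z)) x"
    by (simp add: o_def)
next
  show "continuous_on UNIV (\<lambda>x. gradient f (x - z))"
    by (rule continuous_on_compose2[OF C1_gradient_continuous[OF assms, of UNIV]])
      (simp_all add: continuous_on_diff continuous_on_id continuous_on_const)
qed

lemma C1_bounded_on_compact:
  assumes "C1 f" "compact K"
  obtains B where "\<And>x. x \<in> K \<Longrightarrow> \<bar>f x\<bar> \<le> B" "\<And>x. x \<in> K \<Longrightarrow> norm (gradient f x) \<le> B"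
proof -
  have "bounded (f ` K)" "bounded (gradient f ` K)"
    using assms by (auto intro!: compact_imp_bounded compact_continuous_image C1_continuous C1_gradient_continuous)
  then obtain B1 B2 where "\<forall>x\<in>K. norm (f x) \<le> B1" "\<forall>x\<in>K. norm (gradient f x) \<le> B2"
    unfolding bounded_iff by auto
  then show ?thesis using that[of "max B1 B2"] by fastforce
qed

text \<open>The mean value inequality survives finitely many exceptional points as long as the
  function is continuous. Such points arise where a segment crosses element boundaries.\<close>

lemma abs_diff_le_of_derivative_bound:
  fixes f :: "real \<Rightarrow> real"
  assumes "finite A" "a \<le> b" "continuous_on {a..b} f"
    and "\<And>s. s \<in> {a..b} - A \<Longrightarrow> (f has_real_derivative f' s) (at s) \<and> \<bar>f' s\<bar> \<le> C" and "0 \<le> C"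
  shows "\<bar>f b - f a\<bar> \<le> C * (b - a)"
proof -
  have int: "(f' has_integral (f b - f a)) {a..b}"
    using assms by (intro fundamental_theorem_of_calculus_strong[of A])
      (auto simp: has_real_derivative_iff_has_vector_derivative)
  \<comment> \<open>On \<open>A\<close> the values of \<open>f'\<close> are arbitrary; replacing
    them by 0 keeps the integral and makes the bound hold on the whole interval.\<close>
  have "((\<lambda>s. if s \<in> A then 0 else f' s) has_integral (f b - f a)) {a..b}"
    by (rule has_integral_spike_finite[OF assms(1) _ int]) auto
  then have "norm (f b - f a) \<le> C * measure lborel (cbox a b)"
    using assms by (intro has_integral_bound[where f = "\<lambda>s. if s \<in> A then 0 else f' s"]) auto
  then show ?thesis using assms(2) by simp
qed

lemma finite_measure_lebesgue_on: "S \<in> lmeasurable \<Longrightarrow> finite_measure (lebesgue_on S)"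
proof -
  assume S: "S \<in> lmeasurable"
  then have "emeasure (lebesgue_on S) S = emeasure lebesgue S"
    by (intro emeasure_restrict_space) (auto simp: fmeasurableD)
  then show ?thesis
    using fmeasurableD2[OF S] by (intro finite_measureI) simp
qed

lemma AE_lebesgue_on_notin:
  assumes "negligible N" "S \<in> sets lebesgue" shows "AE x in lebesgue_on S. x \<notin> N"
proof -
  have "AE x in lebesgue. x \<notin> N"
    using assms AE_not_in negligible_iff_null_sets by blast
  then show ?thesis using assms(2) by (auto simp: AE_restrict_space_iff)
qed

text \<open>Lebesgue measure is complete, so the arbitrary values that a derivative takes on a null
  set cannot spoil its measurability.\<close>

lemma measurable_lebesgue_on_diff_negligible:
  fixes f :: "'a::euclidean_space \<Rightarrow> 'b::euclidean_space"
  assumes "f \<in> borel_measurable (lebesgue_on (S - N))" "negligible N" "S \<in> sets lebesgue"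
  shows "f \<in> borel_measurable (lebesgue_on S)"
proof -
  have "negligible (N \<inter> S)" using assms(2) negligible_Int by blast
  then have "N \<inter> S \<in> null_sets (lebesgue_on S)"
    using assms(3) by (simp add: negligible_iff_null_sets null_sets_restrict_space)
  from borel_measurable_diff_null[OF this assms(3), of f] assms(1) show ?thesis
    by (simp add: Diff_Int2 Diff_Int)
qed

lemma borel_imp_measurable_lebesgue_on:
  "f \<in> borel_measurable borel \<Longrightarrow> f \<in> borel_measurable (lebesgue_on S)"
  by (intro measurable_restrict_space1 measurable_completion) simp

lemma directional_derivative_limit:
  fixes f :: "real^'d \<Rightarrow> real"
  assumes "((\<lambda>s. f (x + s *\<^sub>R e)) has_real_derivative D) (at 0)"
  shows "(\<lambda>k. real (Suc k) * (f (x + (1 / real (Suc k)) *\<^sub>R e) - f x)) \<longlonglongrightarrow> D"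
proof -
  have "((\<lambda>h. (f (x + h *\<^sub>R e) - f x) / h) \<longlongrightarrow> D) (at 0)"
    using assms by (simp add: DERIV_def)
  moreover have "filterlim (\<lambda>k. 1 / real (Suc k)) (at 0) sequentially"
    using LIMSEQ_inverse_real_of_nat by (simp add: filterlim_at inverse_eq_divide)
  ultimately have "((\<lambda>k. (f (x + (1 / real (Suc k)) *\<^sub>R e) - f x) / (1 / real (Suc k))) \<longlongrightarrow> D) sequentially"
    by (rule filterlim_compose)
  then show ?thesis by (simp add: mult.commute)
qed

text \<open>The difference quotients of \<open>f\<close> in direction \<open>e\<close> integrate to
  zero by \<open>shift\<close>, are bounded by \<open>C\<close> through the mean value inequality,
  and converge to \<open>f'\<close> off \<open>N\<close>; dominated convergence does the rest. A
  segment starting at \<open>x\<close> may contain finitely many points without derivative, but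
  \<open>0 \<notin> A\<close> keeps \<open>x\<close> itself out of them, which is what the limit
  needs.\<close>

lemma integral_directional_derivative:
  fixes f :: "real^'d \<Rightarrow> real"
  assumes S: "S \<in> lmeasurable" and N: "negligible N"
    and f: "f \<in> borel_measurable borel" and B: "\<And>x. \<bar>f x\<bar> \<le> B" and \<delta>: "0 < \<delta>"
    and shift: "\<And>h. 0 < h \<Longrightarrow> h < \<delta> \<Longrightarrow>
      (LINT x|lebesgue_on S. f (x + h *\<^sub>R e)) = (LINT x|lebesgue_on S. f x)"
    and line: "\<And>x. x \<in> S - N \<Longrightarrow> \<exists>A. finite A \<and> 0 \<notin> A \<and>
      continuous_on {0..\<delta>} (\<lambda>s. f (x + s *\<^sub>R e)) \<and>
      (\<forall>s\<in>{0..\<delta>} - A. ((\<lambda>s. f (x + s *\<^sub>R e)) has_real_derivative f' (x + s *\<^sub>R e)) (at s) \<and>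
         \<bar>f' (x + s *\<^sub>R e)\<bar> \<le> C)"
  shows "integrable (lebesgue_on S) f'" "(LINT x|lebesgue_on S. f' x) = 0"
proof -
  interpret finite_measure "lebesgue_on S"
    using S by (rule finite_measure_lebesgue_on)
  have Sl: "S \<in> sets lebesgue" using S by (simp add: fmeasurableD)
  define q where "q k x = real (Suc k) * (f (x + (1 / real (Suc k)) *\<^sub>R e) - f x)" for k x
  have qb: "q k \<in> borel_measurable borel" for k
    unfolding q_def using f by measurable
  have qm: "q k \<in> borel_measurable (lebesgue_on R)" for k R
    by (intro borel_imp_measurable_lebesgue_on qb)
  have lim: "(\<lambda>k. q k x) \<longlonglongrightarrow> f' x" if "x \<in> S - N" for x
  proof -
    obtain A where "0 \<notin> A" "\<forall>s\<in>{0..\<delta>} - A. ((\<lambda>s. f (x + s *\<^sub>R e)) has_real_derivative f' (x + s *\<^sub>R e)) (at s)"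
      using line[OF \<open>x \<in> S - N\<close>] by blast
    then have "((\<lambda>s. f (x + s *\<^sub>R e)) has_real_derivative f' (x + 0 *\<^sub>R e)) (at 0)"
      using \<delta> by (meson DiffI atLeastAtMost_iff less_imp_le order_refl)
    then have "((\<lambda>s. f (x + s *\<^sub>R e)) has_real_derivative f' x) (at 0)" by simp
    then show ?thesis unfolding q_def by (rule directional_derivative_limit)
  qed
  have f'm: "f' \<in> borel_measurable (lebesgue_on S)"
  proof (rule measurable_lebesgue_on_diff_negligible[OF _ N Sl])
    show "f' \<in> borel_measurable (lebesgue_on (S - N))"
      by (rule borel_measurable_LIMSEQ_real[where u = q]) (use lim qm in auto)
  qed
  \<comment> \<open>From \<open>k0\<close> on the step of the quotient is shorter than \<delta>, the
    range in which \<open>shift\<close> and \<open>line\<close> apply.\<close>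
  obtain k0 where k0: "1 / real (Suc k0) < \<delta>"
    using \<delta> nat_approx_posE by metis
  have small: "1 / real (Suc (k + k0)) < \<delta>" for k
  proof -
    have "1 / real (Suc (k + k0)) \<le> 1 / real (Suc k0)"
      by (rule divide_left_mono) auto
    then show ?thesis using k0 by linarith
  qed
  have C: "0 \<le> C" if "x \<in> S - N" for x
  proof -
    obtain A where A: "0 \<notin> A" "\<forall>s\<in>{0..\<delta>} - A. \<bar>f' (x + s *\<^sub>R e)\<bar> \<le> C"
      using line[OF \<open>x \<in> S - N\<close>] by blast
    then have "\<bar>f' (x + 0 *\<^sub>R e)\<bar> \<le> C" using \<delta> by (meson DiffI atLeastAtMost_iff less_imp_le order_refl)
    then show ?thesis by linarith
  qed
  have bnd: "\<bar>q (k + k0) x\<bar> \<le> C" if x: "x \<in> S - N" for k x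
  proof -
    define h where "h = 1 / real (Suc (k + k0))"
    have h: "0 < h" "h < \<delta>" using small[of k] by (auto simp: h_def)
    obtain A where A: "finite A" "continuous_on {0..\<delta>} (\<lambda>s. f (x + s *\<^sub>R e))"
       "\<forall>s\<in>{0..\<delta>} - A. ((\<lambda>s. f (x + s *\<^sub>R e)) has_real_derivative f' (x + s *\<^sub>R e)) (at s) \<and> \<bar>f' (x + s *\<^sub>R e)\<bar> \<le> C"
      using line[OF x] by blast
    have "\<bar>f (x + h *\<^sub>R e) - f (x + 0 *\<^sub>R e)\<bar> \<le> C * (h - 0)"
      by (rule abs_diff_le_of_derivative_bound[OF A(1), where f' = "\<lambda>s. f' (x + s *\<^sub>R e)"])
        (use h A(3) C[OF x] continuous_on_subset[OF A(2), of "{0..h}"] in simp_all)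
    then have "\<bar>f (x + h *\<^sub>R e) - f x\<bar> / h \<le> C" using h by (simp add: field_simps)
    then show ?thesis using h by (simp add: q_def h_def abs_mult mult.commute)
  qed
  have AE: "AE x in lebesgue_on S. x \<in> S - N"
    using AE_lebesgue_on_notin[OF N Sl] AE_space[of "lebesgue_on S"] by eventually_elim auto
  have dom: "integrable (lebesgue_on S) f'"
    "(\<lambda>k. LINT x|lebesgue_on S. q (k + k0) x) \<longlonglongrightarrow> (LINT x|lebesgue_on S. f' x)"
  proof -
    have w: "integrable (lebesgue_on S) (\<lambda>x. C)" by simp
    have l: "AE x in lebesgue_on S. (\<lambda>k. q (k + k0) x) \<longlonglongrightarrow> f' x"
      using AE by eventually_elim (rule LIMSEQ_ignore_initial_segment[OF lim])
    have b: "\<And>k. AE x in lebesgue_on S. norm (q (k + k0) x) \<le> C"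
      using AE by eventually_elim (simp add: bnd del: of_nat_Suc)
    show "integrable (lebesgue_on S) f'"
      by (rule integrable_dominated_convergence[OF f'm qm w l b])
    show "(\<lambda>k. LINT x|lebesgue_on S. q (k + k0) x) \<longlonglongrightarrow> (LINT x|lebesgue_on S. f' x)"
      by (rule integral_dominated_convergence[OF f'm qm w l b])
  qed
  show "integrable (lebesgue_on S) f'" by (rule dom)
  have int: "integrable (lebesgue_on S) (\<lambda>x. f (x + h *\<^sub>R e))" for h
  proof (rule integrable_const_bound[where B = B])
    show "(\<lambda>x. f (x + h *\<^sub>R e)) \<in> borel_measurable (lebesgue_on S)"
      by (rule borel_imp_measurable_lebesgue_on) (use f in measurable)
  qed (simp add: B)
  have "(LINT x|lebesgue_on S. q (k + k0) x) = 0" for k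
  proof -
    define h where "h = 1 / real (Suc (k + k0))"
    have h: "0 < h" "h < \<delta>" using small[of k] by (auto simp: h_def)
    have "(LINT x|lebesgue_on S. real (Suc (k + k0)) * (f (x + h *\<^sub>R e) - f x)) = 0"
      using Bochner_Integration.integral_diff[OF int[of h] int[of 0]] shift[OF h] by simp
    then show ?thesis by (simp only: q_def h_def)
  qed
  then show "(LINT x|lebesgue_on S. f' x) = 0"
    using dom(2) by (simp add: LIMSEQ_const_iff)
qed

section \<open>Cut-off functions near hyperplanes\<close>

text \<open>A hyperplane is given by a normal and an offset. Opposite signs of both describe the
  same set, which is why injectivity of \<open>hyp\<close> becomes a condition of its own
  later.\<close>

definition hyp :: "(real^'d) \<times> real \<Rightarrow> (real^'d) set" where
  "hyp p = {x. fst p \<bullet> x = snd p}"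

text \<open>For a unit normal this is the signed distance from the hyperplane.\<close>

definition level :: "(real^'d) \<times> real \<Rightarrow> real^'d \<Rightarrow> real" where
  "level p x = fst p \<bullet> x - snd p"

lemma mem_hyp: "x \<in> hyp p \<longleftrightarrow> level p x = 0"
  by (simp add: hyp_def level_def)

lemma closed_hyp: "closed (hyp p)"
  unfolding hyp_def by (rule closed_hyperplane)

lemma negligible_hyp: "norm (fst p) = 1 \<Longrightarrow> negligible (hyp p)"
  unfolding hyp_def by (rule negligible_hyperplane) auto

lemma has_gradient_level: "has_gradient (level p) (fst p) x"
  unfolding level_def using has_gradient_diff[OF has_gradient_inner has_gradient_const] by simp

lemma C1_level: "C1 (level p)"
  by (rule C1I[OF has_gradient_level]) simp

text \<open>A step from 0 on \<open>s \<le> 1\<close> to 1 on \<open>s \<ge> 2\<close>. It is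
  composed of squares of positive parts because such a square is the simplest piecewise polynomial
  that is still continuously differentiable.\<close>

definition ramp :: "real \<Rightarrow> real" where
  "ramp s = 1 - (max 0 (1 - (max 0 (s - 1))\<^sup>2))\<^sup>2"

definition ramp' :: "real \<Rightarrow> real" where
  "ramp' s = 4 * max 0 (1 - (max 0 (s - 1))\<^sup>2) * max 0 (s - 1)"

text \<open>The only doubtful point is 0, where the difference quotient is at most
  \<open>\<bar>h\<bar>\<close>.\<close>

lemma has_real_derivative_max_square:
  "((\<lambda>s::real. (max 0 s)\<^sup>2) has_real_derivative 2 * max 0 s) (at s)"
proof -
  consider "s < 0" | "s > 0" | "s = 0" by linarith
  then show ?thesis
  proof cases
    case 1
    have "((\<lambda>s::real. (max 0 s)\<^sup>2) has_real_derivative 0) (at s)"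
      by (rule has_field_derivative_transform_within_open[of "\<lambda>_. 0" _ _ "{..<0}"]) (use 1 in auto)
    then show ?thesis using 1 by simp
  next
    case 2
    have "((\<lambda>s::real. (max 0 s)\<^sup>2) has_real_derivative 2 * s) (at s)"
      by (rule has_field_derivative_transform_within_open[of "\<lambda>s. s\<^sup>2" _ _ "{0<..}"])
        (use 2 in \<open>auto intro!: derivative_eq_intros\<close>)
    then show ?thesis using 2 by simp
  next
    case 3
    have "((\<lambda>h::real. (max 0 h)\<^sup>2 / h) \<longlongrightarrow> 0) (at 0)"
    proof (rule Lim_null_comparison)
      show "\<forall>\<^sub>F h in at 0. norm ((max 0 h)\<^sup>2 / h) \<le> \<bar>h::real\<bar>"
        by (rule always_eventually) (auto simp: max_def power2_eq_square)
      show "((\<lambda>h::real. \<bar>h\<bar>) \<longlongrightarrow> 0) (at 0)" by (intro tendsto_rabs_zero tendsto_ident_at)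
    qed
    then show ?thesis using 3 by (simp add: DERIV_def)
  qed
qed

lemma has_real_derivative_ramp: "(ramp has_real_derivative ramp' s) (at s)"
proof -
  have "((\<lambda>s. (max 0 (s - 1))\<^sup>2) has_real_derivative 2 * max 0 (s - 1) * 1) (at s)"
    by (rule DERIV_chain2[where g = "\<lambda>s. s - 1" and f = "\<lambda>s. (max 0 s)\<^sup>2", OF has_real_derivative_max_square])
      (auto intro!: derivative_eq_intros)
  then have "((\<lambda>s. (max 0 (s - 1))\<^sup>2) has_real_derivative 2 * max 0 (s - 1)) (at s)"
    by simp
  from DERIV_diff[OF DERIV_const this] have "((\<lambda>s. 1 - (max 0 (s - 1))\<^sup>2) has_real_derivative - (2 * max 0 (s - 1))) (at s)"
    by simp
  from DERIV_chain2[OF has_real_derivative_max_square this]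
  have "((\<lambda>s. 1 - (max 0 (1 - (max 0 (s - 1))\<^sup>2))\<^sup>2) has_real_derivative
     0 - 2 * max 0 (1 - (max 0 (s - 1))\<^sup>2) * - (2 * max 0 (s - 1))) (at s)"
    by (intro DERIV_diff DERIV_const)
  then show ?thesis by (simp add: ramp_def[abs_def] ramp'_def mult.assoc)
qed

lemma continuous_on_ramp': "continuous_on UNIV ramp'"
  unfolding ramp'_def[abs_def] by (intro continuous_intros)

lemma ramp_eq_0: "s \<le> 1 \<Longrightarrow> ramp s = 0"
  by (simp add: ramp_def max_def)

lemma ramp_eq_1: assumes "2 \<le> s" shows "ramp s = 1"
proof -
  have "1 \<le> (s - 1)\<^sup>2" using assms by (intro one_le_power) linarith
  then have h: "max 0 (1 - (s - 1)\<^sup>2) = 0" by linarith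
  have m: "max 0 (s - 1) = s - 1" using assms by simp
  show ?thesis unfolding ramp_def m h by simp
qed

lemma ramp_bounds: "0 \<le> ramp s" "ramp s \<le> 1"
proof -
  have "(max 0 (1 - (max 0 (s - 1))\<^sup>2))\<^sup>2 \<le> 1"
    by (intro power_le_one) auto
  then show "0 \<le> ramp s" "ramp s \<le> 1" by (simp_all add: ramp_def)
qed

lemma ramp'_eq_0: assumes "s \<le> 1 \<or> 2 \<le> s" shows "ramp' s = 0"
proof (cases "s \<le> 1")
  case False
  then have "1 \<le> (s - 1)\<^sup>2" using assms by (intro one_le_power) linarith
  then have h: "max 0 (1 - (s - 1)\<^sup>2) = 0" by linarith
  have m: "max 0 (s - 1) = s - 1" using False by simp
  show ?thesis unfolding ramp'_def m h by simp
qed (simp add: ramp'_def)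

lemma ramp'_bound: "\<bar>ramp' s\<bar> \<le> 4"
proof (cases "s \<le> 1 \<or> 2 \<le> s")
  case False
  have "max 0 (1 - (max 0 (s - 1))\<^sup>2) * max 0 (s - 1) \<le> 1 * 1"
    by (rule mult_mono) (use False in auto)
  then show ?thesis by (simp add: ramp'_def abs_mult)
qed (simp add: ramp'_eq_0)

lemma C1_ramp: assumes "C1 f" shows "C1 (\<lambda>x. ramp (f x))"
  by (rule C1I[OF has_gradient_compose[OF has_real_derivative_ramp C1_has_gradient[OF assms]]])
    (intro continuous_intros continuous_on_compose2[OF continuous_on_ramp'] C1_continuous
      C1_gradient_continuous assms, auto)

lemma gradient_ramp: "C1 f \<Longrightarrow> gradient (\<lambda>x. ramp (f x)) x = ramp' (f x) *\<^sub>R gradient f x"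
  by (intro gradient_eqI has_gradient_compose has_real_derivative_ramp C1_has_gradient)

text \<open>The multipliers for a field with jumps: multiplying by such a function preserves bounds
  on values and gradients, which dominated convergence relies on.\<close>

definition C1b :: "(real^'d \<Rightarrow> real) \<Rightarrow> bool" where
  "C1b f \<longleftrightarrow> C1 f \<and> (\<exists>B. \<forall>x. \<bar>f x\<bar> \<le> B \<and> norm (gradient f x) \<le> B)"

lemma C1bE:
  assumes "C1b f" obtains B where "0 \<le> B" "\<And>x. \<bar>f x\<bar> \<le> B" "\<And>x. norm (gradient f x) \<le> B"
  using assms unfolding C1b_def by (meson norm_ge_zero order_trans)

lemma C1bI: "C1 f \<Longrightarrow> (\<And>x. \<bar>f x\<bar> \<le> B1) \<Longrightarrow> (\<And>x. norm (gradient f x) \<le> B2) \<Longrightarrow> C1b f"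
  unfolding C1b_def by (meson max.coboundedI1 max.coboundedI2)

lemma C1b_const: "C1b (\<lambda>x. c)"
  by (rule C1bI[OF C1_const, of _ "\<bar>c\<bar>" 0]) (simp_all add: gradient_eqI[OF has_gradient_const])

lemma C1b_mult: assumes "C1b f" "C1b g" shows "C1b (\<lambda>x. f x * g x)"
proof -
  obtain F where F: "0 \<le> F" "\<And>x. \<bar>f x\<bar> \<le> F" "\<And>x. norm (gradient f x) \<le> F" using assms C1bE by blast
  obtain G where G: "0 \<le> G" "\<And>x. \<bar>g x\<bar> \<le> G" "\<And>x. norm (gradient g x) \<le> G" using assms C1bE by blast
  have C: "C1 f" "C1 g" using assms by (auto simp: C1b_def)
  show ?thesis
  proof (rule C1bI)
    show "C1 (\<lambda>x. f x * g x)" using C by (rule C1_mult)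
    show "\<bar>f x * g x\<bar> \<le> F * G" for x unfolding abs_mult by (intro mult_mono F G) auto
    have eq: "gradient (\<lambda>x. f x * g x) x = f x *\<^sub>R gradient g x + g x *\<^sub>R gradient f x" for x
      by (intro gradient_eqI has_gradient_mult C1_has_gradient C)
    have le: "norm (f x *\<^sub>R gradient g x) \<le> F * G" "norm (g x *\<^sub>R gradient f x) \<le> G * F" for x
      unfolding norm_scaleR by (intro mult_mono F G; simp)+
    show "norm (gradient (\<lambda>x. f x * g x) x) \<le> F * G + G * F" for x
      unfolding eq by (rule norm_triangle_mono[OF le])
  qed
qed

lemma C1b_add: assumes "C1b f" "C1b g" shows "C1b (\<lambda>x. f x + g x)"
proof -
  obtain F where F: "0 \<le> F" "\<And>x. \<bar>f x\<bar> \<le> F" "\<And>x. norm (gradient f x) \<le> F" using assms C1bE by blast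
  obtain G where G: "0 \<le> G" "\<And>x. \<bar>g x\<bar> \<le> G" "\<And>x. norm (gradient g x) \<le> G" using assms C1bE by blast
  have C: "C1 f" "C1 g" using assms by (auto simp: C1b_def)
  show ?thesis
  proof (rule C1bI)
    show "C1 (\<lambda>x. f x + g x)" using C by (rule C1_add)
    show "\<bar>f x + g x\<bar> \<le> F + G" for x using F(2)[of x] G(2)[of x] by linarith
    have "gradient (\<lambda>x. f x + g x) x = gradient f x + gradient g x" for x
      by (intro gradient_eqI has_gradient_add C1_has_gradient C)
    then show "norm (gradient (\<lambda>x. f x + g x) x) \<le> F + G" for x
      by (simp add: norm_triangle_mono F G)
  qed
qed

lemma C1b_sum: "(\<And>i. i \<in> I \<Longrightarrow> C1b (f i)) \<Longrightarrow> C1b (\<lambda>x. \<Sum>i\<in>I. f i x)"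
  by (induction I rule: infinite_finite_induct) (auto simp: C1b_const intro!: C1b_add)

lemma C1b_prod: "(\<And>i. i \<in> I \<Longrightarrow> C1b (f i)) \<Longrightarrow> C1b (\<lambda>x. \<Prod>i\<in>I. f i x)"
  by (induction I rule: infinite_finite_induct) (auto simp: C1b_const intro!: C1b_mult)

lemma C1b_diff: "C1b f \<Longrightarrow> C1b g \<Longrightarrow> C1b (\<lambda>x. f x - g x)"
  using C1b_add[of f "\<lambda>x. (- 1) * g x"] C1b_mult[OF C1b_const[of "- 1"], of g] by simp

text \<open>
  Where a product of \<open>pair_cut\<close>s is nonzero, at most one hyperplane has a level below \<open>\<epsilon> / \<surd>2\<close>; the
  factor \<open>8\<close> confines \<open>near_cut\<close> to levels below \<open>\<epsilon> / 2\<close>, so that at most one \<open>near_cut\<close> survives there.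
\<close>

definition near_cut :: "real \<Rightarrow> (real^'d) \<times> real \<Rightarrow> real^'d \<Rightarrow> real" where
  "near_cut \<epsilon> p x = 1 - ramp (8 * (level p x)\<^sup>2 / \<epsilon>\<^sup>2)"

definition pair_cut :: "real \<Rightarrow> ((real^'d) \<times> real) \<times> ((real^'d) \<times> real) \<Rightarrow> real^'d \<Rightarrow> real" where
  "pair_cut \<epsilon> r x = ramp (((level (fst r) x)\<^sup>2 + (level (snd r) x)\<^sup>2) / \<epsilon>\<^sup>2)"

lemma C1_square_level: "C1 (\<lambda>x. c * (level p x)\<^sup>2)"
  by (intro C1_mult C1_const C1_power C1_level)

lemma gradient_square_level: "has_gradient (\<lambda>x. c * (level p x)\<^sup>2) ((2 * c * level p x) *\<^sub>R fst p) x"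
proof -
  have "has_gradient (\<lambda>x. c * (level p x * level p x)) (c *\<^sub>R (level p x *\<^sub>R fst p + level p x *\<^sub>R fst p)) x"
    by (intro has_gradient_cmult has_gradient_mult has_gradient_level)
  then show ?thesis by (simp add: power2_eq_square scaleR_add_left[symmetric] algebra_simps)
qed

text \<open>The gradient of the squared level is unbounded, but \<open>ramp'\<close> vanishes once
  its argument reaches 2, that is, from distance \<open>\<epsilon> / 2\<close> on. Closer to the
  hyperplane the inner gradient is at most \<open>16 / \<epsilon>\<^sup>2 * \<epsilon>\<close>, and
  \<open>ramp'\<close> contributes the factor 4.\<close>

lemma C1b_near_cut:
  assumes "0 < \<epsilon>" "norm (fst p) = 1" shows "C1b (near_cut \<epsilon> p)"
proof -
  let ?f = "\<lambda>x. 8 / \<epsilon>\<^sup>2 * (level p x)\<^sup>2"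
  have "C1b (\<lambda>x. ramp (?f x))"
  proof (rule C1bI)
    show "C1 (\<lambda>x. ramp (?f x))" by (intro C1_ramp C1_square_level)
    show "\<bar>ramp (?f x)\<bar> \<le> 1" for x by (metis abs_of_nonneg ramp_bounds)
    fix x
    have g: "gradient (\<lambda>x. ramp (?f x)) x = ramp' (?f x) *\<^sub>R ((2 * (8 / \<epsilon>\<^sup>2) * level p x) *\<^sub>R fst p)"
      using gradient_ramp[OF C1_square_level] gradient_eqI[OF gradient_square_level] by metis
    show "norm (gradient (\<lambda>x. ramp (?f x)) x) \<le> 4 * (16 / \<epsilon>\<^sup>2 * \<epsilon>)"
    proof (cases "2 \<le> ?f x")
      case True
      then have "ramp' (?f x) = 0" using ramp'_eq_0 by blast
      then show ?thesis using assms by (simp only: g) simp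
    next
      case False
      then have "4 * (level p x)\<^sup>2 < \<epsilon>\<^sup>2" using assms by (simp add: field_simps)
      then have "(level p x)\<^sup>2 \<le> \<epsilon>\<^sup>2" by (smt (verit) zero_le_power2)
      then have "\<bar>level p x\<bar> \<le> \<epsilon>" using assms abs_le_square_iff[of "level p x" \<epsilon>] by simp
      then have "\<bar>2 * (8 / \<epsilon>\<^sup>2) * level p x\<bar> \<le> 16 / \<epsilon>\<^sup>2 * \<epsilon>"
        using assms by (simp add: abs_mult divide_right_mono)
      then have "\<bar>ramp' (?f x)\<bar> * \<bar>2 * (8 / \<epsilon>\<^sup>2) * level p x\<bar> \<le> 4 * (16 / \<epsilon>\<^sup>2 * \<epsilon>)"
        using assms by (intro mult_mono ramp'_bound) auto
      then show ?thesis unfolding g norm_scaleR using assms by simp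
    qed
  qed
  then have "C1b (\<lambda>x. 1 - ramp (?f x))" by (intro C1b_diff C1b_const)
  then show ?thesis by (simp add: near_cut_def[abs_def])
qed

text \<open>\<open>ramp'\<close> is nonzero only where the two squared levels add up to less than
  \<open>2 * \<epsilon>\<^sup>2\<close>, so both levels are below \<open>2 * \<epsilon>\<close>
  there. Each of the two terms of the inner gradient is then at most \<open>4 / \<epsilon>\<close>,
  and the bound 4 for \<open>ramp'\<close> gives \<open>32 / \<epsilon>\<close>.\<close>

lemma gradient_pair_cut:
  assumes "0 < \<epsilon>" "norm (fst (fst r)) = 1" "norm (fst (snd r)) = 1"
  shows "C1 (pair_cut \<epsilon> r)" "norm (gradient (pair_cut \<epsilon> r) x) \<le> 32 / \<epsilon>"
    "\<not> (\<bar>level (fst r) x\<bar> < 2 * \<epsilon> \<and> \<bar>level (snd r) x\<bar> < 2 * \<epsilon>) \<Longrightarrow> gradient (pair_cut \<epsilon> r) x = 0"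
proof -
  let ?p = "fst r" and ?q = "snd r"
  let ?f = "\<lambda>x. 1 / \<epsilon>\<^sup>2 * (level ?p x)\<^sup>2 + 1 / \<epsilon>\<^sup>2 * (level ?q x)\<^sup>2"
  have eq: "pair_cut \<epsilon> r = (\<lambda>x. ramp (?f x))" by (simp add: pair_cut_def[abs_def] add_divide_distrib)
  have f: "C1 ?f" by (intro C1_add C1_square_level)
  show "C1 (pair_cut \<epsilon> r)" unfolding eq by (rule C1_ramp[OF f])
  have "gradient ?f x = (2 * (1 / \<epsilon>\<^sup>2) * level ?p x) *\<^sub>R fst ?p + (2 * (1 / \<epsilon>\<^sup>2) * level ?q x) *\<^sub>R fst ?q"
    by (intro gradient_eqI has_gradient_add gradient_square_level)
  then have g: "gradient (pair_cut \<epsilon> r) x = ramp' (?f x) *\<^sub>R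
     ((2 * (1 / \<epsilon>\<^sup>2) * level ?p x) *\<^sub>R fst ?p + (2 * (1 / \<epsilon>\<^sup>2) * level ?q x) *\<^sub>R fst ?q)"
    unfolding eq gradient_ramp[OF f] by simp
  have small: "\<bar>level ?p x\<bar> < 2 * \<epsilon> \<and> \<bar>level ?q x\<bar> < 2 * \<epsilon>" if "?f x < 2"
  proof -
    have "(level ?p x)\<^sup>2 + (level ?q x)\<^sup>2 < 2 * \<epsilon>\<^sup>2"
      using that assms(1) by (simp add: field_simps)
    then have "(level ?p x)\<^sup>2 < (2 * \<epsilon>)\<^sup>2" "(level ?q x)\<^sup>2 < (2 * \<epsilon>)\<^sup>2"
      using zero_le_power2[of "level ?p x"] zero_le_power2[of "level ?q x"]
      unfolding power_mult_distrib power2_eq_square[of "2::real"] by linarith+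
    then show ?thesis
      using power2_less_imp_less[of "\<bar>level ?p x\<bar>" "2 * \<epsilon>"]
        power2_less_imp_less[of "\<bar>level ?q x\<bar>" "2 * \<epsilon>"] assms(1) by simp
  qed
  show "gradient (pair_cut \<epsilon> r) x = 0" if "\<not> (\<bar>level ?p x\<bar> < 2 * \<epsilon> \<and> \<bar>level ?q x\<bar> < 2 * \<epsilon>)"
  proof -
    have "2 \<le> ?f x" using small that by (metis not_less)
    then have "ramp' (?f x) = 0" using ramp'_eq_0 by blast
    then show ?thesis by (simp only: g scaleR_zero_left)
  qed
  show "norm (gradient (pair_cut \<epsilon> r) x) \<le> 32 / \<epsilon>"
  proof (cases "?f x < 2")
    case True
    have 1: "\<bar>2 * (1 / \<epsilon>\<^sup>2) * level ?p x\<bar> \<le> 4 / \<epsilon>" "\<bar>2 * (1 / \<epsilon>\<^sup>2) * level ?q x\<bar> \<le> 4 / \<epsilon>"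
      using small[OF True] assms(1) by (simp_all add: abs_mult field_simps power2_eq_square)
    have "norm ((2 * (1 / \<epsilon>\<^sup>2) * level ?p x) *\<^sub>R fst ?p + (2 * (1 / \<epsilon>\<^sup>2) * level ?q x) *\<^sub>R fst ?q) \<le> 4 / \<epsilon> + 4 / \<epsilon>"
      using 1 assms by (intro norm_triangle_mono) simp_all
    then have "\<bar>ramp' (?f x)\<bar> * norm ((2 * (1 / \<epsilon>\<^sup>2) * level ?p x) *\<^sub>R fst ?p + (2 * (1 / \<epsilon>\<^sup>2) * level ?q x) *\<^sub>R fst ?q)
       \<le> 4 * (4 / \<epsilon> + 4 / \<epsilon>)"
      by (intro mult_mono ramp'_bound) auto
    then show ?thesis unfolding g by simp
  next
    case False
    then have "ramp' (?f x) = 0" using ramp'_eq_0 not_less by blast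
    then show ?thesis using assms(1) by (simp only: g) simp
  qed
qed

text \<open>The translates of \<open>A\<close> by the multiples of \<open>\<delta> *\<^sub>R u\<close> are disjoint, and about \<open>1 / \<delta>\<close> of them fit into \<open>U\<close>.\<close>

lemma measure_strip_le:
  fixes a :: "real^'d"
  assumes A: "A \<in> lmeasurable" and U: "U \<in> lmeasurable" and u: "a \<bullet> u = 2" and \<delta>: "0 < \<delta>"
    and strip: "\<And>x. x \<in> A \<Longrightarrow> \<bar>a \<bullet> x - b\<bar> < \<delta>"
    and sub: "\<And>x s. x \<in> A \<Longrightarrow> 0 \<le> s \<Longrightarrow> s \<le> 1 \<Longrightarrow> x + s *\<^sub>R u \<in> U"
  shows "measure lebesgue A \<le> \<delta> * measure lebesgue U"
proof -
  define m where "m = nat \<lceil>1 / \<delta>\<rceil>"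
  have m: "1 / \<delta> \<le> real m" unfolding m_def by (rule real_nat_ceiling_ge)
  have km: "real k * \<delta> \<le> 1" if "k < m" for k
  proof -
    have "real k < 1 / \<delta>" using that unfolding m_def by linarith
    then show ?thesis using \<delta> by (simp add: field_simps)
  qed
  define T where "T k = (+) ((real k * \<delta>) *\<^sub>R u) ` A" for k
  \<comment> \<open>As \<open>a \<bullet> u = 2\<close>, consecutive translates are
    \<open>2 * \<delta>\<close> apart in direction \<open>a\<close>, which is exactly the width of
    the open strip.\<close>
  have disj: "disjoint_family_on T {..<m}"
  proof (unfold disjoint_family_on_def, intro ballI impI)
    fix j k :: nat assume "j \<noteq> k"
    show "T j \<inter> T k = {}"
    proof (rule ccontr)
      assume "T j \<inter> T k \<noteq> {}"
      then obtain y z where yz: "y \<in> A" "z \<in> A" "(real j * \<delta>) *\<^sub>R u + y = (real k * \<delta>) *\<^sub>R u + z"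
        unfolding T_def by auto
      then have "a \<bullet> ((real j * \<delta>) *\<^sub>R u + y) = a \<bullet> ((real k * \<delta>) *\<^sub>R u + z)" by simp
      then have "2 * \<delta> * (real j - real k) = a \<bullet> z - a \<bullet> y"
        using u by (simp add: inner_add_right algebra_simps)
      moreover have "\<bar>a \<bullet> z - a \<bullet> y\<bar> < 2 * \<delta>" using strip[OF yz(1)] strip[OF yz(2)] by linarith
      ultimately have "2 * \<delta> * \<bar>real j - real k\<bar> < 2 * \<delta> * 1"
        using \<delta> abs_mult[of "2 * \<delta>" "real j - real k"] by linarith
      then have "\<bar>real j - real k\<bar> < 1" using \<delta> mult_less_cancel_left_pos[of "2 * \<delta>"] by simp
      then show False using \<open>j \<noteq> k\<close> by linarith
    qed
  qed
  have Tm: "T k \<in> lmeasurable" for k unfolding T_def using A by (rule measurable_translation)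
  have Te: "emeasure lebesgue (T k) \<noteq> \<infinity>" for k
    using fmeasurableD2[OF Tm[of k]] unfolding infinity_ennreal_def .
  have "real m * measure lebesgue A = (\<Sum>k<m. measure lebesgue (T k))"
    unfolding T_def by (simp add: measure_translation)
  also have "\<dots> = measure lebesgue (\<Union>k<m. T k)"
    by (intro measure_finite_Union[symmetric] disj Te) (auto simp: fmeasurableD[OF Tm])
  also have "\<dots> \<le> measure lebesgue U"
  proof (rule measure_mono_fmeasurable)
    show "(\<Union>k<m. T k) \<subseteq> U"
    proof clarify
      fix k y assume k: "k < m" and "y \<in> T k"
      then obtain x where x: "x \<in> A" "y = x + (real k * \<delta>) *\<^sub>R u"
        by (auto simp: T_def add.commute)
      show "y \<in> U" unfolding x(2) using sub[OF x(1)] km[OF k] \<delta> by simp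
    qed
  qed (use Tm U in \<open>auto intro: fmeasurableD\<close>)
  finally have "real m * measure lebesgue A \<le> measure lebesgue U" .
  moreover have "1 / \<delta> * measure lebesgue A \<le> real m * measure lebesgue A"
    using m by (intro mult_right_mono) auto
  ultimately have "1 / \<delta> * measure lebesgue A \<le> measure lebesgue U" by linarith
  then show ?thesis using \<delta> by (simp add: field_simps)
qed

text \<open>Contains all points of the ball at which the gradient of
  \<open>pair_cut \<epsilon> r\<close> can be nonzero.\<close>

definition double_strip :: "real \<Rightarrow> real \<Rightarrow> ((real^'d) \<times> real) \<times> ((real^'d) \<times> real) \<Rightarrow> (real^'d) set" where
  "double_strip R \<epsilon> r = {x \<in> ball 0 R. \<bar>level (fst r) x\<bar> < 2 * \<epsilon> \<and> \<bar>level (snd r) x\<bar> < 2 * \<epsilon>}"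

lemma open_level_less: "open {x. \<bar>level p x\<bar> < c}"
  unfolding level_def by (intro open_Collect_less continuous_intros)

lemma lmeasurable_double_strip: "double_strip R \<epsilon> r \<in> lmeasurable"
proof -
  have "double_strip R \<epsilon> r = ball 0 R \<inter> {x. \<bar>level (fst r) x\<bar> < 2 * \<epsilon>} \<inter> {x. \<bar>level (snd r) x\<bar> < 2 * \<epsilon>}"
    by (auto simp: double_strip_def)
  then show ?thesis
    using bounded_subset[OF bounded_ball, of _ 0 R]
    by (intro lmeasurable_open) (auto intro!: open_Int open_level_less)
qed

text \<open>Different hyperplanes are parallel or transversal. Parallel ones have a positive
  distance, so narrow strips around them do not meet. For transversal ones
  \<open>measure_strip_le\<close> applies twice: sliding inside the first strip gains one factor
  \<epsilon>, sliding along the normal of the first strip gains another.\<close>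

lemma measure_double_strip:
  fixes p q :: "(real^'d) \<times> real"
  assumes p: "norm (fst p) = 1" and q: "norm (fst q) = 1" and ne: "hyp p \<noteq> hyp q"
  obtains K where "0 \<le> K" "\<And>\<epsilon>. 0 < \<epsilon> \<Longrightarrow> measure lebesgue (double_strip R \<epsilon> (p, q)) \<le> K * \<epsilon>\<^sup>2"
proof -
  \<comment> \<open>The cosine of the angle between the normals. The part \<open>w\<close> of the
    second normal orthogonal to the first has squared length \<open>1 - s\<^sup>2\<close>, so
    \<open>s\<^sup>2 = 1\<close> means that the hyperplanes are parallel.\<close>
  define s where "s = fst p \<bullet> fst q"
  define w where "w = fst q - s *\<^sub>R fst p"
  have pp: "fst p \<bullet> fst p = 1" and qq: "fst q \<bullet> fst q = 1" using p q by (simp_all add: norm_eq_1)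
  have pw: "fst p \<bullet> w = 0" by (simp add: w_def inner_diff_right pp s_def)
  have qw: "fst q \<bullet> w = 1 - s\<^sup>2" by (simp add: w_def inner_diff_right qq s_def power2_eq_square inner_commute)
  have ww: "w \<bullet> w = 1 - s\<^sup>2"
    using pw qw by (simp add: w_def inner_diff_left inner_diff_right inner_commute)
  show ?thesis
  proof (cases "s\<^sup>2 = 1")
    case True
    then have "fst q = s *\<^sub>R fst p" using ww by (simp add: w_def)
    then have lev: "level q x = s * level p x + (s * snd p - snd q)" for x
      by (simp add: level_def algebra_simps)
    have s1: "\<bar>s\<bar> = 1" using True by (auto simp: power2_eq_1_iff)
    define c where "c = \<bar>s * snd p - snd q\<bar>"
    have c: "0 < c"
    proof (rule ccontr)
      assume "\<not> 0 < c"
      then have "level q x = s * level p x" for x using lev by (simp add: c_def)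
      then have "hyp p = hyp q" using s1 by (auto simp: mem_hyp)
      then show False using ne by simp
    qed
    \<comment> \<open>Narrow strips are disjoint. If \<open>c < 4 * \<epsilon>\<close> they may
      meet, but then \<open>(4 / c * \<epsilon>)\<^sup>2\<close> exceeds 1 and the measure of the
      whole ball is a sufficient bound.\<close>
    define K where "K = measure lebesgue (ball (0::real^'d) R) * (4 / c)\<^sup>2"
    show ?thesis
    proof (rule that[of K])
      show "0 \<le> K" by (simp add: K_def)
      fix \<epsilon> :: real assume \<epsilon>: "0 < \<epsilon>"
      show "measure lebesgue (double_strip R \<epsilon> (p, q)) \<le> K * \<epsilon>\<^sup>2"
      proof (cases "c < 4 * \<epsilon>")
        case True
        have "measure lebesgue (double_strip R \<epsilon> (p, q)) \<le> measure lebesgue (ball (0::real^'d) R)"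
          by (intro measure_mono_fmeasurable fmeasurableD[OF lmeasurable_double_strip])
            (auto simp: double_strip_def)
        also have "\<dots> = measure lebesgue (ball (0::real^'d) R) * 1" by simp
        also have "\<dots> \<le> measure lebesgue (ball (0::real^'d) R) * ((4 / c) * \<epsilon>)\<^sup>2"
          using True c by (intro mult_left_mono one_le_power) (simp_all add: field_simps)
        finally show ?thesis by (simp only: K_def power_mult_distrib mult.assoc)
      next
        case False
        have "double_strip R \<epsilon> (p, q) = {}"
        proof -
          have "\<not> (\<bar>level p x\<bar> < 2 * \<epsilon> \<and> \<bar>level q x\<bar> < 2 * \<epsilon>)" for x
          proof -
            have "c = \<bar>level q x - s * level p x\<bar>" using lev by (simp add: c_def)
            also have "\<dots> \<le> \<bar>level q x\<bar> + \<bar>s * level p x\<bar>" by (rule abs_triangle_ineq4)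
            also have "\<bar>s * level p x\<bar> = \<bar>level p x\<bar>" using s1 by (simp add: abs_mult)
            finally show ?thesis using False by linarith
          qed
          then show ?thesis by (auto simp: double_strip_def)
        qed
        then show ?thesis by (simp add: K_def)
      qed
    qed
  next
    case False
    \<comment> \<open>Parallel to the first hyperplane, so that moving along \<open>t\<close> stays
      in the first strip, and scaled to have inner product 2 with the second normal as
      \<open>measure_strip_le\<close> demands.\<close>
    define t where "t = (2 / (1 - s\<^sup>2)) *\<^sub>R w"
    have "2 / a * a = 2" if "a \<noteq> 0" for a :: real using that by simp
    then have "2 / (1 - s\<^sup>2) * (1 - s\<^sup>2) = 2" using False by (metis eq_iff_diff_eq_0)
    then have t: "fst p \<bullet> t = 0" "fst q \<bullet> t = 2"
      unfolding t_def inner_scaleR_right pw qw by auto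
    \<comment> \<open>Leaves room for both displacements, first by \<open>t\<close> and then by
      twice a unit normal.\<close>
    define V where "V = ball (0::real^'d) (R + norm t + 2)"
    have V: "V \<in> lmeasurable" by (simp add: V_def)
    show ?thesis
    proof (rule that[of "4 * measure lebesgue V"])
      show "0 \<le> 4 * measure lebesgue V" by simp
      fix \<epsilon> :: real assume \<epsilon>: "0 < \<epsilon>"
      define U where "U = ball (0::real^'d) (R + norm t) \<inter> {x. \<bar>level p x\<bar> < 2 * \<epsilon>}"
      have U: "U \<in> lmeasurable" unfolding U_def
        using bounded_subset[OF bounded_ball, of _ 0 "R + norm t"]
        by (intro lmeasurable_open) (auto intro!: open_Int open_level_less)
      have "measure lebesgue (double_strip R \<epsilon> (p, q)) \<le> 2 * \<epsilon> * measure lebesgue U"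
      proof (rule measure_strip_le[OF lmeasurable_double_strip U t(2), where b = "snd q"])
        show "\<bar>fst q \<bullet> x - snd q\<bar> < 2 * \<epsilon>" if "x \<in> double_strip R \<epsilon> (p, q)" for x
          using that by (simp add: double_strip_def level_def)
        show "x + c *\<^sub>R t \<in> U" if x: "x \<in> double_strip R \<epsilon> (p, q)" and c: "0 \<le> c" "c \<le> 1" for x c
        proof -
          have "norm (c *\<^sub>R t) \<le> norm t" using c by (simp add: mult_left_le_one_le)
          moreover have "norm x < R" using x by (simp add: double_strip_def)
          ultimately have "norm (x + c *\<^sub>R t) < R + norm t"
            using norm_triangle_ineq[of x "c *\<^sub>R t"] by linarith
          then show ?thesis using x t by (simp add: U_def double_strip_def level_def inner_add_right)
        qed
      qed (use \<epsilon> in simp)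
      also have "measure lebesgue U \<le> 2 * \<epsilon> * measure lebesgue V"
      proof (rule measure_strip_le[OF U V, where a = "fst p" and b = "snd p" and u = "2 *\<^sub>R fst p"])
        show "fst p \<bullet> 2 *\<^sub>R fst p = 2" by (simp add: pp)
        show "\<bar>fst p \<bullet> x - snd p\<bar> < 2 * \<epsilon>" if "x \<in> U" for x
          using that by (simp add: U_def level_def)
        show "x + c *\<^sub>R 2 *\<^sub>R fst p \<in> V" if x: "x \<in> U" and c: "0 \<le> c" "c \<le> 1" for x c
        proof -
          have "norm (c *\<^sub>R 2 *\<^sub>R fst p) \<le> 2" using c p by simp
          moreover have "norm x < R + norm t" using x by (simp add: U_def)
          ultimately show ?thesis
            using norm_triangle_ineq[of x "c *\<^sub>R 2 *\<^sub>R fst p"] by (simp add: V_def)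
        qed
      qed (use \<epsilon> in simp)
      finally show "measure lebesgue (double_strip R \<epsilon> (p, q)) \<le> 4 * measure lebesgue V * \<epsilon>\<^sup>2"
        using \<epsilon> by (simp add: power2_eq_square ac_simps)
    qed
  qed
qed

section \<open>Divergence of fields that are singular on hyperplanes\<close>

text \<open>Nothing is known of \<open>f\<close> on \<open>N\<close>, where it may involve
  derivatives that do not exist; completeness of the measure supplies even its
  measurability.\<close>

lemma integrable_cong_negligible:
  fixes f g :: "'a::euclidean_space \<Rightarrow> 'b::euclidean_space"
  assumes g: "integrable (lebesgue_on S) g" and N: "negligible N" and S: "S \<in> sets lebesgue"
    and eq: "\<And>x. x \<in> S - N \<Longrightarrow> f x = g x"
  shows "integrable (lebesgue_on S) f" "integral\<^sup>L (lebesgue_on S) f = integral\<^sup>L (lebesgue_on S) g"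
proof -
  have gm: "g \<in> borel_measurable (lebesgue_on S)" using g by auto
  have "g \<in> borel_measurable (lebesgue_on (S - N))"
    using measurable_restrict_mono[OF gm, of "S - N"] S by auto
  then have "f \<in> borel_measurable (lebesgue_on (S - N))"
    using eq by (subst measurable_cong[where g = g]) auto
  then have fm: "f \<in> borel_measurable (lebesgue_on S)"
    using measurable_lebesgue_on_diff_negligible N S by blast
  have AE: "AE x in lebesgue_on S. f x = g x"
    using AE_lebesgue_on_notin[OF N S] AE_space[of "lebesgue_on S"] by eventually_elim (simp add: eq)
  show "integrable (lebesgue_on S) f" using integrable_cong_AE[OF fm gm AE] g by blast
  show "integral\<^sup>L (lebesgue_on S) f = integral\<^sup>L (lebesgue_on S) g" by (rule integral_cong_AE[OF fm gm AE])
qed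

text \<open>Off \<open>N\<close> the directional derivative is a pointwise limit of difference
  quotients, which are Borel functions.\<close>

lemma gradient_inner_measurable:
  assumes f: "f \<in> borel_measurable borel" and S: "S \<in> sets lebesgue" and N: "negligible N"
    and diff: "\<And>x. x \<in> S - N \<Longrightarrow> f differentiable (at x)"
  shows "(\<lambda>x. gradient f x \<bullet> e) \<in> borel_measurable (lebesgue_on S)"
proof (rule measurable_lebesgue_on_diff_negligible[OF _ N S])
  define q where "q k x = real (Suc k) * (f (x + (1 / real (Suc k)) *\<^sub>R e) - f x)" for k x
  show "(\<lambda>x. gradient f x \<bullet> e) \<in> borel_measurable (lebesgue_on (S - N))"
  proof (rule borel_measurable_LIMSEQ_real[where u = q])
    show "q k \<in> borel_measurable (lebesgue_on (S - N))" for k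
      by (intro borel_imp_measurable_lebesgue_on) (use f in \<open>unfold q_def, measurable\<close>)
    show "(\<lambda>k. q k x) \<longlonglongrightarrow> gradient f x \<bullet> e" if "x \<in> space (lebesgue_on (S - N))" for x
    proof -
      have "f differentiable (at x)" using that diff by simp
      then have "has_gradient f (gradient f x) (x + 0 *\<^sub>R e)" using has_gradient_gradient by simp
      from directional_derivative_limit[OF has_gradient_line[OF this]] show ?thesis
        by (simp only: q_def)
    qed
  qed
qed

lemma lborel_integral_translate:
  fixes f :: "real^'d \<Rightarrow> real"
  assumes "f \<in> borel_measurable borel"
  shows "(LINT x|lborel. f (x + w)) = (LINT x|lborel. f x)"
proof -
  have "(LINT x|lborel. f (x + w)) = (LINT x|distr lborel borel ((+) w). f x)"
    by (subst integral_distr) (use assms in \<open>simp_all add: add.commute\<close>)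
  then show ?thesis by (simp add: lborel_distr_plus)
qed

lemma lebesgue_on_integral_lborel:
  fixes f :: "real^'d \<Rightarrow> real"
  assumes "f \<in> borel_measurable borel" "S \<in> sets borel"
  shows "(LINT x|lebesgue_on S. f x) = (LINT x|lborel. indicator S x * f x)"
proof -
  have "(LINT x|lebesgue_on S. f x) = (LINT x|lebesgue. indicator S x *\<^sub>R f x)"
    by (rule integral_restrict_space) (use assms in simp)
  also have "\<dots> = (LINT x|lborel. indicator S x *\<^sub>R f x)"
    by (rule integral_completion) (use assms in simp)
  finally show ?thesis by simp
qed

text \<open>A support in the ball of radius \<open>R\<close> stays within radius
  \<open>R + 2\<close> when moved by at most 2, so both sides are integrals over the whole space.
  The margin 2 accommodates the tangential directions used for the divergence, whose norms are at
  most 2.\<close>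

lemma integral_shift_compact_support:
  fixes f :: "real^'d \<Rightarrow> real"
  assumes f: "f \<in> borel_measurable borel" and supp: "\<And>x. R \<le> norm x \<Longrightarrow> f x = 0" and w: "norm w \<le> 2"
  shows "(LINT x|lebesgue_on (ball 0 (R + 2)). f (x + w)) = (LINT x|lebesgue_on (ball 0 (R + 2)). f x)"
proof -
  have "(LINT x|lebesgue_on (ball 0 (R + 2)). f (x + z)) = (LINT x|lborel. f x)" if z: "norm z \<le> 2" for z
  proof -
    have m: "(\<lambda>x. f (x + z)) \<in> borel_measurable borel" using f by simp
    have "f (x + z) = 0" if "x \<notin> ball 0 (R + 2)" for x
    proof (rule supp)
      have "norm x \<le> norm (x + z) + norm z" using norm_triangle_ineq4[of "x + z" z] by simp
      then show "R \<le> norm (x + z)" using that z by simp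
    qed
    then have "(LINT x|lborel. indicator (ball 0 (R + 2)) x * f (x + z)) = (LINT x|lborel. f (x + z))"
      by (intro Bochner_Integration.integral_cong) (auto simp: indicator_def)
    then show ?thesis
      unfolding lebesgue_on_integral_lborel[OF m borel_open[OF open_ball]] lborel_integral_translate[OF f] .
  qed
  from this[OF w] this[of 0] show ?thesis by simp
qed

text \<open>A line in direction \<open>e\<close> starting off the hyperplane either never meets it,
  being parallel to it, or meets it once, and there \<open>f\<close> is continuous. In both cases
  \<open>integral_directional_derivative\<close> applies.\<close>

lemma integral_gradient_off_hyperplane:
  fixes p :: "(real^'d) \<times> real"
  assumes p: "norm (fst p) = 1" and f: "f \<in> borel_measurable borel" and B: "\<And>x. \<bar>f x\<bar> \<le> B"
    and supp: "\<And>x. R \<le> norm x \<Longrightarrow> f x = 0"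
    and diff: "\<And>x. x \<notin> hyp p \<Longrightarrow> f differentiable (at x)" "\<And>x. x \<notin> hyp p \<Longrightarrow> norm (gradient f x) \<le> C"
    and e: "norm e \<le> 2" "fst p \<bullet> e = 0 \<or> (\<forall>x. isCont f x)"
  shows "integrable (lebesgue_on (ball 0 (R + 2))) (\<lambda>x. gradient f x \<bullet> e)"
    "(LINT x|lebesgue_on (ball 0 (R + 2)). gradient f x \<bullet> e) = 0"
proof -
  \<comment> \<open>The parameter at which the line through \<open>x\<close> in direction
    \<open>e\<close> hits the hyperplane, if it does.\<close>
  define A where "A x = (if fst p \<bullet> e = 0 then {} else {- level p x / (fst p \<bullet> e)})" for x
  have A: "finite (A x)" "0 \<notin> A x" "\<And>s. s \<notin> A x \<Longrightarrow> x + s *\<^sub>R e \<notin> hyp p" if "x \<notin> hyp p" for x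
  proof -
    have lev: "level p (x + s *\<^sub>R e) = level p x + s * (fst p \<bullet> e)" for s
      by (simp add: level_def inner_add_right)
    show "finite (A x)" "0 \<notin> A x" using that by (auto simp: A_def mem_hyp)
    show "x + s *\<^sub>R e \<notin> hyp p" if "s \<notin> A x" for s
    proof
      assume "x + s *\<^sub>R e \<in> hyp p"
      then have 0: "level p x + s * (fst p \<bullet> e) = 0" by (simp add: mem_hyp lev)
      then have "fst p \<bullet> e \<noteq> 0" using \<open>x \<notin> hyp p\<close> by (auto simp: mem_hyp)
      moreover from this have "s = - level p x / (fst p \<bullet> e)"
        using 0 by (subst nonzero_eq_divide_eq) auto
      ultimately show False using that by (simp add: A_def)
    qed
  qed
  have cont: "isCont f (x + s *\<^sub>R e)" if "x \<notin> hyp p" for x s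
  proof (cases "fst p \<bullet> e = 0")
    case True
    then have "f differentiable (at (x + s *\<^sub>R e))" using A(3)[OF that] diff(1) by (simp add: A_def)
    then show ?thesis using has_gradient_gradient has_gradient_continuous by blast
  qed (use e in auto)
  have line: "\<exists>A. finite A \<and> 0 \<notin> A \<and> continuous_on {0..1} (\<lambda>s. f (x + s *\<^sub>R e)) \<and>
      (\<forall>s\<in>{0..1} - A. ((\<lambda>s. f (x + s *\<^sub>R e)) has_real_derivative gradient f (x + s *\<^sub>R e) \<bullet> e) (at s) \<and>
         \<bar>gradient f (x + s *\<^sub>R e) \<bullet> e\<bar> \<le> C * 2)" if x: "x \<in> ball 0 (R + 2) - hyp p" for x
  proof (intro exI conjI ballI)
    have x: "x \<notin> hyp p" using x by simp
    show "finite (A x)" "0 \<notin> A x" using A x by auto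
    show "continuous_on {0..1} (\<lambda>s. f (x + s *\<^sub>R e))"
    proof (intro continuous_at_imp_continuous_on ballI)
      fix s :: real
      have "isCont (\<lambda>s. x + s *\<^sub>R e) s" by (intro continuous_intros)
      from isCont_o2[OF this cont[OF x]] show "isCont (\<lambda>s. f (x + s *\<^sub>R e)) s" .
    qed
    fix s assume "s \<in> {0..1} - A x"
    then have y: "x + s *\<^sub>R e \<notin> hyp p" using A(3)[OF x] by simp
    show "((\<lambda>s. f (x + s *\<^sub>R e)) has_real_derivative gradient f (x + s *\<^sub>R e) \<bullet> e) (at s)"
      by (intro has_gradient_line has_gradient_gradient diff(1) y)
    have "\<bar>gradient f (x + s *\<^sub>R e) \<bullet> e\<bar> \<le> norm (gradient f (x + s *\<^sub>R e)) * norm e"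
      by (rule Cauchy_Schwarz_ineq2)
    also have "\<dots> \<le> C * 2"
      by (rule mult_mono) (use diff(2)[OF y] e order_trans[OF norm_ge_zero diff(2)[OF y]] in auto)
    finally show "\<bar>gradient f (x + s *\<^sub>R e) \<bullet> e\<bar> \<le> C * 2" .
  qed
  have shift: "(LINT x|lebesgue_on (ball 0 (R + 2)). f (x + h *\<^sub>R e)) = (LINT x|lebesgue_on (ball 0 (R + 2)). f x)"
    if "0 < h" "h < 1" for h
  proof (rule integral_shift_compact_support[OF f supp])
    have "h * norm e \<le> 1 * 2" by (rule mult_mono) (use that e in auto)
    then show "norm (h *\<^sub>R e) \<le> 2" using that by simp
  qed
  show "integrable (lebesgue_on (ball 0 (R + 2))) (\<lambda>x. gradient f x \<bullet> e)"
    "(LINT x|lebesgue_on (ball 0 (R + 2)). gradient f x \<bullet> e) = 0"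
    using integral_directional_derivative[OF _ negligible_hyp[OF p] f B _ shift line] by simp_all
qed

text \<open>Describes the zero extension of a finite element field. Jumps across the hyperplanes are
  allowed, except for the normal component, and for this one only at points that lie on a single
  hyperplane. Injectivity of \<open>hyp\<close> makes different members of \<open>P\<close>
  different hyperplanes, so that points on several of them form a set of codimension two.\<close>

locale broken_field =
  fixes P :: "((real^'d) \<times> real) set" and u :: "'d \<Rightarrow> real^'d \<Rightarrow> real" and R B :: real
  assumes fin: "finite P" and unit: "\<And>p. p \<in> P \<Longrightarrow> norm (fst p) = 1" and inj: "inj_on hyp P"
    and meas: "\<And>i. u i \<in> borel_measurable borel" and bound: "\<And>i x. \<bar>u i x\<bar> \<le> B"
    and supp: "\<And>i x. R \<le> norm x \<Longrightarrow> u i x = 0"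
    and diff: "\<And>i x. x \<notin> \<Union>(hyp ` P) \<Longrightarrow> u i differentiable (at x)"
    and grad: "\<And>i x. x \<notin> \<Union>(hyp ` P) \<Longrightarrow> norm (gradient (u i) x) \<le> B"
    and normal: "\<And>p x. p \<in> P \<Longrightarrow> x \<in> hyp p \<Longrightarrow> (\<And>q. q \<in> P \<Longrightarrow> q \<noteq> p \<Longrightarrow> x \<notin> hyp q) \<Longrightarrow>
      isCont (\<lambda>x. \<Sum>i\<in>UNIV. fst p $ i * u i x) x"
begin

abbreviation "N \<equiv> \<Union>(hyp ` P)"
abbreviation "S \<equiv> ball (0::real^'d) (R + 2)"

lemma B_nonneg: "0 \<le> B"
  using bound[of undefined 0] by linarith

lemma negligible_N: "negligible N"
  using fin unit negligible_hyp by (intro negligible_Union) auto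

lemma borel_C1: "C1 \<omega> \<Longrightarrow> \<omega> \<in> borel_measurable borel"
  using C1_continuous borel_measurable_continuous_onI by blast

lemma scaled_has_gradient:
  assumes "C1 \<omega>" "x \<notin> N"
  shows "has_gradient (\<lambda>x. \<omega> x * u i x) (\<omega> x *\<^sub>R gradient (u i) x + u i x *\<^sub>R gradient \<omega> x) x"
  by (intro has_gradient_mult C1_has_gradient assms(1) has_gradient_gradient diff assms(2))

text \<open>
  With \<open>n = fst p\<close>, the divergence of \<open>f\<close> is the sum of the derivatives of \<open>f\<^sub>i\<close> along the tangential
  vectors \<open>e\<^sub>i - n\<^sub>i n\<close> and of the derivative of \<open>n \<bullet> f\<close> along \<open>n\<close>.
\<close>

lemma integral_divergence_scaled:
  assumes p: "norm (fst p) = 1" and \<omega>: "C1b \<omega>"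
    and off: "\<And>x. x \<in> N - hyp p \<Longrightarrow> \<exists>T. open T \<and> x \<in> T \<and> (\<forall>y\<in>T. \<omega> y = 0)"
    and on: "\<And>x. x \<in> N \<inter> hyp p \<Longrightarrow> (\<exists>T. open T \<and> x \<in> T \<and> (\<forall>y\<in>T. \<omega> y = 0)) \<or>
      isCont (\<lambda>x. \<Sum>i\<in>UNIV. fst p $ i * u i x) x"
  shows "integrable (lebesgue_on S) (\<lambda>x. \<Sum>i\<in>UNIV. gradient (\<lambda>x. \<omega> x * u i x) x $ i)"
    "(LINT x|lebesgue_on S. (\<Sum>i\<in>UNIV. gradient (\<lambda>x. \<omega> x * u i x) x $ i)) = 0"
proof -
  obtain W where W: "0 \<le> W" "\<And>x. \<bar>\<omega> x\<bar> \<le> W" "\<And>x. norm (gradient \<omega> x) \<le> W" using \<omega> C1bE by blast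
  have \<omega>1: "C1 \<omega>" using \<omega> by (simp add: C1b_def)
  define f where "f i x = \<omega> x * u i x" for i x
  define fn where "fn x = (\<Sum>i\<in>UNIV. fst p $ i * f i x)" for x
  have fb: "f i \<in> borel_measurable borel" for i
    unfolding f_def using meas borel_C1[OF \<omega>1] by measurable
  have fnb: "fn \<in> borel_measurable borel" unfolding fn_def using fb by measurable
  have fB: "\<bar>f i x\<bar> \<le> W * B" for i x
    unfolding f_def abs_mult by (intro mult_mono W bound) auto
  have zero: "has_gradient (f i) 0 x" if "open T" "x \<in> T" "\<forall>y\<in>T. \<omega> y = 0" for i T x
    by (rule has_gradient_transform[OF has_gradient_const[of 0] that(1,2)]) (use that in \<open>auto simp: f_def\<close>)
  have fd: "f i differentiable (at x) \<and> norm (gradient (f i) x) \<le> W * B + B * W" if x: "x \<notin> hyp p" for i x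
  proof (cases "x \<in> N")
    case True
    then have "has_gradient (f i) 0 x" using off x zero by blast
    from gradient_eqI[OF this] has_gradient_imp_differentiable[OF this]
    show ?thesis using W(1) B_nonneg by simp
  next
    case False
    have g: "has_gradient (f i) (\<omega> x *\<^sub>R gradient (u i) x + u i x *\<^sub>R gradient \<omega> x) x"
      unfolding f_def[abs_def] by (rule scaled_has_gradient[OF \<omega>1 False])
    have 1: "norm (\<omega> x *\<^sub>R gradient (u i) x) \<le> W * B"
      unfolding norm_scaleR by (intro mult_mono W grad False B_nonneg) auto
    have 2: "norm (u i x *\<^sub>R gradient \<omega> x) \<le> B * W"
      unfolding norm_scaleR by (intro mult_mono W bound B_nonneg) auto
    have "norm (gradient (f i) x) \<le> W * B + B * W"
      unfolding gradient_eqI[OF g] by (rule norm_triangle_mono[OF 1 2])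
    then show ?thesis using has_gradient_imp_differentiable[OF g] by simp
  qed
  have fg: "has_gradient (f i) (gradient (f i) x) x" if "x \<notin> hyp p" for i x
    using fd[OF that] has_gradient_gradient by blast
  have fng: "has_gradient fn (\<Sum>i\<in>UNIV. fst p $ i *\<^sub>R gradient (f i) x) x" if "x \<notin> hyp p" for x
    unfolding fn_def[abs_def] by (intro has_gradient_sum has_gradient_cmult fg that)
  have p_le: "\<bar>fst p $ i\<bar> \<le> 1" for i using component_le_norm_cart[of "fst p" i] p by simp
  have fn_grad: "norm (gradient fn x) \<le> (\<Sum>i\<in>(UNIV::'d set). 1 * (W * B + B * W))" if "x \<notin> hyp p" for x
    unfolding gradient_eqI[OF fng[OF that]]
  proof (rule sum_norm_le)
    fix i
    show "norm (fst p $ i *\<^sub>R gradient (f i) x) \<le> 1 * (W * B + B * W)"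
      unfolding norm_scaleR real_norm_def by (rule mult_mono[OF p_le]) (use fd[OF that] in auto)
  qed
  have fn_bound: "\<bar>fn x\<bar> \<le> (\<Sum>i\<in>(UNIV::'d set). 1 * (W * B))" for x
    unfolding fn_def
  proof (rule order_trans[OF sum_abs sum_mono])
    fix i show "\<bar>fst p $ i * f i x\<bar> \<le> 1 * (W * B)"
      unfolding abs_mult by (rule mult_mono[OF p_le fB]) auto
  qed
  \<comment> \<open>On the hyperplane either \<omega> vanishes nearby or the normal component of
    \<open>u\<close> is continuous; at all other points the components of \<open>f\<close> are
    differentiable.\<close>
  have fn_cont: "isCont fn x" for x
  proof (cases "x \<in> N \<inter> hyp p")
    case True
    show ?thesis
    proof (cases "\<exists>T. open T \<and> x \<in> T \<and> (\<forall>y\<in>T. \<omega> y = 0)")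
      case True
      then obtain T where T: "open T" "x \<in> T" "\<forall>y\<in>T. \<omega> y = 0" by blast
      have "has_gradient fn (\<Sum>i\<in>UNIV. fst p $ i *\<^sub>R 0) x"
        unfolding fn_def[abs_def] by (intro has_gradient_sum has_gradient_cmult zero[OF T])
      then show ?thesis by (rule has_gradient_continuous)
    next
      case False
      with on[OF True] have "isCont (\<lambda>x. \<Sum>i\<in>UNIV. fst p $ i * u i x) x" by argo
      with has_gradient_continuous[OF C1_has_gradient[OF \<omega>1]]
      have "isCont (\<lambda>x. \<omega> x * (\<Sum>i\<in>UNIV. fst p $ i * u i x)) x" by (rule isCont_mult)
      then show ?thesis by (simp add: fn_def[abs_def] f_def sum_distrib_left mult.left_commute)
    qed
  next
    case False
    then consider "x \<notin> hyp p" | "x \<notin> N" by blast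
    then show ?thesis
    proof cases
      case 1 then show ?thesis using has_gradient_continuous[OF fng] by simp
    next
      case 2
      have "has_gradient fn (\<Sum>i\<in>UNIV. fst p $ i *\<^sub>R (\<omega> x *\<^sub>R gradient (u i) x + u i x *\<^sub>R gradient \<omega> x)) x"
        unfolding fn_def[abs_def] f_def by (intro has_gradient_sum has_gradient_cmult scaled_has_gradient \<omega>1 2)
      then show ?thesis by (rule has_gradient_continuous)
    qed
  qed
  define t where "t i = axis i 1 - fst p $ i *\<^sub>R fst p" for i
  have pp: "fst p \<bullet> fst p = 1" using p by (simp add: norm_eq_1)
  have t: "norm (t i) \<le> 2" "fst p \<bullet> t i = 0" for i
  proof -
    have "norm (t i) \<le> norm (axis i (1::real)) + norm (fst p $ i *\<^sub>R fst p)"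
      unfolding t_def by (rule norm_triangle_ineq4)
    then show "norm (t i) \<le> 2" using p p_le[of i] by simp
    show "fst p \<bullet> t i = 0" by (simp add: t_def inner_diff_right pp inner_axis)
  qed
  have f0: "f i x = 0" "fn x = 0" if "R \<le> norm x" for i x using supp[OF that] by (simp_all add: f_def fn_def)
  have T: "integrable (lebesgue_on S) (\<lambda>x. gradient (f i) x \<bullet> t i)"
    "(LINT x|lebesgue_on S. gradient (f i) x \<bullet> t i) = 0" for i
    using integral_gradient_off_hyperplane[OF p fb fB f0(1) fd[THEN conjunct1] fd[THEN conjunct2] t(1) disjI1[OF t(2)]]
    by simp_all
  have "norm (fst p) \<le> 2" using p by simp
  then have F: "integrable (lebesgue_on S) (\<lambda>x. gradient fn x \<bullet> fst p)"
    "(LINT x|lebesgue_on S. gradient fn x \<bullet> fst p) = 0"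
    using integral_gradient_off_hyperplane[OF p fnb fn_bound f0(2) has_gradient_imp_differentiable[OF fng] fn_grad,
        where e = "fst p"] fn_cont by simp_all
  define J where "J x = (\<Sum>i\<in>UNIV. gradient (f i) x \<bullet> t i) + gradient fn x \<bullet> fst p" for x
  have J: "integrable (lebesgue_on S) J" "(LINT x|lebesgue_on S. J x) = 0"
    unfolding J_def using T F by (simp_all add: Bochner_Integration.integral_sum)
  have eq: "(\<Sum>i\<in>UNIV. gradient (\<lambda>x. \<omega> x * u i x) x $ i) = J x" if "x \<in> S - hyp p" for x
  proof -
    have "x \<notin> hyp p" using that by simp
    then have "gradient fn x \<bullet> fst p = (\<Sum>i\<in>UNIV. fst p $ i * (gradient (f i) x \<bullet> fst p))"
      by (simp add: gradient_eqI[OF fng] inner_sum_left)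
    moreover have "gradient (f i) x \<bullet> t i = gradient (f i) x $ i - fst p $ i * (gradient (f i) x \<bullet> fst p)" for i
      by (simp add: t_def inner_diff_right inner_axis)
    ultimately have "J x = (\<Sum>i\<in>UNIV. gradient (f i) x $ i)"
      by (simp add: J_def sum_subtractf)
    then show ?thesis by (simp add: f_def[abs_def])
  qed
  show "integrable (lebesgue_on S) (\<lambda>x. \<Sum>i\<in>UNIV. gradient (\<lambda>x. \<omega> x * u i x) x $ i)"
    "(LINT x|lebesgue_on S. (\<Sum>i\<in>UNIV. gradient (\<lambda>x. \<omega> x * u i x) x $ i)) = 0"
    using integrable_cong_negligible[OF J(1) negligible_hyp[OF p] _ eq] J(2) by simp_all
qed

section \<open>A partition of unity around the hyperplanes\<close>

definition pairs where "pairs = {r \<in> P \<times> P. fst r \<noteq> snd r}"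

text \<open>Vanishes near every point common to two different hyperplanes, the places at which
  \<open>normal\<close> gives no information.\<close>

definition edge_cut :: "real \<Rightarrow> real^'d \<Rightarrow> real" where
  "edge_cut \<epsilon> x = (\<Prod>r\<in>pairs. pair_cut \<epsilon> r x)"

lemma finite_pairs: "finite pairs"
  unfolding pairs_def using fin by simp

lemma C1b_pair_cut: assumes "0 < \<epsilon>" "r \<in> pairs" shows "C1b (pair_cut \<epsilon> r)"
proof (rule C1bI)
  have r: "norm (fst (fst r)) = 1" "norm (fst (snd r)) = 1"
    using assms(2) unit by (auto simp: pairs_def)
  show "C1 (pair_cut \<epsilon> r)" "norm (gradient (pair_cut \<epsilon> r) x) \<le> 32 / \<epsilon>" for x
    using gradient_pair_cut[OF assms(1) r] by auto
  show "\<bar>pair_cut \<epsilon> r x\<bar> \<le> 1" for x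
    unfolding pair_cut_def using ramp_bounds abs_of_nonneg by metis
qed

lemma C1b_edge_cut: "0 < \<epsilon> \<Longrightarrow> C1b (edge_cut \<epsilon>)"
  unfolding edge_cut_def[abs_def] by (intro C1b_prod C1b_pair_cut)

lemma pair_cut_bounds: "0 \<le> pair_cut \<epsilon> r x" "pair_cut \<epsilon> r x \<le> 1"
  unfolding pair_cut_def by (rule ramp_bounds)+

lemma edge_cut_bounds: "0 \<le> edge_cut \<epsilon> x" "edge_cut \<epsilon> x \<le> 1"
  unfolding edge_cut_def by (auto intro!: prod_nonneg prod_le_1 pair_cut_bounds)

lemma edge_cut_nonzero:
  assumes "edge_cut \<epsilon> x \<noteq> 0" "p \<in> P" "q \<in> P" "p \<noteq> q" "0 < \<epsilon>"
  shows "\<epsilon>\<^sup>2 < (level p x)\<^sup>2 + (level q x)\<^sup>2"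
proof (rule ccontr)
  assume "\<not> ?thesis"
  then have "((level p x)\<^sup>2 + (level q x)\<^sup>2) / \<epsilon>\<^sup>2 \<le> 1" using assms(5) by simp
  then have "pair_cut \<epsilon> (p, q) x = 0" by (simp add: pair_cut_def ramp_eq_0)
  moreover have "(p, q) \<in> pairs" using assms by (simp add: pairs_def)
  ultimately have "edge_cut \<epsilon> x = 0" unfolding edge_cut_def using finite_pairs by (metis prod_zero)
  then show False using assms(1) by simp
qed

lemma near_cut_eq_0: "0 < \<epsilon> \<Longrightarrow> \<epsilon>\<^sup>2 / 4 \<le> (level p x)\<^sup>2 \<Longrightarrow> near_cut \<epsilon> p x = 0"
  unfolding near_cut_def by (subst ramp_eq_1) (auto simp: field_simps)

lemma near_cut_eq_1: "0 < \<epsilon> \<Longrightarrow> (level p x)\<^sup>2 \<le> \<epsilon>\<^sup>2 / 8 \<Longrightarrow> near_cut \<epsilon> p x = 1"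
  unfolding near_cut_def by (subst ramp_eq_0) (auto simp: field_simps)

lemma open_level_square_less: "open {x. (level q x)\<^sup>2 < c}"
  unfolding level_def by (intro open_Collect_less continuous_intros)

text \<open>Where \<open>edge_cut\<close> is nonzero, the squared levels of \<open>p\<close> and
  \<open>q\<close> add up to more than \<open>\<epsilon>\<^sup>2\<close>. Close to \<open>q\<close>,
  with squared level below three quarters of this, the remaining quarter falls to \<open>p\<close>,
  and there \<open>near_cut\<close> of \<open>p\<close> is zero.\<close>

lemma edge_near_cut_zero:
  assumes \<epsilon>: "0 < \<epsilon>" and "p \<in> P" "q \<in> P" "p \<noteq> q" "x \<in> hyp q"
  shows "\<exists>T. open T \<and> x \<in> T \<and> (\<forall>y\<in>T. edge_cut \<epsilon> y * near_cut \<epsilon> p y = 0)"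
proof (intro exI conjI ballI)
  show "open {y. (level q y)\<^sup>2 < 3 / 4 * \<epsilon>\<^sup>2}" by (rule open_level_square_less)
  show "x \<in> {y. (level q y)\<^sup>2 < 3 / 4 * \<epsilon>\<^sup>2}" using assms by (simp add: mem_hyp)
  fix y assume y: "y \<in> {y. (level q y)\<^sup>2 < 3 / 4 * \<epsilon>\<^sup>2}"
  show "edge_cut \<epsilon> y * near_cut \<epsilon> p y = 0"
  proof (cases "edge_cut \<epsilon> y = 0")
    case False
    from edge_cut_nonzero[OF this assms(2,3,4) \<epsilon>] y have "\<epsilon>\<^sup>2 / 4 \<le> (level p y)\<^sup>2" by simp
    from near_cut_eq_0[OF \<epsilon> this] show ?thesis by simp
  qed simp
qed

text \<open>Where the squared level of \<open>q\<close> is below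
  \<open>\<epsilon>\<^sup>2 / 8\<close>, \<open>near_cut\<close> of \<open>q\<close> is 1. If
  \<open>edge_cut\<close> is nonzero as well, all other hyperplanes are too far away for their
  \<open>near_cut\<close> to contribute, and the sum is exactly 1.\<close>

lemma edge_far_cut_zero:
  assumes \<epsilon>: "0 < \<epsilon>" and q: "q \<in> P" and x: "x \<in> hyp q"
  shows "\<exists>T. open T \<and> x \<in> T \<and> (\<forall>y\<in>T. edge_cut \<epsilon> y * (1 - (\<Sum>p\<in>P. near_cut \<epsilon> p y)) = 0)"
proof (intro exI conjI ballI)
  show "open {y. (level q y)\<^sup>2 < \<epsilon>\<^sup>2 / 8}" by (rule open_level_square_less)
  show "x \<in> {y. (level q y)\<^sup>2 < \<epsilon>\<^sup>2 / 8}" using assms by (simp add: mem_hyp)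
  fix y assume y: "y \<in> {y. (level q y)\<^sup>2 < \<epsilon>\<^sup>2 / 8}"
  show "edge_cut \<epsilon> y * (1 - (\<Sum>p\<in>P. near_cut \<epsilon> p y)) = 0"
  proof (cases "edge_cut \<epsilon> y = 0")
    case False
    have "near_cut \<epsilon> p y = 0" if "p \<in> P - {q}" for p
    proof (rule near_cut_eq_0[OF \<epsilon>])
      have "p \<in> P" "p \<noteq> q" using that by auto
      from y have "(level q y)\<^sup>2 < \<epsilon>\<^sup>2 / 8" by blast
      with edge_cut_nonzero[OF False \<open>p \<in> P\<close> q \<open>p \<noteq> q\<close> \<epsilon>] show "\<epsilon>\<^sup>2 / 4 \<le> (level p y)\<^sup>2"
        using zero_le_power2[of \<epsilon>] by linarith
    qed
    then have "(\<Sum>p\<in>P - {q}. near_cut \<epsilon> p y) = 0" by simp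
    moreover have "near_cut \<epsilon> q y = 1"
      by (rule near_cut_eq_1[OF \<epsilon>]) (use y in auto)
    ultimately have "(\<Sum>p\<in>P. near_cut \<epsilon> p y) = 1" using sum.remove[OF fin q, of "\<lambda>p. near_cut \<epsilon> p y"] by simp
    then show ?thesis by simp
  qed simp
qed

text \<open>\<open>edge_cut\<close> is split into its products with the \<open>near_cut\<close>
  functions and a remainder. The product belonging to \<open>p\<close> vanishes near all other
  hyperplanes, the remainder near all of them, so \<open>integral_divergence_scaled\<close> treats
  each summand.\<close>

lemma integral_divergence_edge_cut:
  assumes \<epsilon>: "0 < \<epsilon>"
  shows "integrable (lebesgue_on S) (\<lambda>x. \<Sum>i\<in>UNIV. gradient (\<lambda>x. edge_cut \<epsilon> x * u i x) x $ i)"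
    "(LINT x|lebesgue_on S. (\<Sum>i\<in>UNIV. gradient (\<lambda>x. edge_cut \<epsilon> x * u i x) x $ i)) = 0"
proof -
  define \<omega> where "\<omega> p x = edge_cut \<epsilon> x * near_cut \<epsilon> p x" for p x
  define \<omega>0 where "\<omega>0 x = edge_cut \<epsilon> x * (1 - (\<Sum>p\<in>P. near_cut \<epsilon> p x))" for x
  define J where "J w x = (\<Sum>i\<in>UNIV. gradient (\<lambda>x. w x * u i x) x $ i)" for w x
  have \<omega>: "C1b (\<omega> p)" if "p \<in> P" for p
    unfolding \<omega>_def[abs_def] by (intro C1b_mult C1b_edge_cut C1b_near_cut \<epsilon> unit that)
  have \<omega>0: "C1b \<omega>0"
    unfolding \<omega>0_def[abs_def]
    by (intro C1b_mult C1b_diff C1b_const C1b_sum C1b_edge_cut C1b_near_cut \<epsilon> unit)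
  have Jp: "integrable (lebesgue_on S) (J (\<omega> p))" "(LINT x|lebesgue_on S. J (\<omega> p) x) = 0" if p: "p \<in> P" for p
  proof -
    have off: "\<exists>T. open T \<and> x \<in> T \<and> (\<forall>y\<in>T. \<omega> p y = 0)" if x: "x \<in> N - hyp p" for x
    proof -
      from x obtain q where "q \<in> P" "x \<in> hyp q" "p \<noteq> q" by blast
      then show ?thesis unfolding \<omega>_def using edge_near_cut_zero[OF \<epsilon> p] by simp
    qed
    have on: "(\<exists>T. open T \<and> x \<in> T \<and> (\<forall>y\<in>T. \<omega> p y = 0)) \<or>
      isCont (\<lambda>x. \<Sum>i\<in>UNIV. fst p $ i * u i x) x" if x: "x \<in> N \<inter> hyp p" for x
    proof (cases "\<exists>q\<in>P. q \<noteq> p \<and> x \<in> hyp q")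
      case True
      then obtain q where "q \<in> P" "x \<in> hyp q" "p \<noteq> q" by blast
      then have "\<exists>T. open T \<and> x \<in> T \<and> (\<forall>y\<in>T. \<omega> p y = 0)"
        unfolding \<omega>_def using edge_near_cut_zero[OF \<epsilon> p] by simp
      then show ?thesis ..
    next
      case False
      then have "isCont (\<lambda>x. \<Sum>i\<in>UNIV. fst p $ i * u i x) x"
        using x by (intro normal[OF p]) auto
      then show ?thesis ..
    qed
    show "integrable (lebesgue_on S) (J (\<omega> p))" "(LINT x|lebesgue_on S. J (\<omega> p) x) = 0"
      unfolding J_def[abs_def] using integral_divergence_scaled[OF unit[OF p] \<omega>[OF p] off on] by simp_all
  qed
  have J0: "integrable (lebesgue_on S) (J \<omega>0)" "(LINT x|lebesgue_on S. J \<omega>0 x) = 0"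
  proof -
    fix k :: 'd
    \<comment> \<open>The remainder has no singular hyperplane left, so any unit normal will do;
      \<open>p0\<close> has no connection with \<open>P\<close>.\<close>
    define p0 :: "(real^'d) \<times> real" where "p0 = (axis k 1, 0)"
    have p0: "norm (fst p0) = 1" by (simp add: p0_def)
    have zero: "\<exists>T. open T \<and> x \<in> T \<and> (\<forall>y\<in>T. \<omega>0 y = 0)" if "x \<in> N" for x
      unfolding \<omega>0_def using that edge_far_cut_zero[OF \<epsilon>] by auto
    show "integrable (lebesgue_on S) (J \<omega>0)" "(LINT x|lebesgue_on S. J \<omega>0 x) = 0"
      unfolding J_def[abs_def] using integral_divergence_scaled[OF p0 \<omega>0 zero disjI1[OF zero]] by simp_all
  qed
  have eq: "J (edge_cut \<epsilon>) x = (\<Sum>p\<in>P. J (\<omega> p) x) + J \<omega>0 x" if x: "x \<in> S - N" for x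
  proof -
    have x: "x \<notin> N" using x by simp
    have sc: "has_gradient (\<lambda>x. w x * u i x) (gradient (\<lambda>x. w x * u i x) x) x" if "C1b w" for w i
      using scaled_has_gradient[of w x i] that x has_gradient_gradient has_gradient_imp_differentiable
      unfolding C1b_def by blast
    have "gradient (\<lambda>x. edge_cut \<epsilon> x * u i x) x =
      (\<Sum>p\<in>P. gradient (\<lambda>x. \<omega> p x * u i x) x) + gradient (\<lambda>x. \<omega>0 x * u i x) x" for i
    proof (rule gradient_eqI)
      have "(\<lambda>x. edge_cut \<epsilon> x * u i x) = (\<lambda>x. (\<Sum>p\<in>P. \<omega> p x * u i x) + \<omega>0 x * u i x)"
        by (simp add: \<omega>_def \<omega>0_def sum_distrib_right[symmetric] sum_distrib_left[symmetric] algebra_simps)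
      then show "has_gradient (\<lambda>x. edge_cut \<epsilon> x * u i x)
        ((\<Sum>p\<in>P. gradient (\<lambda>x. \<omega> p x * u i x) x) + gradient (\<lambda>x. \<omega>0 x * u i x) x) x"
        by (simp only:) (intro has_gradient_add has_gradient_sum sc \<omega> \<omega>0)
    qed
    then have "J (edge_cut \<epsilon>) x = (\<Sum>i\<in>UNIV. (\<Sum>p\<in>P. gradient (\<lambda>x. \<omega> p x * u i x) x $ i)) + J \<omega>0 x"
      by (simp add: J_def sum.distrib)
    also have "(\<Sum>i\<in>UNIV. (\<Sum>p\<in>P. gradient (\<lambda>x. \<omega> p x * u i x) x $ i)) = (\<Sum>p\<in>P. J (\<omega> p) x)"
      unfolding J_def by (rule sum.swap)
    finally show ?thesis .
  qed
  have int: "integrable (lebesgue_on S) (\<lambda>x. (\<Sum>p\<in>P. J (\<omega> p) x) + J \<omega>0 x)"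
    using Jp(1) J0(1) by simp
  have "(LINT x|lebesgue_on S. (\<Sum>p\<in>P. J (\<omega> p) x) + J \<omega>0 x) = 0"
    using Jp J0 by (simp add: Bochner_Integration.integral_sum)
  then show "integrable (lebesgue_on S) (\<lambda>x. \<Sum>i\<in>UNIV. gradient (\<lambda>x. edge_cut \<epsilon> x * u i x) x $ i)"
    "(LINT x|lebesgue_on S. (\<Sum>i\<in>UNIV. gradient (\<lambda>x. edge_cut \<epsilon> x * u i x) x $ i)) = 0"
    using integrable_cong_negligible[OF int negligible_N _ eq] unfolding J_def by simp_all
qed

text \<open>In the product rule the undifferentiated factors lie between 0 and 1, and the
  differentiated one is supported in its double strip.\<close>

lemma norm_gradient_edge_cut:
  assumes \<epsilon>: "0 < \<epsilon>" and x: "norm x < R"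
  shows "norm (gradient (edge_cut \<epsilon>) x) \<le> (\<Sum>r\<in>pairs. 32 / \<epsilon> * indicator (double_strip R \<epsilon> r) x)"
proof -
  have r: "norm (fst (fst r)) = 1" "norm (fst (snd r)) = 1" if "r \<in> pairs" for r
    using that unit by (auto simp: pairs_def)
  have "has_gradient (edge_cut \<epsilon>)
    (\<Sum>r\<in>pairs. (\<Prod>s\<in>pairs - {r}. pair_cut \<epsilon> s x) *\<^sub>R gradient (pair_cut \<epsilon> r) x) x"
    unfolding edge_cut_def[abs_def]
    by (intro has_gradient_prod C1_has_gradient gradient_pair_cut(1) \<epsilon> r)
  from gradient_eqI[OF this] have "norm (gradient (edge_cut \<epsilon>) x) =
    norm (\<Sum>r\<in>pairs. (\<Prod>s\<in>pairs - {r}. pair_cut \<epsilon> s x) *\<^sub>R gradient (pair_cut \<epsilon> r) x)"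
    by (simp only:)
  also have "\<dots> \<le> (\<Sum>r\<in>pairs. 32 / \<epsilon> * indicator (double_strip R \<epsilon> r) x)"
  proof (rule sum_norm_le)
    fix r assume rp: "r \<in> pairs"
    have 0: "0 \<le> (\<Prod>s\<in>pairs - {r}. pair_cut \<epsilon> s x)" by (intro prod_nonneg ballI pair_cut_bounds)
    have 1: "(\<Prod>s\<in>pairs - {r}. pair_cut \<epsilon> s x) \<le> 1" by (intro prod_le_1 conjI pair_cut_bounds)
    have "norm (gradient (pair_cut \<epsilon> r) x) \<le> 32 / \<epsilon> * indicator (double_strip R \<epsilon> r) x"
    proof (cases "\<bar>level (fst r) x\<bar> < 2 * \<epsilon> \<and> \<bar>level (snd r) x\<bar> < 2 * \<epsilon>")
      case True
      then have "x \<in> double_strip R \<epsilon> r" using x by (simp add: double_strip_def)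
      then show ?thesis using gradient_pair_cut(2)[OF \<epsilon> r[OF rp]] by simp
    next
      case False
      from gradient_pair_cut(3)[OF \<epsilon> r[OF rp] this] show ?thesis using \<epsilon> by simp
    qed
    then have "(\<Prod>s\<in>pairs - {r}. pair_cut \<epsilon> s x) * norm (gradient (pair_cut \<epsilon> r) x)
      \<le> 1 * (32 / \<epsilon> * indicator (double_strip R \<epsilon> r) x)"
      using 1 by (intro mult_mono) auto
    then show "norm ((\<Prod>s\<in>pairs - {r}. pair_cut \<epsilon> s x) *\<^sub>R gradient (pair_cut \<epsilon> r) x)
      \<le> 32 / \<epsilon> * indicator (double_strip R \<epsilon> r) x"
      using 0 by simp
  qed
  finally show ?thesis .
qed

section \<open>Removing the cut-off\<close>

abbreviation "dv \<equiv> \<lambda>x. \<Sum>i\<in>UNIV. gradient (u i) x $ i"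

lemma gradient_nth_measurable: "(\<lambda>x. gradient (u i) x $ k) \<in> borel_measurable (lebesgue_on S)"
  using gradient_inner_measurable[OF meas _ negligible_N diff, of S i "axis k 1"] by (simp add: inner_axis)

lemma dv_measurable: "dv \<in> borel_measurable (lebesgue_on S)"
  using gradient_nth_measurable by measurable

lemma dv_bound: assumes "x \<notin> N" shows "\<bar>dv x\<bar> \<le> real CARD('d) * B"
proof -
  have "\<bar>dv x\<bar> \<le> (\<Sum>i\<in>(UNIV::'d set). B)"
    by (rule order_trans[OF sum_abs sum_mono]) (use grad[OF assms] component_le_norm_cart order_trans in blast)
  then show ?thesis by simp
qed

lemma AE_notin_N: "AE x in lebesgue_on S. x \<notin> N"
  by (rule AE_lebesgue_on_notin[OF negligible_N]) simp

lemma edge_cut_dv_measurable: "0 < \<epsilon> \<Longrightarrow> (\<lambda>x. edge_cut \<epsilon> x * dv x) \<in> borel_measurable (lebesgue_on S)"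
proof -
  assume "0 < \<epsilon>"
  then have "C1 (edge_cut \<epsilon>)" using C1b_edge_cut by (simp add: C1b_def)
  then have "edge_cut \<epsilon> \<in> borel_measurable (lebesgue_on S)"
    by (intro borel_imp_measurable_lebesgue_on borel_C1)
  then show ?thesis using dv_measurable by measurable
qed

lemma edge_cut_dv_bound: assumes "x \<notin> N" shows "\<bar>edge_cut \<epsilon> x * dv x\<bar> \<le> real CARD('d) * B"
proof -
  have "\<bar>edge_cut \<epsilon> x\<bar> * \<bar>dv x\<bar> \<le> 1 * (real CARD('d) * B)"
    using edge_cut_bounds[of \<epsilon> x] dv_bound[OF assms] by (intro mult_mono) auto
  then show ?thesis by (simp add: abs_mult)
qed

text \<open>By the product rule \<open>edge_cut \<epsilon> x * dv x\<close> differs from the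
  divergence of the cut-off field, whose integral is zero, by the inner product of \<open>u\<close>
  with the gradient of the cut-off. This difference lives on the double strips.\<close>

lemma integral_edge_cut_dv:
  assumes \<epsilon>: "0 < \<epsilon>"
  shows "\<bar>LINT x|lebesgue_on S. edge_cut \<epsilon> x * dv x\<bar>
    \<le> real CARD('d) * B * (\<Sum>r\<in>pairs. 32 / \<epsilon> * measure lebesgue (double_strip R \<epsilon> r))"
proof -
  interpret finite_measure "lebesgue_on S" by (rule finite_measure_lebesgue_on) simp
  define J where "J x = (\<Sum>i\<in>UNIV. gradient (\<lambda>x. edge_cut \<epsilon> x * u i x) x $ i)" for x
  have J: "integrable (lebesgue_on S) J" "(LINT x|lebesgue_on S. J x) = 0"
    unfolding J_def[abs_def] by (rule integral_divergence_edge_cut[OF \<epsilon>])+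
  have bb: "AE x in lebesgue_on S. norm (edge_cut \<epsilon> x * dv x) \<le> real CARD('d) * B"
    using AE_notin_N by eventually_elim (unfold real_norm_def, rule edge_cut_dv_bound)
  have int: "integrable (lebesgue_on S) (\<lambda>x. edge_cut \<epsilon> x * dv x)"
    by (rule integrable_const_bound[OF bb edge_cut_dv_measurable[OF \<epsilon>]])
  have ds: "double_strip R \<epsilon> r \<subseteq> S" for r by (auto simp: double_strip_def)
  have dsm: "double_strip R \<epsilon> r \<in> sets (lebesgue_on S)" for r
    using ds lmeasurable_double_strip[of R \<epsilon> r] by (simp add: sets_restrict_space_iff fmeasurableD)
  have dsi: "integrable (lebesgue_on S) (indicator (double_strip R \<epsilon> r) :: _ \<Rightarrow> real)" for r
    using dsm[of r] by (simp add: Int_absorb2[OF ds] emeasure_finite less_top[symmetric])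
  have dsv: "measure (lebesgue_on S) (double_strip R \<epsilon> r) = measure lebesgue (double_strip R \<epsilon> r)" for r
    by (rule measure_restrict_space) (use ds in auto)
  define w where "w x = real CARD('d) * B * (\<Sum>r\<in>pairs. 32 / \<epsilon> * indicator (double_strip R \<epsilon> r) x)" for x
  have w: "integrable (lebesgue_on S) w" unfolding w_def using dsi by simp
  have pt: "\<bar>J x - edge_cut \<epsilon> x * dv x\<bar> \<le> w x" if x: "x \<notin> N" for x
  proof -
    have E: "C1 (edge_cut \<epsilon>)" using C1b_edge_cut[OF \<epsilon>] by (simp add: C1b_def)
    have "gradient (\<lambda>x. edge_cut \<epsilon> x * u i x) x = edge_cut \<epsilon> x *\<^sub>R gradient (u i) x + u i x *\<^sub>R gradient (edge_cut \<epsilon>) x" for i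
      by (rule gradient_eqI[OF scaled_has_gradient[OF E x]])
    then have eq: "J x - edge_cut \<epsilon> x * dv x = (\<Sum>i\<in>UNIV. u i x * gradient (edge_cut \<epsilon>) x $ i)"
      by (simp add: J_def sum.distrib sum_distrib_left)
    show ?thesis
    \<comment> \<open>Double strips are confined to the ball of radius \<open>R\<close>; outside it
      the field vanishes and no bound on the cut-off is needed.\<close>
    proof (cases "norm x < R")
      case True
      let ?s = "(\<Sum>r\<in>pairs. 32 / \<epsilon> * indicator (double_strip R \<epsilon> r) x)"
      have "\<bar>u i x * gradient (edge_cut \<epsilon>) x $ i\<bar> \<le> B * ?s" for i
        unfolding abs_mult
        using order_trans[OF component_le_norm_cart norm_gradient_edge_cut[OF \<epsilon> True]]
        by (intro mult_mono bound B_nonneg) auto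
      then have "\<bar>\<Sum>i\<in>UNIV. u i x * gradient (edge_cut \<epsilon>) x $ i\<bar> \<le> (\<Sum>i\<in>(UNIV::'d set). B * ?s)"
        by (intro order_trans[OF sum_abs sum_mono])
      then show ?thesis unfolding eq w_def by simp
    next
      case False
      then have "J x - edge_cut \<epsilon> x * dv x = 0" unfolding eq using supp by simp
      moreover have "0 \<le> w x" unfolding w_def using B_nonneg \<epsilon> by (intro mult_nonneg_nonneg sum_nonneg) auto
      ultimately show ?thesis by simp
    qed
  qed
  have "\<bar>LINT x|lebesgue_on S. edge_cut \<epsilon> x * dv x\<bar> = \<bar>LINT x|lebesgue_on S. J x - edge_cut \<epsilon> x * dv x\<bar>"
    using J int by simp
  also have "\<dots> \<le> (LINT x|lebesgue_on S. w x)"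
  proof -
    have "norm (LINT x|lebesgue_on S. J x - edge_cut \<epsilon> x * dv x) \<le> (LINT x|lebesgue_on S. norm (J x - edge_cut \<epsilon> x * dv x))"
      by (rule integral_norm_bound)
    also have "\<dots> \<le> (LINT x|lebesgue_on S. w x)"
    proof (rule integral_mono_AE)
      show "AE x in lebesgue_on S. norm (J x - edge_cut \<epsilon> x * dv x) \<le> w x"
        using AE_notin_N by eventually_elim (unfold real_norm_def, rule pt)
    qed (use J int w in auto)
    finally show ?thesis by simp
  qed
  also have "\<dots> = real CARD('d) * B * (\<Sum>r\<in>pairs. 32 / \<epsilon> * measure lebesgue (double_strip R \<epsilon> r))"
    unfolding w_def using dsi by (simp add: Bochner_Integration.integral_sum dsv Int_absorb2[OF ds])
  finally show ?thesis .
qed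

text \<open>Off the hyperplanes all levels are nonzero, so every factor eventually reaches the
  plateau of \<open>ramp\<close>; the sequence is even eventually constant.\<close>

lemma edge_cut_tendsto:
  assumes x: "x \<notin> N" shows "(\<lambda>k. edge_cut (1 / real (Suc k)) x) \<longlonglongrightarrow> 1"
proof -
  have "\<forall>\<^sub>F k in sequentially. \<forall>r\<in>pairs. pair_cut (1 / real (Suc k)) r x = 1"
  proof (rule eventually_ball_finite[OF finite_pairs], rule ballI)
    fix r assume r: "r \<in> pairs"
    define c where "c = (level (fst r) x)\<^sup>2 + (level (snd r) x)\<^sup>2"
    have "fst r \<in> P" using r by (auto simp: pairs_def)
    then have "level (fst r) x \<noteq> 0" using x mem_hyp by blast
    then have c: "0 < c" unfolding c_def by (simp add: add_pos_nonneg)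
    obtain k0 :: nat where k0: "2 / c < real k0" using reals_Archimedean2 by blast
    show "\<forall>\<^sub>F k in sequentially. pair_cut (1 / real (Suc k)) r x = 1"
    proof (rule eventually_sequentiallyI[of k0])
      fix k assume "k0 \<le> k"
      then have "2 / c \<le> real (Suc k)" using k0 by linarith
      then have "2 \<le> c * real (Suc k)" using c by (simp add: field_simps)
      also have "\<dots> \<le> c * (real (Suc k))\<^sup>2"
        using c by (intro mult_left_mono self_le_power) auto
      finally have "2 \<le> c / (1 / real (Suc k))\<^sup>2" by (simp add: power_divide del: of_nat_Suc)
      then show "pair_cut (1 / real (Suc k)) r x = 1"
        unfolding pair_cut_def c_def by (rule ramp_eq_1)
    qed
  qed
  then have "\<forall>\<^sub>F k in sequentially. edge_cut (1 / real (Suc k)) x = 1"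
    by eventually_elim (simp add: edge_cut_def)
  then show ?thesis by (rule tendsto_eventually)
qed

text \<open>With \<open>\<epsilon> = 1 / real (Suc k)\<close> the integrals of
  \<open>edge_cut \<epsilon> x * dv x\<close> tend to that of \<open>dv\<close> by dominated
  convergence. They are also bounded by a multiple of
  \<open>1 / \<epsilon> * \<epsilon>\<^sup>2\<close>, hence tend to zero.\<close>

theorem integral_divergence_eq_0: "integrable (lebesgue_on S) dv" "(LINT x|lebesgue_on S. dv x) = 0"
proof -
  interpret finite_measure "lebesgue_on S" by (rule finite_measure_lebesgue_on) simp
  define I where "I k = (LINT x|lebesgue_on S. edge_cut (1 / real (Suc k)) x * dv x)" for k
  have lim: "I \<longlonglongrightarrow> (LINT x|lebesgue_on S. dv x)"
    unfolding I_def
  proof (rule integral_dominated_convergence[where w = "\<lambda>_. real CARD('d) * B"])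
    show "dv \<in> borel_measurable (lebesgue_on S)" by (rule dv_measurable)
    show "(\<lambda>x. edge_cut (1 / real (Suc k)) x * dv x) \<in> borel_measurable (lebesgue_on S)" for k
      by (rule edge_cut_dv_measurable) simp
    show "AE x in lebesgue_on S. (\<lambda>k. edge_cut (1 / real (Suc k)) x * dv x) \<longlonglongrightarrow> dv x"
      using AE_notin_N
    proof eventually_elim
      fix x assume "x \<notin> N"
      from tendsto_mult_right[OF edge_cut_tendsto[OF this], of "dv x"]
      show "(\<lambda>k. edge_cut (1 / real (Suc k)) x * dv x) \<longlonglongrightarrow> dv x" by simp
    qed
    show "AE x in lebesgue_on S. norm (edge_cut (1 / real (Suc k)) x * dv x) \<le> real CARD('d) * B" for k
      using AE_notin_N by eventually_elim (unfold real_norm_def, rule edge_cut_dv_bound)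
  qed simp
  have "\<exists>K\<ge>0. \<forall>\<epsilon>>0. measure lebesgue (double_strip R \<epsilon> r) \<le> K * \<epsilon>\<^sup>2" if r: "r \<in> pairs" for r
  proof -
    obtain p q where pq: "r = (p, q)" "p \<in> P" "q \<in> P" "p \<noteq> q" using r by (auto simp: pairs_def)
    have "hyp p \<noteq> hyp q" using pq inj by (auto simp: inj_on_def)
    from measure_double_strip[OF unit[OF pq(2)] unit[OF pq(3)] this, of R]
    obtain K where "0 \<le> K" "\<And>\<epsilon>. 0 < \<epsilon> \<Longrightarrow> measure lebesgue (double_strip R \<epsilon> (p, q)) \<le> K * \<epsilon>\<^sup>2" by blast
    then show ?thesis unfolding pq(1) by blast
  qed
  then obtain K where K: "\<And>r \<epsilon>. r \<in> pairs \<Longrightarrow> 0 < \<epsilon> \<Longrightarrow> measure lebesgue (double_strip R \<epsilon> r) \<le> K r * \<epsilon>\<^sup>2"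
    by metis
  define C where "C = real CARD('d) * B * (\<Sum>r\<in>pairs. 32 * K r)"
  have bnd: "norm (I k) \<le> C * (1 / real (Suc k))" for k
  proof -
    define \<epsilon> where "\<epsilon> = 1 / real (Suc k)"
    have \<epsilon>: "0 < \<epsilon>" by (simp add: \<epsilon>_def)
    have "norm (I k) \<le> real CARD('d) * B * (\<Sum>r\<in>pairs. 32 / \<epsilon> * measure lebesgue (double_strip R \<epsilon> r))"
      unfolding I_def \<epsilon>_def[symmetric] real_norm_def by (rule integral_edge_cut_dv[OF \<epsilon>])
    also have "\<dots> \<le> real CARD('d) * B * (\<Sum>r\<in>pairs. 32 / \<epsilon> * (K r * \<epsilon>\<^sup>2))"
      using \<epsilon> B_nonneg by (intro mult_left_mono sum_mono K) auto
    also have "\<dots> = C * \<epsilon>"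
      using \<epsilon> by (simp add: C_def sum_distrib_left sum_distrib_right power2_eq_square ac_simps)
    finally show ?thesis by (simp only: \<epsilon>_def)
  qed
  have "(\<lambda>k. C * (1 / real (Suc k))) \<longlonglongrightarrow> C * 0"
    using LIMSEQ_inverse_real_of_nat by (intro tendsto_mult_left) (simp add: inverse_eq_divide)
  then have "I \<longlonglongrightarrow> 0"
    using bnd by (intro Lim_null_comparison[of I]) (simp_all add: always_eventually del: of_nat_Suc)
  then show "(LINT x|lebesgue_on S. dv x) = 0" using lim LIMSEQ_unique by blast
  show "integrable (lebesgue_on S) dv"
  proof (rule integrable_const_bound[OF _ dv_measurable])
    show "AE x in lebesgue_on S. norm (dv x) \<le> real CARD('d) * B"
      using AE_notin_N by eventually_elim (unfold real_norm_def, rule dv_bound)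
  qed
qed

end

section \<open>Piecewise smooth functions on polyhedral domains\<close>

text \<open>The regularity of finite element functions: continuous across the set \<open>N\<close>
  that carries the element boundaries, differentiable with bounded gradient only off it.\<close>

definition piecewise_C1 :: "(real^'d) set \<Rightarrow> (real^'d) set \<Rightarrow> (real^'d \<Rightarrow> real) \<Rightarrow> bool" where
  "piecewise_C1 U N f \<longleftrightarrow> continuous_on U f \<and>
     (\<exists>B. (\<forall>x\<in>U. \<bar>f x\<bar> \<le> B) \<and> (\<forall>x\<in>U - N. f differentiable (at x) \<and> norm (gradient f x) \<le> B))"

lemma piecewise_C1I:
  assumes "continuous_on U f" "\<And>x. x \<in> U \<Longrightarrow> \<bar>f x\<bar> \<le> A"
    and "\<And>x. x \<in> U - N \<Longrightarrow> has_gradient f (G x) x" "\<And>x. x \<in> U - N \<Longrightarrow> norm (G x) \<le> B"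
  shows "piecewise_C1 U N f"
  unfolding piecewise_C1_def
proof (intro conjI exI[of _ "max A B"] ballI)
  fix x assume x: "x \<in> U - N"
  show "f differentiable (at x)" by (rule has_gradient_imp_differentiable[OF assms(3)[OF x]])
  show "norm (gradient f x) \<le> max A B"
    unfolding gradient_eqI[OF assms(3)[OF x]] using assms(4)[OF x] by simp
qed (use assms(1,2) in \<open>auto intro: max.coboundedI1\<close>)

lemma piecewise_C1E:
  assumes "piecewise_C1 U N f"
  obtains B where "0 \<le> B" "\<And>x. x \<in> U \<Longrightarrow> \<bar>f x\<bar> \<le> B"
    "\<And>x. x \<in> U - N \<Longrightarrow> has_gradient f (gradient f x) x" "\<And>x. x \<in> U - N \<Longrightarrow> norm (gradient f x) \<le> B"
proof -
  obtain B where B: "\<forall>x\<in>U. \<bar>f x\<bar> \<le> B" "\<forall>x\<in>U - N. f differentiable (at x) \<and> norm (gradient f x) \<le> B"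
    using assms unfolding piecewise_C1_def by blast
  show ?thesis
  proof (rule that[of "max B 0"])
    show "has_gradient f (gradient f x) x" if "x \<in> U - N" for x
      by (rule has_gradient_gradient) (use B that in blast)
    show "\<bar>f x\<bar> \<le> max B 0" if "x \<in> U" for x using B(1) that by (simp add: max.coboundedI1)
    show "norm (gradient f x) \<le> max B 0" if "x \<in> U - N" for x using B(2) that by (simp add: max.coboundedI1)
  qed simp
qed

lemma piecewise_C1_continuous: "piecewise_C1 U N f \<Longrightarrow> continuous_on U f"
  by (simp add: piecewise_C1_def)

lemma piecewise_C1_has_gradient:
  assumes "piecewise_C1 U N f" "x \<in> U" "x \<notin> N" shows "has_gradient f (gradient f x) x"
  by (rule piecewise_C1E[OF assms(1)]) (use assms in blast)

lemma piecewise_C1_mono: "piecewise_C1 U N f \<Longrightarrow> V \<subseteq> U \<Longrightarrow> piecewise_C1 V N f"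
  unfolding piecewise_C1_def by (meson Diff_mono continuous_on_subset order_refl subsetD)

lemma piecewise_C1_mult:
  assumes f: "piecewise_C1 U N f" and g: "piecewise_C1 U N g" shows "piecewise_C1 U N (\<lambda>x. f x * g x)"
proof -
  obtain F where F: "0 \<le> F" "\<And>x. x \<in> U \<Longrightarrow> \<bar>f x\<bar> \<le> F" "\<And>x. x \<in> U - N \<Longrightarrow> has_gradient f (gradient f x) x"
    "\<And>x. x \<in> U - N \<Longrightarrow> norm (gradient f x) \<le> F" using piecewise_C1E[OF f] by blast
  obtain G where G: "0 \<le> G" "\<And>x. x \<in> U \<Longrightarrow> \<bar>g x\<bar> \<le> G" "\<And>x. x \<in> U - N \<Longrightarrow> has_gradient g (gradient g x) x"
    "\<And>x. x \<in> U - N \<Longrightarrow> norm (gradient g x) \<le> G" using piecewise_C1E[OF g] by blast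
  show ?thesis
  proof (rule piecewise_C1I[OF _ _ has_gradient_mult[OF F(3) G(3)]])
    show "continuous_on U (\<lambda>x. f x * g x)"
      by (intro continuous_intros piecewise_C1_continuous[OF f] piecewise_C1_continuous[OF g])
    show "\<bar>f x * g x\<bar> \<le> F * G" if "x \<in> U" for x
      unfolding abs_mult by (intro mult_mono F G that) auto
    show "norm (f x *\<^sub>R gradient g x + g x *\<^sub>R gradient f x) \<le> F * G + G * F" if x: "x \<in> U - N" for x
    proof (rule norm_triangle_mono)
      have "x \<in> U" using x by simp
      then show "norm (f x *\<^sub>R gradient g x) \<le> F * G" "norm (g x *\<^sub>R gradient f x) \<le> G * F"
        unfolding norm_scaleR real_norm_def by (intro mult_mono F G x; simp)+
    qed
  qed
qed

lemma C1_imp_piecewise_C1: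
  assumes "C1 f" "bounded U" shows "piecewise_C1 U N f"
proof -
  have "compact (closure U)" using assms(2) by (simp add: compact_closure)
  from C1_bounded_on_compact[OF assms(1) this] obtain B
    where B: "\<And>x. x \<in> closure U \<Longrightarrow> \<bar>f x\<bar> \<le> B" "\<And>x. x \<in> closure U \<Longrightarrow> norm (gradient f x) \<le> B" by blast
  show ?thesis
    by (rule piecewise_C1I[OF C1_continuous[OF assms(1)] _ C1_has_gradient[OF assms(1)]])
      (use B closure_subset in blast)+
qed

text \<open>A point of \<open>K\<close> off \<open>N\<close> is interior to \<open>K\<close>, since
  \<open>N\<close> contains the frontier; near it \<open>f\<close> is the smooth function belonging
  to \<open>K\<close>. Finitely many compact pieces allow a common bound.\<close>

lemma piecewise_C1_of_pieces:
  assumes fin: "finite KK" and comp: "\<And>K. K \<in> KK \<Longrightarrow> compact K" and cover: "U \<subseteq> \<Union>KK"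
    and fr: "\<And>K. K \<in> KK \<Longrightarrow> frontier K \<subseteq> N" and cont: "continuous_on U f"
    and pieces: "\<And>K. K \<in> KK \<Longrightarrow> \<exists>F. C1 F \<and> (\<forall>x\<in>K. f x = F x)"
  shows "piecewise_C1 U N f"
proof -
  have "\<forall>K\<in>KK. \<exists>F B. C1 F \<and> (\<forall>x\<in>K. f x = F x) \<and> (\<forall>x\<in>K. \<bar>F x\<bar> \<le> B \<and> norm (gradient F x) \<le> B)"
  proof
    fix K assume K: "K \<in> KK"
    obtain F where F: "C1 F" "\<forall>x\<in>K. f x = F x" using pieces[OF K] by blast
    obtain B where "\<And>x. x \<in> K \<Longrightarrow> \<bar>F x\<bar> \<le> B" "\<And>x. x \<in> K \<Longrightarrow> norm (gradient F x) \<le> B"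
      using C1_bounded_on_compact[OF F(1) comp[OF K]] by blast
    then show "\<exists>F B. C1 F \<and> (\<forall>x\<in>K. f x = F x) \<and> (\<forall>x\<in>K. \<bar>F x\<bar> \<le> B \<and> norm (gradient F x) \<le> B)"
      using F by blast
  qed
  then obtain F b where F: "\<And>K. K \<in> KK \<Longrightarrow> C1 (F K)" "\<And>K x. K \<in> KK \<Longrightarrow> x \<in> K \<Longrightarrow> f x = F K x"
    "\<And>K x. K \<in> KK \<Longrightarrow> x \<in> K \<Longrightarrow> \<bar>F K x\<bar> \<le> b K" "\<And>K x. K \<in> KK \<Longrightarrow> x \<in> K \<Longrightarrow> norm (gradient (F K) x) \<le> b K"
    unfolding bchoice_iff by blast
  define B where "B = Max (insert 0 (b ` KK))"
  have B: "b K \<le> B" if "K \<in> KK" for K unfolding B_def using fin that by (intro Max_ge) auto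
  have grad: "has_gradient f (gradient f x) x \<and> norm (gradient f x) \<le> B" if x: "x \<in> U - N" for x
  proof -
    obtain K where K: "K \<in> KK" "x \<in> K" using x cover by blast
    have "x \<in> interior K"
      using K x fr[OF K(1)] closure_subset by (auto simp: frontier_def)
    then have g: "has_gradient f (gradient (F K) x) x"
      by (intro has_gradient_transform[OF C1_has_gradient[OF F(1)[OF K(1)]] open_interior])
        (use F(2)[OF K(1) subsetD[OF interior_subset]] in auto)
    then show ?thesis unfolding gradient_eqI[OF g] using order_trans[OF F(4)[OF K] B[OF K(1)]] by simp
  qed
  show ?thesis
  proof (rule piecewise_C1I[OF cont])
    fix x assume "x \<in> U"
    then obtain K where K: "K \<in> KK" "x \<in> K" using cover by blast
    show "\<bar>f x\<bar> \<le> B" using F(2)[OF K] F(3)[OF K] B[OF K(1)] by simp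
  qed (use grad in auto)
qed

lemma piecewise_C1_measurable:
  assumes "piecewise_C1 U N f" "open U"
  shows "f \<in> borel_measurable (lebesgue_on U)"
  using assms piecewise_C1_continuous by (intro continuous_imp_measurable_on_sets_lebesgue) auto

lemma zero_extension_borel:
  fixes f :: "real^'d \<Rightarrow> real"
  assumes "continuous_on U f" "open U"
  shows "(\<lambda>x. indicator U x * f x) \<in> borel_measurable borel"
  using borel_measurable_continuous_on_indicator[of U f] assms by simp

lemma zero_extension_has_gradient:
  assumes "has_gradient f G x" "open U" "x \<in> U"
  shows "has_gradient (\<lambda>x. indicator U x * f x) G x"
  by (rule has_gradient_transform[OF assms]) simp

text \<open>\<open>gradient_inner_measurable\<close> requires a Borel function on the whole space;
  extension by zero is one and does not change gradients inside the open set.\<close>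

lemma piecewise_C1_gradient_measurable:
  assumes f: "piecewise_C1 U N f" and U: "open U" and N: "negligible N"
  shows "gradient f \<in> borel_measurable (lebesgue_on U)"
proof -
  let ?f = "\<lambda>x. indicator U x * f x"
  have g: "has_gradient ?f (gradient f x) x" if "x \<in> U - N" for x
    by (rule zero_extension_has_gradient[OF piecewise_C1_has_gradient[OF f] U]) (use that in auto)
  have "(\<lambda>x. gradient f x \<bullet> e) \<in> borel_measurable (lebesgue_on U)" for e
  proof (rule measurable_lebesgue_on_diff_negligible[OF _ N])
    have m: "(\<lambda>x. gradient ?f x \<bullet> e) \<in> borel_measurable (lebesgue_on U)"
      by (rule gradient_inner_measurable[OF zero_extension_borel[OF piecewise_C1_continuous[OF f] U] _ N])
        (use U g has_gradient_imp_differentiable in auto)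
    have "(\<lambda>x. gradient ?f x \<bullet> e) \<in> borel_measurable (lebesgue_on (U - N))"
      by (rule measurable_restrict_mono[OF m]) auto
    then show "(\<lambda>x. gradient f x \<bullet> e) \<in> borel_measurable (lebesgue_on (U - N))"
      by (subst measurable_cong[where g = "\<lambda>x. gradient ?f x \<bullet> e"]) (use gradient_eqI[OF g] in auto)
  qed (use U in simp)
  then show ?thesis by (subst borel_measurable_euclidean_space) blast
qed

lemma polynomial_on_C1:
  fixes f :: "real^'d \<Rightarrow> real"
  assumes "polynomial_on k K f" shows "\<exists>F. C1 F \<and> (\<forall>x\<in>K. f x = F x)"
proof -
  obtain c :: "('d \<Rightarrow> nat) \<Rightarrow> real" where c: "\<forall>x\<in>K.
        f x = (\<Sum>m | (\<Sum>i\<in>UNIV. m i) \<le> k. c m * (\<Prod>i\<in>UNIV. (x $ i) ^ m i))"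
    using assms unfolding polynomial_on_def by blast
  have "C1 (\<lambda>x. \<Sum>m | (\<Sum>i\<in>UNIV. m i) \<le> k. c m * (\<Prod>i\<in>(UNIV::'d set). (x $ i) ^ m i))"
    by (intro C1_sum C1_mult C1_const C1_prod C1_power C1_nth)
  then show ?thesis using c by blast
qed

text \<open>A polytope is a finite intersection of half-spaces, and a point at which all the
  inequalities are strict is interior. Hence a frontier point lies on one of the bounding
  hyperplanes.\<close>

lemma polytope_frontier_hyperplanes:
  fixes K :: "(real^'d) set"
  assumes "polytope K"
  shows "\<exists>P. finite P \<and> (\<forall>p\<in>P. norm (fst p) = 1) \<and> frontier K \<subseteq> \<Union>(hyp ` P)"
proof -
  have "polyhedron K" using assms by (rule polytope_imp_polyhedron)
  then obtain F where F: "finite F" "K = \<Inter>F" "\<forall>h\<in>F. \<exists>a b. a \<noteq> 0 \<and> h = {x. a \<bullet> x \<le> b}"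
    unfolding polyhedron_def by blast
  then obtain a b where ab: "\<And>h. h \<in> F \<Longrightarrow> a h \<noteq> 0" "\<And>h. h \<in> F \<Longrightarrow> h = {x. a h \<bullet> x \<le> b h}"
    by metis
  define P where "P = (\<lambda>h. ((1 / norm (a h)) *\<^sub>R a h, b h / norm (a h))) ` F"
  have "frontier K \<subseteq> \<Union>(hyp ` P)"
  proof
    fix x assume x: "x \<in> frontier K"
    have "closed K" using assms polytope_imp_closed by blast
    then have xK: "x \<in> K" "x \<notin> interior K" using x by (auto simp: frontier_def)
    have "\<exists>h\<in>F. a h \<bullet> x = b h"
    proof (rule ccontr)
      assume ne: "\<not> ?thesis"
      define T where "T = (\<Inter>h\<in>F. {x. a h \<bullet> x < b h})"
      have "open T" unfolding T_def using F(1) by (intro open_INT ballI open_halfspace_lt)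
      moreover have "T \<subseteq> K" unfolding T_def F(2) using ab(2) by (force intro: less_imp_le)
      moreover have "x \<in> T" unfolding T_def
      proof
        fix h assume h: "h \<in> F"
        then have "a h \<bullet> x \<le> b h" using xK(1) F(2) ab(2)[OF h] by blast
        then show "x \<in> {x. a h \<bullet> x < b h}" using ne h by force
      qed
      ultimately show False using xK(2) by (meson interior_maximal subsetD)
    qed
    then obtain h where h: "h \<in> F" "a h \<bullet> x = b h" by blast
    then have "x \<in> hyp ((1 / norm (a h)) *\<^sub>R a h, b h / norm (a h))" by (simp add: hyp_def)
    then show "x \<in> \<Union>(hyp ` P)" unfolding P_def using h by blast
  qed
  moreover have "finite P" unfolding P_def using F(1) by simp
  moreover have "\<forall>p\<in>P. norm (fst p) = 1" unfolding P_def using ab(1) by auto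
  ultimately show ?thesis by blast
qed

text \<open>Every hyperplane has a single representative, as \<open>broken_field\<close>
  requires.\<close>

definition arrangement :: "((real^'d) \<times> real) set \<Rightarrow> bool" where
  "arrangement P \<longleftrightarrow> finite P \<and> (\<forall>p\<in>P. norm (fst p) = 1) \<and> inj_on hyp P"

lemma polytopes_frontier_arrangement:
  fixes KK :: "(real^'d) set set"
  assumes "finite KK" "\<And>K. K \<in> KK \<Longrightarrow> polytope K"
  obtains P where "arrangement P" "\<And>K. K \<in> KK \<Longrightarrow> frontier K \<subseteq> \<Union>(hyp ` P)"
proof -
  obtain Q where Q: "\<And>K. K \<in> KK \<Longrightarrow> finite (Q K) \<and> (\<forall>p\<in>Q K. norm (fst p) = 1) \<and> frontier K \<subseteq> \<Union>(hyp ` Q K)"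
    using polytope_frontier_hyperplanes[OF assms(2)] by metis
  define R where "R = \<Union>(Q ` KK)"
  \<comment> \<open>Neighbouring elements share faces and so contribute the same hyperplane,
    possibly with opposite normals; one representative of each is kept.\<close>
  obtain P where P: "P \<subseteq> R" "inj_on hyp P" "hyp ` R = hyp ` P"
    using subset_image_inj[of "hyp ` R" hyp R] by auto
  show ?thesis
  proof (rule that)
    have "finite R" unfolding R_def using assms(1) Q by blast
    moreover have "\<forall>p\<in>R. norm (fst p) = 1" unfolding R_def using Q by blast
    ultimately show "arrangement P"
      unfolding arrangement_def using P(1,2) finite_subset by blast
    show "frontier K \<subseteq> \<Union>(hyp ` P)" if "K \<in> KK" for K
      using Q[OF that] that unfolding P(3)[symmetric] R_def by blast
  qed
qed

lemma arrangement_negligible: "arrangement P \<Longrightarrow> negligible (\<Union>(hyp ` P))"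
  unfolding arrangement_def using negligible_hyp by (intro negligible_Union) auto

text \<open>In a ball around \<open>x\<close> that misses all other hyperplanes, no frontier of an
  element enters the two open half balls cut out by \<open>p\<close>. These are connected, so each
  lies inside the union of the elements or is disjoint from it. The four combinations yield an
  interior point, an exterior point, or a half-space on the side told by \<sigma>.\<close>

lemma half_space_local:
  fixes p :: "(real^'d) \<times> real"
  assumes fin: "finite Th" and poly: "\<And>K. K \<in> Th \<Longrightarrow> polytope K" and P: "arrangement P"
    and fr: "\<And>K. K \<in> Th \<Longrightarrow> frontier K \<subseteq> \<Union>(hyp ` P)"
    and \<Omega>: "\<Omega> = interior (\<Union>Th)"
    and p: "p \<in> P" "x \<in> hyp p" "\<And>q. q \<in> P \<Longrightarrow> q \<noteq> p \<Longrightarrow> x \<notin> hyp q"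
  obtains r where "0 < r"
    "ball x r \<subseteq> \<Omega> \<or> ball x r \<inter> \<Omega> = {} \<or>
     (\<exists>\<sigma>. \<bar>\<sigma>\<bar> = 1 \<and> \<Omega> \<inter> ball x r = {y \<in> ball x r. \<sigma> * level p y < 0} \<and> x \<in> closure \<Omega>)"
proof -
  define W where "W = \<Union>Th"
  have W: "closed W" unfolding W_def using fin poly polytope_imp_closed by (intro closed_Union) auto
  have unit: "norm (fst p) = 1" using P p(1) by (simp add: arrangement_def)
  have Pf: "finite P" using P by (simp add: arrangement_def)
  have "closed (\<Union>(hyp ` (P - {p})))" using Pf closed_hyp by (intro closed_Union) auto
  moreover have "x \<notin> \<Union>(hyp ` (P - {p}))" using p(3) by blast
  ultimately obtain r where r: "0 < r" "ball x r \<subseteq> - \<Union>(hyp ` (P - {p}))"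
    by (meson ComplI open_Compl open_contains_ball)
  define H where "H \<sigma> = {y \<in> ball x r. \<sigma> * level p y < 0}" for \<sigma> :: real
  have Hopen: "open (H \<sigma>)" for \<sigma>
  proof -
    have "open {y. \<sigma> * level p y < 0}" unfolding level_def by (intro open_Collect_less continuous_intros)
    then show ?thesis unfolding H_def Collect_conj_eq Collect_mem_eq by (intro open_Int open_ball)
  qed
  have Hconn: "connected (H \<sigma>)" for \<sigma>
  proof -
    have "H \<sigma> = ball x r \<inter> {y. (\<sigma> *\<^sub>R fst p) \<bullet> y < \<sigma> * snd p}"
      by (auto simp: H_def level_def right_diff_distrib)
    then have "convex (H \<sigma>)" by (metis convex_Int convex_ball convex_halfspace_lt)
    then show ?thesis by (rule convex_connected)
  qed
  have Hfr: "H \<sigma> \<inter> frontier K = {}" if K: "K \<in> Th" for \<sigma> K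
  proof (rule ccontr)
    assume "H \<sigma> \<inter> frontier K \<noteq> {}"
    then obtain y where y: "y \<in> H \<sigma>" "y \<in> frontier K" by blast
    then obtain q where q: "q \<in> P" "y \<in> hyp q" using fr[OF K] by blast
    moreover have "y \<in> ball x r" using y(1) by (simp add: H_def)
    ultimately have "q = p" using r(2) by blast
    then show False using q y(1) by (simp add: H_def mem_hyp)
  qed
  have Hdich: "H \<sigma> \<subseteq> W \<or> H \<sigma> \<inter> W = {}" for \<sigma>
  proof (rule disjCI)
    assume "H \<sigma> \<inter> W \<noteq> {}"
    then obtain K where K: "K \<in> Th" "H \<sigma> \<inter> K \<noteq> {}" unfolding W_def by blast
    then have "H \<sigma> - K = {}" using connected_Int_frontier[OF Hconn K(2)] Hfr[OF K(1)] by blast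
    then show "H \<sigma> \<subseteq> W" unfolding W_def using K(1) by blast
  qed
  \<comment> \<open>Points of the hyperplane inside the ball are limits of both half balls. This
    transfers what is known off the hyperplane to the hyperplane itself.\<close>
  have meet: "\<exists>z. z \<in> T \<inter> H \<sigma>" if "y \<in> ball x r" "level p y = 0" "open T" "y \<in> T" "\<bar>\<sigma>\<bar> = 1" for y T \<sigma>
  proof -
    have "open (T \<inter> ball x r)" using that(3) by (intro open_Int) auto
    moreover have "y \<in> T \<inter> ball x r" using that(1,4) by blast
    ultimately obtain d where d: "0 < d" "ball y d \<subseteq> T \<inter> ball x r" by (rule openE)
    define z where "z = y - (\<sigma> * d / 2) *\<^sub>R fst p"
    have "dist y z = \<bar>\<sigma>\<bar> * d / 2" using unit d(1) by (simp add: z_def dist_norm abs_mult)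
    then have "z \<in> ball y d" using d(1) that(5) by simp
    then have "z \<in> T" "z \<in> ball x r" using d(2) by auto
    moreover have "fst p \<bullet> fst p = 1" using unit by (simp add: norm_eq_1)
    then have "level p z = - (\<sigma> * d / 2)" using that(2) by (simp add: level_def z_def inner_diff_right)
    then have "\<sigma> * level p z = - (\<bar>\<sigma>\<bar>\<^sup>2 * d / 2)" by (simp add: power2_eq_square)
    then have "\<sigma> * level p z < 0" using d(1) that(5) by simp
    ultimately show ?thesis by (auto simp: H_def)
  qed
  have sides: "y \<in> H 1 \<or> y \<in> H (- 1) \<or> level p y = 0" if "y \<in> ball x r" for y
    using that by (auto simp: H_def)
  have xx: "x \<in> ball x r" "level p x = 0" using r(1) p(2) by (auto simp: mem_hyp)
  have \<Omega>W: "\<Omega> \<subseteq> W" "open \<Omega>" unfolding \<Omega> W_def by (auto intro: subsetD[OF interior_subset])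
  \<comment> \<open>Since \<Omega> is open, a point of it on the hyperplane would have neighbours in
    the half ball that contains no element.\<close>
  have one: "\<exists>\<sigma>. \<bar>\<sigma>\<bar> = 1 \<and> \<Omega> \<inter> ball x r = {y \<in> ball x r. \<sigma> * level p y < 0} \<and> x \<in> closure \<Omega>"
    if \<sigma>: "\<bar>\<sigma>\<bar> = 1" and in': "H \<sigma> \<subseteq> W" and out: "H (- \<sigma>) \<inter> W = {}" for \<sigma> :: real
  proof (intro exI[of _ \<sigma>] conjI)
    have sub: "H \<sigma> \<subseteq> \<Omega>" unfolding \<Omega> W_def[symmetric] using in' Hopen by (rule interior_maximal)
    show "\<Omega> \<inter> ball x r = {y \<in> ball x r. \<sigma> * level p y < 0}"
    proof
      show "{y \<in> ball x r. \<sigma> * level p y < 0} \<subseteq> \<Omega> \<inter> ball x r" using sub by (auto simp: H_def)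
      show "\<Omega> \<inter> ball x r \<subseteq> {y \<in> ball x r. \<sigma> * level p y < 0}"
      proof
        fix y assume y: "y \<in> \<Omega> \<inter> ball x r"
        have "level p y \<noteq> 0"
        proof
          assume "level p y = 0"
          then obtain z where "z \<in> \<Omega> \<inter> H (- \<sigma>)" using meet[of y \<Omega> "- \<sigma>"] y \<Omega>W(2) \<sigma> by auto
          then show False using out \<Omega>W by blast
        qed
        moreover have "y \<notin> H (- \<sigma>)" using out y \<Omega>W by blast
        then have "\<not> 0 < \<sigma> * level p y" using y by (auto simp: H_def)
        moreover have "\<sigma> \<noteq> 0" using \<sigma> by auto
        ultimately have "\<sigma> * level p y < 0" by (simp add: not_less le_less)
        then show "y \<in> {y \<in> ball x r. \<sigma> * level p y < 0}" using y by blast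
      qed
    qed
    show "x \<in> closure \<Omega>"
      unfolding closure_iff_nhds_not_empty
    proof (intro allI impI)
      fix A V assume A: "V \<subseteq> A" "open V" "x \<in> V"
      then obtain z where "z \<in> V \<inter> H \<sigma>" using meet[OF xx _ _ \<sigma>] by blast
      then show "\<Omega> \<inter> A \<noteq> {}" using A sub by blast
    qed
  qed (rule \<sigma>)
  show ?thesis
  proof (rule that[OF r(1)])
    consider "H 1 \<subseteq> W" "H (- 1) \<subseteq> W" | "H 1 \<inter> W = {}" "H (- 1) \<inter> W = {}"
      | "H 1 \<subseteq> W" "H (- 1) \<inter> W = {}" | "H (- 1) \<subseteq> W" "H 1 \<inter> W = {}" using Hdich by blast
    then show "ball x r \<subseteq> \<Omega> \<or> ball x r \<inter> \<Omega> = {} \<or>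
     (\<exists>\<sigma>. \<bar>\<sigma>\<bar> = 1 \<and> \<Omega> \<inter> ball x r = {y \<in> ball x r. \<sigma> * level p y < 0} \<and> x \<in> closure \<Omega>)"
    proof cases
      case 1
      \<comment> \<open>The union of the elements is closed and so contains the hyperplane points as
        well; taking its interior leaves no slit between two filled sides.\<close>
      have "ball x r \<subseteq> W"
      proof
        fix y assume y: "y \<in> ball x r"
        show "y \<in> W"
        proof (rule ccontr)
          assume yW: "y \<notin> W"
          then have "level p y = 0" using sides[OF y] 1 by blast
          then obtain z where "z \<in> (- W) \<inter> H 1" using meet[of y "- W" 1] y yW W by (auto simp: open_Compl)
          then show False using 1 by blast
        qed
      qed
      then have "ball x r \<subseteq> \<Omega>" unfolding \<Omega> W_def[symmetric] by (intro interior_maximal) auto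
      then show ?thesis ..
    next
      case 2
      have "ball x r \<inter> \<Omega> = {}"
      proof (rule ccontr)
        assume "\<not> ?thesis"
        then obtain y where y: "y \<in> ball x r" "y \<in> \<Omega>" by blast
        then have "level p y = 0" using sides[OF y(1)] 2 \<Omega>W by blast
        then obtain z where "z \<in> \<Omega> \<inter> H 1" using meet[of y \<Omega> 1] y \<Omega>W(2) by auto
        then show False using 2 \<Omega>W by blast
      qed
      then show ?thesis by blast
    next
      case 3
      then show ?thesis using one[of 1] by simp
    next
      case 4
      then show ?thesis using one[of "- 1"] by simp
    qed
  qed
qed

text \<open>By \<open>half_space_local\<close> only a point with a half-space as neighbourhood needs
  an argument. If it lies in \<Gamma>1, then \<open>w\<close> vanishes there; if in \<Gamma>2, the
  outward normal is plus or minus \<open>fst p\<close> and the normal component vanishes. So it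
  tends to 0, the value of the extension outside.\<close>

lemma wall_normal_component_continuous:
  fixes p :: "(real^'d) \<times> real" and w :: "real^'d \<Rightarrow> real^'d"
  assumes Th: "finite Th" "\<And>K. K \<in> Th \<Longrightarrow> polytope K" and P: "arrangement P"
    and fr: "\<And>K. K \<in> Th \<Longrightarrow> frontier K \<subseteq> \<Union>(hyp ` P)"
    and \<Omega>: "\<Omega> = interior (\<Union>Th)"
    and p: "p \<in> P" "x \<in> hyp p" "\<And>q. q \<in> P \<Longrightarrow> q \<noteq> p \<Longrightarrow> x \<notin> hyp q"
    and w: "continuous_on (closure \<Omega>) w" "frontier \<Omega> = \<Gamma>1 \<union> \<Gamma>2" "\<And>x. x \<in> \<Gamma>1 \<Longrightarrow> w x = 0"
      "\<And>x n. x \<in> \<Gamma>2 \<Longrightarrow> outward_normal \<Omega> x n \<Longrightarrow> w x \<bullet> n = 0"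
  shows "isCont (\<lambda>x. indicator \<Omega> x * (fst p \<bullet> w x)) x"
proof -
  define G where "G y = fst p \<bullet> w y" for y
  have G: "continuous_on (closure \<Omega>) G" unfolding G_def by (intro continuous_intros w)
  obtain r where r: "0 < r" "ball x r \<subseteq> \<Omega> \<or> ball x r \<inter> \<Omega> = {} \<or>
     (\<exists>\<sigma>. \<bar>\<sigma>\<bar> = 1 \<and> \<Omega> \<inter> ball x r = {y \<in> ball x r. \<sigma> * level p y < 0} \<and> x \<in> closure \<Omega>)"
    using half_space_local[OF Th P fr \<Omega> p] by blast
  have op: "open \<Omega>" unfolding \<Omega> by simp
  have xr: "x \<in> ball x r" using r(1) by simp
  from r(2) have "isCont (\<lambda>x. indicator \<Omega> x * G x) x"
  proof (elim disjE exE conjE)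
    assume "ball x r \<subseteq> \<Omega>"
    then have "x \<in> \<Omega>" using xr by blast
    have "continuous_on \<Omega> G" using G closure_subset by (rule continuous_on_subset)
    then have "continuous_on \<Omega> (\<lambda>x. indicator \<Omega> x * G x)"
      by (rule continuous_on_eq) simp
    then show ?thesis using op \<open>x \<in> \<Omega>\<close> continuous_on_eq_continuous_at by blast
  next
    assume "ball x r \<inter> \<Omega> = {}"
    then have 0: "0 = indicator \<Omega> y * G y" if "y \<in> ball x r" for y
      using that by (cases "y \<in> \<Omega>") (auto simp del: mem_ball)
    have "continuous_on (ball x r) (\<lambda>x. indicator \<Omega> x * G x)"
      by (rule continuous_on_eq[OF continuous_on_const 0])
    then show ?thesis using xr open_ball continuous_on_eq_continuous_at by blast
  next
    fix \<sigma> :: real assume \<sigma>: "\<bar>\<sigma>\<bar> = 1" and eq: "\<Omega> \<inter> ball x r = {y \<in> ball x r. \<sigma> * level p y < 0}"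
      and cl: "x \<in> closure \<Omega>"
    have lx: "level p x = 0" using p(2) by (simp add: mem_hyp)
    then have "x \<notin> {y \<in> ball x r. \<sigma> * level p y < 0}" by simp
    then have xn: "x \<notin> \<Omega>" using eq xr by blast
    then have "x \<in> frontier \<Omega>" using cl op by (simp add: frontier_def interior_open)
    then consider "x \<in> \<Gamma>1" | "x \<in> \<Gamma>2" using w(2) by blast
    then have Gx: "G x = 0"
    proof cases
      case 1
      then show ?thesis by (simp add: G_def w(3))
    next
      case 2
      have "norm (fst p) = 1" using P p(1) by (simp add: arrangement_def)
      then have "norm (\<sigma> *\<^sub>R fst p) = 1" using \<sigma> by simp
      moreover have "(y - x) \<bullet> (\<sigma> *\<^sub>R fst p) = \<sigma> * level p y" for y
        using lx by (simp add: level_def inner_diff_left inner_diff_right inner_commute[of _ "fst p"])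
      then have "\<Omega> \<inter> ball x r = {y \<in> ball x r. (y - x) \<bullet> (\<sigma> *\<^sub>R fst p) < 0}"
        using eq by (simp only:)
      ultimately have "outward_normal \<Omega> x (\<sigma> *\<^sub>R fst p)"
        unfolding outward_normal_def using r(1) by blast
      from w(4)[OF 2 this] have "\<sigma> * G x = 0" by (simp add: G_def inner_commute)
      then show ?thesis using \<sigma> by auto
    qed
    show ?thesis
      unfolding continuous_at_eps_delta
    proof (intro allI impI)
      fix e :: real assume e: "0 < e"
      then obtain d where d: "0 < d" "\<forall>y\<in>closure \<Omega>. dist y x < d \<longrightarrow> dist (G y) (G x) < e"
        using G cl unfolding continuous_on_iff by blast
      show "\<exists>d>0. \<forall>y. dist y x < d \<longrightarrow> dist (indicator \<Omega> y * G y) (indicator \<Omega> x * G x) < e"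
      proof (intro exI[of _ d] conjI allI impI d(1))
        fix y assume y: "dist y x < d"
        show "dist (indicator \<Omega> y * G y) (indicator \<Omega> x * G x) < e"
        proof (cases "y \<in> \<Omega>")
          case True
          then have "dist (G y) (G x) < e" using d(2) y subsetD[OF closure_subset True] by blast
          then show ?thesis using True Gx by (simp add: dist_norm)
        next
          case False
          then show ?thesis using e Gx by simp
        qed
      qed
    qed
  qed
  then show ?thesis by (simp add: G_def)
qed

text \<open>The zero extension of \<open>w\<close> is a \<open>broken_field\<close>, and its
  divergence over a large ball is that of \<open>w\<close> over \<Omega>.\<close>

lemma walls_integral_divergence:
  fixes w :: "real^'d \<Rightarrow> real^'d"
  assumes Th: "finite Th" "\<And>K. K \<in> Th \<Longrightarrow> polytope K" and P: "arrangement P"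
    and fr: "\<And>K. K \<in> Th \<Longrightarrow> frontier K \<subseteq> \<Union>(hyp ` P)"
    and \<Omega>: "\<Omega> = interior (\<Union>Th)"
    and w: "continuous_on (closure \<Omega>) w" "frontier \<Omega> = \<Gamma>1 \<union> \<Gamma>2" "\<And>x. x \<in> \<Gamma>1 \<Longrightarrow> w x = 0"
      "\<And>x n. x \<in> \<Gamma>2 \<Longrightarrow> outward_normal \<Omega> x n \<Longrightarrow> w x \<bullet> n = 0"
    and pw: "\<And>i. piecewise_C1 \<Omega> (\<Union>(hyp ` P)) (\<lambda>x. w x $ i)"
  shows "(LINT x|lebesgue_on \<Omega>. (\<Sum>i\<in>UNIV. gradient (\<lambda>x. w x $ i) x $ i)) = 0"
proof -
  let ?N = "\<Union>(hyp ` P)"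
  have op: "open \<Omega>" unfolding \<Omega> by simp
  have "bounded (\<Union>Th)" using Th polytope_imp_bounded by (intro bounded_Union) auto
  then have "bounded \<Omega>" unfolding \<Omega> using bounded_interior by blast
  then obtain R where R: "\<And>x. x \<in> \<Omega> \<Longrightarrow> norm x < R" unfolding bounded_pos_less by blast
  define u where "u i x = indicator \<Omega> x * w x $ i" for i x
  \<comment> \<open>Off the hyperplanes a point is thus inside the open set \<Omega> or outside its
    closure, so the extension agrees nearby with \<open>w\<close> or with 0.\<close>
  have frN: "frontier \<Omega> \<subseteq> ?N"
  proof -
    have "frontier \<Omega> \<subseteq> frontier (\<Union>Th)" unfolding \<Omega> by (rule frontier_interior_subset)
    also have "\<dots> \<subseteq> (\<Union>K\<in>Th. frontier K)" by (rule frontier_Union_subset[OF Th(1)])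
    finally show ?thesis using fr by blast
  qed
  have "\<exists>B. (\<forall>x\<in>\<Omega>. \<bar>w x $ i\<bar> \<le> B) \<and> (\<forall>x\<in>\<Omega> - ?N. norm (gradient (\<lambda>x. w x $ i) x) \<le> B)" for i
    using piecewise_C1E[OF pw[of i]] by metis
  then obtain b where b: "\<And>i x. x \<in> \<Omega> \<Longrightarrow> \<bar>w x $ i\<bar> \<le> b i"
     "\<And>i x. x \<in> \<Omega> - ?N \<Longrightarrow> norm (gradient (\<lambda>x. w x $ i) x) \<le> b i" by metis
  define B where "B = Max (insert 0 (range b))"
  have B: "b i \<le> B" "0 \<le> B" for i unfolding B_def by (rule Max_ge; simp)+
  have ins: "has_gradient (u i) (gradient (\<lambda>x. w x $ i) x) x" if "x \<in> \<Omega>" "x \<notin> ?N" for i x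
    unfolding u_def[abs_def]
    by (rule zero_extension_has_gradient[OF piecewise_C1_has_gradient[OF pw that] op that(1)])
  have outs: "has_gradient (u i) 0 x" if "x \<notin> closure \<Omega>" for i x
    by (rule has_gradient_transform[OF has_gradient_const[of 0], where S = "- closure \<Omega>"])
      (use that subsetD[OF closure_subset[of \<Omega>]] in \<open>auto simp: u_def indicator_def\<close>)
  have cases: "x \<in> \<Omega> \<or> x \<notin> closure \<Omega>" if "x \<notin> ?N" for x
    using that frN op by (auto simp: frontier_def interior_open)
  interpret broken_field P u R B
  proof
    show "finite P" "inj_on hyp P" "\<And>p. p \<in> P \<Longrightarrow> norm (fst p) = 1" using P by (auto simp: arrangement_def)
    show "u i \<in> borel_measurable borel" for i
      unfolding u_def[abs_def] by (rule zero_extension_borel[OF piecewise_C1_continuous[OF pw] op])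
    show "\<bar>u i x\<bar> \<le> B" for i x
      using order_trans[OF b(1)[of x i] B(1)] B(2) by (cases "x \<in> \<Omega>") (auto simp: u_def)
    show "u i x = 0" if "R \<le> norm x" for i x using R[of x] that by (auto simp: u_def indicator_def)
    show "u i differentiable (at x)" if x: "x \<notin> ?N" for i x
      using cases[OF x] has_gradient_imp_differentiable[OF ins[OF _ x]]
        has_gradient_imp_differentiable[OF outs] by blast
    show "norm (gradient (u i) x) \<le> B" if x: "x \<notin> ?N" for i x
      using cases[OF x]
    proof
      assume "x \<in> \<Omega>"
      then show ?thesis
        using gradient_eqI[OF ins[OF _ x], of i] order_trans[OF b(2)[of x i] B(1)] x by (simp only: Diff_iff) simp
    next
      assume "x \<notin> closure \<Omega>"
      from gradient_eqI[OF outs[OF this], of i] show ?thesis using B(2) by simp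
    qed
    show "isCont (\<lambda>x. \<Sum>i\<in>UNIV. fst p $ i * u i x) x"
      if "p \<in> P" "x \<in> hyp p" "\<And>q. q \<in> P \<Longrightarrow> q \<noteq> p \<Longrightarrow> x \<notin> hyp q" for p x
    proof -
      have "(\<Sum>i\<in>UNIV. fst p $ i * u i y) = indicator \<Omega> y * (fst p \<bullet> w y)" for y
        by (simp add: u_def inner_vec_def sum_distrib_left mult.left_commute)
      then show ?thesis using wall_normal_component_continuous[OF Th P fr \<Omega> that w] by simp
    qed
  qed
  let ?d = "\<lambda>x. \<Sum>i\<in>UNIV. gradient (\<lambda>x. w x $ i) x $ i"
  have \<Omega>S: "\<Omega> \<subseteq> S" using R by force
  have eq: "indicator \<Omega> x *\<^sub>R ?d x = dv x" if "x \<in> S - ?N" for x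
  proof -
    have x: "x \<notin> ?N" using that by simp
    from cases[OF x] show ?thesis
    proof
      assume "x \<in> \<Omega>"
      then show ?thesis using gradient_eqI[OF ins[OF _ x]] by simp
    next
      assume "x \<notin> closure \<Omega>"
      moreover from this have "x \<notin> \<Omega>" using closure_subset by blast
      ultimately show ?thesis using gradient_eqI[OF outs] by simp
    qed
  qed
  have "(LINT x|lebesgue_on \<Omega>. ?d x) = (LINT x|lebesgue. indicator \<Omega> x *\<^sub>R ?d x)"
    by (rule integral_restrict_space) (use op in simp)
  also have "\<dots> = (LINT x|lebesgue. indicator S x *\<^sub>R (indicator \<Omega> x *\<^sub>R ?d x))"
    using \<Omega>S by (intro Bochner_Integration.integral_cong) (auto simp: indicator_def)
  also have "\<dots> = (LINT x|lebesgue_on S. indicator \<Omega> x *\<^sub>R ?d x)"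
    by (rule integral_restrict_space[symmetric]) simp
  also have "\<dots> = (LINT x|lebesgue_on S. dv x)"
    by (rule integrable_cong_negligible(2)[OF integral_divergence_eq_0(1) arrangement_negligible[OF P] _ eq]) simp_all
  also have "\<dots> = 0" by (rule integral_divergence_eq_0(2))
  finally show ?thesis .
qed

section \<open>Periodic and compactly supported functions\<close>

text \<open>Moving the cube along an axis trades a slab of width \<open>h\<close> at one face for a
  slab at the opposite face, and by periodicity the two contribute the same.\<close>

lemma torus_shift:
  fixes f :: "real^'d \<Rightarrow> real"
  assumes cont: "continuous_on UNIV f" and per: "periodic_fun L f" and h: "0 < h" "h < L"
    and \<Omega>: "\<Omega> = box a (a + (\<chi> i. L))"
  shows "(LINT x|lebesgue_on \<Omega>. f (x + h *\<^sub>R axis i 1)) = (LINT x|lebesgue_on \<Omega>. f x)"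
proof -
  have fb: "f \<in> borel_measurable borel" using cont borel_measurable_continuous_onI by blast
  \<comment> \<open>The part of the cylinder over the cube in direction \<open>i\<close> that lies
    between \<open>c\<close> and \<open>d\<close>.\<close>
  define G where "G c d = {y. (\<forall>j. j \<noteq> i \<longrightarrow> a $ j < y $ j \<and> y $ j < a $ j + L) \<and> c < y $ i \<and> y $ i < d}" for c d
  have Gbox: "G c d = box (\<chi> j. if j = i then c else a $ j) (\<chi> j. if j = i then d else a $ j + L)" for c d
  proof (rule set_eqI)
    fix y :: "real^'d"
    have "(\<forall>j. Q j) \<longleftrightarrow> (\<forall>j. j \<noteq> i \<longrightarrow> Q j) \<and> Q i" for Q :: "'d \<Rightarrow> bool" by metis
    from this[of "\<lambda>j. (if j = i then c else a $ j) < y $ j \<and> y $ j < (if j = i then d else a $ j + L)"]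
    show "y \<in> G c d \<longleftrightarrow> y \<in> box (\<chi> j. if j = i then c else a $ j) (\<chi> j. if j = i then d else a $ j + L)"
      by (simp add: G_def mem_box_cart)
  qed
  have Gm: "G c d \<in> sets borel" for c d unfolding Gbox by simp
  have Gf: "emeasure lborel (G c d) < \<infinity>" for c d unfolding Gbox by (rule emeasure_lborel_box_finite)
  have \<Omega>G: "\<Omega> = G (a $ i) (a $ i + L)" unfolding \<Omega> Gbox
    by (rule arg_cong2[where f = box]) (auto simp: vec_eq_iff)
  have int: "integrable lborel (\<lambda>x. indicator (G c d) x * f x)" for c d
  proof -
    have "bounded (G c d)" unfolding Gbox by simp
    then have "compact (closure (G c d))" by (simp add: compact_closure)
    then have "bounded (f ` closure (G c d))"
      using cont by (intro compact_imp_bounded compact_continuous_image) (auto intro: continuous_on_subset)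
    then obtain B where B: "\<And>x. x \<in> closure (G c d) \<Longrightarrow> \<bar>f x\<bar> \<le> B" unfolding bounded_iff by auto
    have "integrable lborel (\<lambda>x. indicator (G c d) x *\<^sub>R f x)"
      by (rule integrableI_bounded_set_indicator[OF _ _ Gf, where B = B])
        (use Gm fb B[OF subsetD[OF closure_subset]] in \<open>auto intro!: AE_I2\<close>)
    then show ?thesis by simp
  qed
  define I where "I c d = (LINT x|lborel. indicator (G c d) x * f x)" for c d
  have split: "I c e = I c d + I d e" if "c < d" "d < e" for c d e
  proof -
    \<comment> \<open>Cutting an open slab in two loses the separating hyperplane, which is a null
      set.\<close>
    have neg: "{x::real^'d. x $ i = d} \<in> null_sets lborel"
    proof -
      have "negligible {x::real^'d. axis i 1 \<bullet> x = d}" by (rule negligible_hyperplane) simp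
      then have "{x::real^'d. x $ i = d} \<in> null_sets lebesgue"
        by (simp add: inner_axis' negligible_iff_null_sets)
      moreover have "closed {x::real^'d. x $ i = d}"
        by (intro closed_Collect_eq continuous_intros)
      ultimately show ?thesis by (simp add: null_sets_completion_iff)
    qed
    have "I c e = (LINT x|lborel. indicator (G c d) x * f x + indicator (G d e) x * f x)"
      unfolding I_def
    proof (rule integral_cong_AE)
      show "AE x in lborel. indicator (G c e) x * f x = indicator (G c d) x * f x + indicator (G d e) x * f x"
        using AE_not_in[OF neg] by eventually_elim (use that in \<open>auto simp: G_def indicator_def\<close>)
    qed (use int[of c e] int[of c d] int[of d e] in auto)
    then show ?thesis unfolding I_def using int[of c d] int[of d e] by simp
  qed
  have shiftI: "(LINT x|lborel. indicator (G c d) x * f (x + s *\<^sub>R axis i 1)) = I (c + s) (d + s)" for c d s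
  proof -
    have eq: "indicator (G c d) x = (indicator (G (c + s) (d + s)) (x + s *\<^sub>R axis i 1) :: real)" for x
      by (auto simp: G_def indicator_def axis_def)
    have m: "(\<lambda>x. indicator (G (c + s) (d + s)) x * f x) \<in> borel_measurable borel"
      using Gm[of "c + s" "d + s"] fb by measurable
    show ?thesis unfolding I_def eq by (rule lborel_integral_translate[OF m])
  qed
  have "f (x + L *\<^sub>R axis i 1) = f x" for x
  proof -
    have "L *\<^sub>R axis i 1 \<in> torus_lattice L"
      unfolding torus_lattice_def
    proof (intro CollectI allI)
      fix j show "\<exists>k::int. (L *\<^sub>R axis i 1) $ j = L * of_int k"
        by (rule exI[of _ "if j = i then 1 else 0"]) (simp add: axis_def)
    qed
    then show ?thesis using per by (simp add: periodic_fun_def)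
  qed
  then have perI: "I (c + L) (d + L) = I c d" for c d
    using shiftI[of c d L] by (simp add: I_def)
  have "I (a $ i + h) (a $ i + L + h) = I (a $ i + h) (a $ i + L) + I (a $ i + L) (a $ i + L + h)"
    using h by (intro split) auto
  also have "I (a $ i + L) (a $ i + L + h) = I (a $ i) (a $ i + h)"
    using perI[of "a $ i" "a $ i + h"] by (simp add: algebra_simps)
  also have "I (a $ i + h) (a $ i + L) + I (a $ i) (a $ i + h) = I (a $ i) (a $ i + L)"
    using split[of "a $ i" "a $ i + h" "a $ i + L"] h by simp
  finally have "I (a $ i + h) (a $ i + L + h) = I (a $ i) (a $ i + L)" .
  moreover have "(LINT x|lebesgue_on \<Omega>. f (x + h *\<^sub>R axis i 1)) = I (a $ i + h) (a $ i + L + h)"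
  proof -
    have "(\<lambda>x. f (x + h *\<^sub>R axis i 1)) \<in> borel_measurable borel" using fb by measurable
    from lebesgue_on_integral_lborel[OF this Gm] show ?thesis unfolding \<Omega>G shiftI .
  qed
  moreover have "(LINT x|lebesgue_on \<Omega>. f x) = I (a $ i) (a $ i + L)"
    unfolding \<Omega>G I_def by (rule lebesgue_on_integral_lborel[OF fb Gm])
  ultimately show ?thesis by simp
qed

text \<open>A periodic finite element function is continuous, so lines may cross element boundaries
  freely, and invariance under shifts comes from \<open>torus_shift\<close>. The set
  \<open>U\<close> extends beyond the cube because the shifted points leave it.\<close>

lemma torus_integral_gradient:
  fixes f :: "real^'d \<Rightarrow> real"
  assumes L: "0 < L" and \<Omega>: "\<Omega> = box a (a + (\<chi> i. L))" and P: "arrangement P"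
    and U: "open U" "\<And>x w. x \<in> \<Omega> \<Longrightarrow> norm w \<le> 1 \<Longrightarrow> x + w \<in> U"
    and f: "piecewise_C1 U (\<Union>(hyp ` P)) f" "continuous_on UNIV f" "periodic_fun L f"
  shows "(LINT x|lebesgue_on \<Omega>. gradient f x $ i) = 0"
proof -
  let ?N = "\<Union>(hyp ` P)" and ?e = "axis i (1::real)"
  obtain B where B: "0 \<le> B" "\<And>x. x \<in> U \<Longrightarrow> \<bar>f x\<bar> \<le> B"
    "\<And>x. x \<in> U - ?N \<Longrightarrow> has_gradient f (gradient f x) x" "\<And>x. x \<in> U - ?N \<Longrightarrow> norm (gradient f x) \<le> B"
    using piecewise_C1E[OF f(1)] by blast
  \<comment> \<open>The bound for \<open>f\<close> is available on \<open>U\<close> only; cutting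
    off outside makes it global and changes nothing at the shifted points of the cube.\<close>
  define f0 where "f0 x = indicator U x * f x" for x
  define \<delta> where "\<delta> = min 1 L"
  have \<delta>: "0 < \<delta>" using L by (simp add: \<delta>_def)
  have near: "x + s *\<^sub>R ?e \<in> U" if "x \<in> \<Omega>" "0 \<le> s" "s \<le> \<delta>" for x s
    using that by (intro U) (auto simp: \<delta>_def)
  have \<Omega>lm: "\<Omega> \<in> lmeasurable" unfolding \<Omega> by simp
  have shift: "(LINT x|lebesgue_on \<Omega>. f0 (x + h *\<^sub>R ?e)) = (LINT x|lebesgue_on \<Omega>. f0 x)"
    if h: "0 < h" "h < \<delta>" for h
  proof -
    have "(LINT x|lebesgue_on \<Omega>. f0 (x + h *\<^sub>R ?e)) = (LINT x|lebesgue_on \<Omega>. f (x + h *\<^sub>R ?e))"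
      using h near by (intro Bochner_Integration.integral_cong) (auto simp: f0_def)
    also have "\<dots> = (LINT x|lebesgue_on \<Omega>. f x)"
      using h by (intro torus_shift[OF f(2,3) _ _ \<Omega>]) (auto simp: \<delta>_def)
    also have "\<dots> = (LINT x|lebesgue_on \<Omega>. f0 x)"
      using near[of _ 0] \<delta> by (intro Bochner_Integration.integral_cong) (auto simp: f0_def)
    finally show ?thesis .
  qed
  have line: "\<exists>A. finite A \<and> 0 \<notin> A \<and> continuous_on {0..\<delta>} (\<lambda>s. f0 (x + s *\<^sub>R ?e)) \<and>
      (\<forall>s\<in>{0..\<delta>} - A. ((\<lambda>s. f0 (x + s *\<^sub>R ?e)) has_real_derivative gradient f (x + s *\<^sub>R ?e) \<bullet> ?e) (at s) \<and>
         \<bar>gradient f (x + s *\<^sub>R ?e) \<bullet> ?e\<bar> \<le> B)" if x: "x \<in> \<Omega> - ?N" for x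
  proof (intro exI[of _ "\<Union>p\<in>P. {s. x + s *\<^sub>R ?e \<in> hyp p}"] conjI ballI)
    have x1: "x \<in> \<Omega>" using x by simp
    \<comment> \<open>A line through a point off a hyperplane meets that hyperplane at most
      once.\<close>
    show "finite (\<Union>p\<in>P. {s. x + s *\<^sub>R ?e \<in> hyp p})"
    proof (rule finite_UN_I)
      show "finite P" using P by (simp add: arrangement_def)
      fix p assume "p \<in> P"
      then have x0: "level p x \<noteq> 0" using x mem_hyp by blast
      have "{s. x + s *\<^sub>R ?e \<in> hyp p} \<subseteq> {- level p x / (fst p \<bullet> ?e)}"
      proof
        fix s assume "s \<in> {s. x + s *\<^sub>R ?e \<in> hyp p}"
        then have 0: "level p x + s * (fst p \<bullet> ?e) = 0" by (simp add: mem_hyp level_def inner_add_right)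
        then have "fst p \<bullet> ?e \<noteq> 0" using x0 by auto
        then have "s = - level p x / (fst p \<bullet> ?e)" using 0 by (subst nonzero_eq_divide_eq) auto
        then show "s \<in> {- level p x / (fst p \<bullet> ?e)}" by simp
      qed
      then show "finite {s. x + s *\<^sub>R ?e \<in> hyp p}" by (rule finite_subset) simp
    qed
    show "0 \<notin> (\<Union>p\<in>P. {s. x + s *\<^sub>R ?e \<in> hyp p})" using x by simp
    show "continuous_on {0..\<delta>} (\<lambda>s. f0 (x + s *\<^sub>R ?e))"
    proof (rule continuous_on_eq)
      show "continuous_on {0..\<delta>} (\<lambda>s. f (x + s *\<^sub>R ?e))"
        by (rule continuous_on_compose2[OF f(2)]) (auto intro!: continuous_intros)
    qed (use near[OF x1] in \<open>auto simp: f0_def\<close>)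
    fix s assume s: "s \<in> {0..\<delta>} - (\<Union>p\<in>P. {s. x + s *\<^sub>R ?e \<in> hyp p})"
    then have y: "x + s *\<^sub>R ?e \<in> U" "x + s *\<^sub>R ?e \<in> U - ?N" using near[OF x1] by auto
    show "((\<lambda>s. f0 (x + s *\<^sub>R ?e)) has_real_derivative gradient f (x + s *\<^sub>R ?e) \<bullet> ?e) (at s)"
      unfolding f0_def[abs_def]
      by (rule has_gradient_line[OF zero_extension_has_gradient[OF B(3)[OF y(2)] U(1) y(1)]])
    have "\<bar>gradient f (x + s *\<^sub>R ?e) \<bullet> ?e\<bar> \<le> norm (gradient f (x + s *\<^sub>R ?e)) * norm ?e"
      by (rule Cauchy_Schwarz_ineq2)
    then show "\<bar>gradient f (x + s *\<^sub>R ?e) \<bullet> ?e\<bar> \<le> B" using B(4)[OF y(2)] by simp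
  qed
  have f0b: "f0 \<in> borel_measurable borel"
    unfolding f0_def[abs_def] by (rule zero_extension_borel[OF piecewise_C1_continuous[OF f(1)] U(1)])
  have f0B: "\<bar>f0 x\<bar> \<le> B" for x using B(1) B(2)[of x] by (cases "x \<in> U") (auto simp: f0_def)
  from integral_directional_derivative(2)[OF \<Omega>lm arrangement_negligible[OF P] f0b f0B \<delta> shift line]
  show ?thesis by (simp add: inner_axis)
qed

lemma compact_support_integral_gradient:
  fixes f :: "real^'d \<Rightarrow> real"
  assumes f: "C1 f" and comp: "compact (closure {x. f x \<noteq> 0})" and sub: "closure {x. f x \<noteq> 0} \<subseteq> \<Omega>"
    and \<Omega>: "open \<Omega>"
  shows "(LINT x|lebesgue_on \<Omega>. gradient f x $ i) = 0"
proof -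
  let ?C = "closure {x. f x \<noteq> 0}"
  obtain R where R: "\<And>x. x \<in> ?C \<Longrightarrow> norm x < R"
    using compact_imp_bounded[OF comp] unfolding bounded_pos_less by blast
  obtain B where B: "\<And>x. x \<in> ?C \<Longrightarrow> \<bar>f x\<bar> \<le> B" "\<And>x. x \<in> ?C \<Longrightarrow> norm (gradient f x) \<le> B"
    using C1_bounded_on_compact[OF f comp] by blast
  have out: "f x = 0" if "x \<notin> ?C" for x using that subsetD[OF closure_subset[of "{x. f x \<noteq> 0}"], of x] by blast
  have outg: "gradient f x = 0" if "x \<notin> ?C" for x
  proof (rule gradient_eqI[OF has_gradient_transform[OF has_gradient_const[of 0]]])
    show "open (- ?C)" "x \<in> - ?C" using that by auto
    show "0 = f y" if "y \<in> - ?C" for y using out[of y] that by simp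
  qed
  \<comment> \<open>A smooth function has no singular hyperplane; an arbitrary one is named in order
    to apply \<open>integral_gradient_off_hyperplane\<close>.\<close>
  define p :: "(real^'d) \<times> real" where "p = (axis i 1, 0)"
  have p: "norm (fst p) = 1" by (simp add: p_def)
  have fb: "f \<in> borel_measurable borel" using C1_continuous[OF f] borel_measurable_continuous_onI by blast
  have bd: "\<bar>f x\<bar> \<le> max B 0" "norm (gradient f x) \<le> max B 0" for x
    using B[of x] out[of x] outg[of x] by (cases "x \<in> ?C"; simp add: max.coboundedI1)+
  have z: "f x = 0" if "R \<le> norm x" for x
  proof (rule out)
    show "x \<notin> ?C" using R[of x] that by linarith
  qed
  have dif: "f differentiable (at x)" for x using f by (simp add: C1_def)
  have e: "norm (axis i (1::real)) \<le> 2" by simp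
  have ct: "\<forall>x. isCont f x" using has_gradient_continuous[OF C1_has_gradient[OF f]] by blast
  have 0: "(LINT x|lebesgue_on (ball 0 (R + 2)). gradient f x \<bullet> axis i 1) = 0"
    by (rule integral_gradient_off_hyperplane(2)[OF p fb bd(1) z dif bd(2) e disjI2[OF ct]])
  let ?S = "ball (0::real^'d) (R + 2)"
  have "(LINT x|lebesgue_on \<Omega>. gradient f x $ i) = (LINT x|lebesgue. indicator \<Omega> x *\<^sub>R gradient f x $ i)"
    by (rule integral_restrict_space) (use \<Omega> in simp)
  also have "\<dots> = (LINT x|lebesgue. indicator ?S x *\<^sub>R gradient f x $ i)"
  proof (rule Bochner_Integration.integral_cong[OF refl])
    fix x
    show "indicator \<Omega> x *\<^sub>R gradient f x $ i = indicator ?S x *\<^sub>R gradient f x $ i"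
    proof (cases "x \<in> ?C")
      case True
      then have "x \<in> \<Omega>" "x \<in> ?S" using sub R[OF True] by auto
      then show ?thesis by simp
    qed (simp add: outg)
  qed
  also have "\<dots> = (LINT x|lebesgue_on ?S. gradient f x $ i)"
    by (rule integral_restrict_space[symmetric]) simp
  also have "\<dots> = 0" using 0 by (simp add: inner_axis)
  finally show ?thesis .
qed

text \<open>Each component of such a lattice point is \<open>L\<close> times an integer of size at
  most \<open>r / L\<close>.\<close>

lemma finite_torus_lattice_bounded:
  assumes L: "0 < L" shows "finite {z :: real^'d. z \<in> torus_lattice L \<and> norm z \<le> r}"
proof -
  define M where "M = \<lceil>r / L\<rceil>"
  let ?F = "\<lambda>g :: 'd \<Rightarrow> int. (\<chi> i. L * of_int (g i)) :: real^'d"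
  have sub: "{z :: real^'d. z \<in> torus_lattice L \<and> norm z \<le> r} \<subseteq> ?F ` (Pi\<^sub>E UNIV (\<lambda>_. {-M..M}))"
  proof
    fix z :: "real^'d" assume "z \<in> {z. z \<in> torus_lattice L \<and> norm z \<le> r}"
    then have z: "\<forall>i. \<exists>k::int. z $ i = L * of_int k" "norm z \<le> r" by (auto simp: torus_lattice_def)
    then obtain g :: "'d \<Rightarrow> int" where g: "\<And>i. z $ i = L * of_int (g i)" by metis
    have "g i \<in> {-M..M}" for i
    proof -
      have "\<bar>z $ i\<bar> \<le> r" using component_le_norm_cart[of z i] z(2) by linarith
      then have "L * \<bar>of_int (g i)\<bar> \<le> r" using L by (simp add: g abs_mult)
      then have "\<bar>real_of_int (g i)\<bar> \<le> r / L" using L by (simp add: field_simps)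
      also have "\<dots> \<le> of_int M" unfolding M_def by (rule le_of_int_ceiling)
      finally show ?thesis by (simp only: atLeastAtMost_iff) linarith
    qed
    then have "g \<in> Pi\<^sub>E UNIV (\<lambda>_. {-M..M})" unfolding PiE_UNIV_domain by blast
    moreover have "z = ?F g" unfolding vec_eq_iff by (simp only: g vec_lambda_beta) simp
    ultimately show "z \<in> ?F ` (Pi\<^sub>E UNIV (\<lambda>_. {-M..M}))" unfolding image_def by blast
  qed
  have "finite (Pi\<^sub>E (UNIV::'d set) (\<lambda>_. {-M..M}))"
    by (rule finite_PiE[OF finite finite_atLeastAtMost_int])
  from finite_subset[OF sub finite_imageI[OF this]] show ?thesis .
qed

lemma vgradient_eqI:
  fixes v :: "real^'d \<Rightarrow> real^'d"
  assumes "\<And>i. has_gradient (\<lambda>x. v x $ i) (G i) x"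
  shows "vgradient v x = (\<chi> i. G i)"
proof -
  have "(v has_derivative (\<lambda>y. (\<chi> i. G i) *v y)) (at x)"
  proof (rule iffD2[OF has_derivative_componentwise_within], rule ballI)
    fix b :: "real^'d" assume "b \<in> Basis"
    then obtain i where b: "b = axis i 1" by (auto simp: Basis_vec_def)
    show "((\<lambda>x. v x \<bullet> b) has_derivative (\<lambda>y. ((\<chi> i. G i) *v y) \<bullet> b)) (at x)"
      using assms[of i] by (simp add: b inner_axis matrix_vector_mul_component)
  qed
  then have "frechet_derivative v (at x) = (\<lambda>y. (\<chi> i. G i) *v y)"
    by (rule frechet_derivative_at[symmetric])
  then show ?thesis by (simp add: vgradient_def jacobian_def matrix_of_matrix_vector_mul)
qed

lemma divergence_eqI:
  fixes v :: "real^'d \<Rightarrow> real^'d"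
  assumes "\<And>i. has_gradient (\<lambda>x. v x $ i) (G i) x"
  shows "divergence v x = (\<Sum>i\<in>UNIV. G i $ i)"
  unfolding divergence_def vgradient_eqI[OF assms] by (simp add: trace_def)

section \<open>Finite element spaces\<close>

text \<open>Guarantees that the sum in \<open>polynomial_on\<close> is a genuine one; over an
  infinite index set it would be zero by convention.\<close>

lemma finite_bounded_multi_indices: "finite {m :: 'd::finite \<Rightarrow> nat. (\<Sum>i\<in>UNIV. m i) \<le> k}"
proof -
  have "finite (Pi\<^sub>E (UNIV::'d set) (\<lambda>_. {..k}))" by (rule finite_PiE[OF finite finite_atMost])
  moreover have "{m :: 'd \<Rightarrow> nat. (\<Sum>i\<in>UNIV. m i) \<le> k} \<subseteq> Pi\<^sub>E UNIV (\<lambda>_. {..k})"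
  proof
    fix m :: "'d \<Rightarrow> nat" assume m: "m \<in> {m. (\<Sum>i\<in>UNIV. m i) \<le> k}"
    have "m i \<le> k" for i using member_le_sum[of i UNIV m] m by simp
    then show "m \<in> Pi\<^sub>E UNIV (\<lambda>_. {..k})" unfolding PiE_UNIV_domain by blast
  qed
  ultimately show ?thesis using finite_subset by blast
qed

section \<open>Polynomials and continuous fields\<close>

lemma polynomial_on_add: "polynomial_on k K f \<Longrightarrow> polynomial_on k K g \<Longrightarrow> polynomial_on k K (\<lambda>x. f x + g x)"
  unfolding polynomial_on_def
proof (elim exE)
  fix c d :: "('a \<Rightarrow> nat) \<Rightarrow> real"
  assume "\<forall>x\<in>K. f x = (\<Sum>m | sum m UNIV \<le> k. c m * (\<Prod>i\<in>UNIV. x $ i ^ m i))"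
    "\<forall>x\<in>K. g x = (\<Sum>m | sum m UNIV \<le> k. d m * (\<Prod>i\<in>UNIV. x $ i ^ m i))"
  then show "\<exists>c. \<forall>x\<in>K. f x + g x = (\<Sum>m | sum m UNIV \<le> k. c m * (\<Prod>i\<in>UNIV. x $ i ^ m i))"
    by (intro exI[of _ "\<lambda>m. c m + d m"]) (simp add: distrib_right sum.distrib)
qed

lemma polynomial_on_cmult: "polynomial_on k K f \<Longrightarrow> polynomial_on k K (\<lambda>x. a * f x)"
  unfolding polynomial_on_def
proof (elim exE)
  fix c :: "('a \<Rightarrow> nat) \<Rightarrow> real"
  assume "\<forall>x\<in>K. f x = (\<Sum>m | sum m UNIV \<le> k. c m * (\<Prod>i\<in>UNIV. x $ i ^ m i))"
  then show "\<exists>c. \<forall>x\<in>K. a * f x = (\<Sum>m | sum m UNIV \<le> k. c m * (\<Prod>i\<in>UNIV. x $ i ^ m i))"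
    by (intro exI[of _ "\<lambda>m. a * c m"]) (simp add: sum_distrib_left mult.assoc)
qed

lemma polynomial_on_monomial:
  fixes K :: "(real^'d) set"
  assumes "(\<Sum>i\<in>UNIV. m i) \<le> k"
  shows "polynomial_on k K (\<lambda>x. \<Prod>i\<in>UNIV. x $ i ^ m i)"
  unfolding polynomial_on_def
proof (intro exI ballI)
  fix x :: "real^'d"
  have "(\<Sum>n | (\<Sum>i\<in>UNIV. n i) \<le> k. (if n = m then 1 else 0) * (\<Prod>i\<in>UNIV. x $ i ^ n i))
    = (\<Sum>n | (\<Sum>i\<in>UNIV. n i) \<le> k. if m = n then (\<Prod>i\<in>UNIV. x $ i ^ n i) else 0)"
    by (rule sum.cong) auto
  also have "\<dots> = (\<Prod>i\<in>UNIV. x $ i ^ m i)"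
    by (subst sum.delta'[OF finite_bounded_multi_indices]) (use assms in simp)
  finally show "(\<Prod>i\<in>UNIV. x $ i ^ m i)
    = (\<Sum>n | (\<Sum>i\<in>UNIV. n i) \<le> k. (if n = m then 1 else 0) * (\<Prod>i\<in>UNIV. x $ i ^ n i))" by simp
qed

lemma polynomial_on_const:
  fixes K :: "(real^'d) set"
  shows "polynomial_on k K (\<lambda>x. a)"
  using polynomial_on_cmult[OF polynomial_on_monomial[of "\<lambda>_. 0" k K], of a] by simp

lemma polynomial_on_nth:
  fixes K :: "(real^'d) set"
  assumes "1 \<le> k" shows "polynomial_on k K (\<lambda>x. x $ j)"
proof -
  have "x $ i ^ (if i = j then 1 else 0) = (if i = j then x $ i else 1)" for x :: "real^'d" and i
    by simp
  then have "(\<Prod>i\<in>UNIV. x $ i ^ (if i = j then 1 else 0)) = x $ j" for x :: "real^'d"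
    by (simp only: prod.delta[OF finite] UNIV_I if_True)
  moreover have "(\<Sum>i\<in>UNIV. if i = j then 1 else 0) \<le> k" using assms by simp
  ultimately show ?thesis using polynomial_on_monomial[of "\<lambda>i. if i = j then 1 else 0" k K] by simp
qed

lemma continuous_field_add:
  fixes f g :: "real^'d \<Rightarrow> real"
  shows "continuous_field D f \<Longrightarrow> continuous_field D g \<Longrightarrow> continuous_field D (\<lambda>x. f x + g x)"
  unfolding continuous_field_def
  by (auto split: boundary.splits simp: periodic_fun_def intro!: continuous_intros)

lemma continuous_field_cmult:
  fixes f :: "real^'d \<Rightarrow> real"
  shows "continuous_field D f \<Longrightarrow> continuous_field D (\<lambda>x. c * f x)"
  unfolding continuous_field_def
  by (auto split: boundary.splits simp: periodic_fun_def intro!: continuous_intros)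

lemma continuous_field_nth:
  fixes v :: "real^'d \<Rightarrow> real^'d"
  shows "continuous_field D v \<Longrightarrow> continuous_field D (\<lambda>x. v x $ i)"
  unfolding continuous_field_def
  by (auto split: boundary.splits simp: periodic_fun_def intro!: continuous_intros)

lemma continuous_field_const: "continuous_field D (\<lambda>x. c :: real)"
  unfolding continuous_field_def
  by (auto split: boundary.splits simp: periodic_fun_def intro!: continuous_intros)

section \<open>The domain and its test functions\<close>

lemma discretization_domain:
  fixes D :: "('d::finite) discretization"
  assumes "discretization_ok D"
  shows "open (Omega D)" "bounded (Omega D)"
proof -
  have "open (Omega D) \<and> bounded (Omega D)"
  proof (cases "bdry D")
    case (Torus L)
    then show ?thesis using assms by (auto simp: discretization_ok_def)
  next
    case (Walls \<Gamma>1 \<Gamma>2)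
    then have "open (Omega D)" "conforming_partition (Omega D) (elements D)"
      using assms by (auto simp: discretization_ok_def)
    then have "Omega D = interior (\<Union>(elements D))" "finite (elements D)" "\<forall>K\<in>elements D. polytope K"
      by (auto simp: conforming_partition_def element_def)
    moreover from this have "bounded (\<Union>(elements D))"
      using polytope_imp_bounded by (intro bounded_Union) auto
    ultimately show ?thesis using \<open>open (Omega D)\<close> bounded_interior by simp
  qed
  then show "open (Omega D)" "bounded (Omega D)" by auto
qed

lemma discretization_lmeasurable: "discretization_ok D \<Longrightarrow> Omega D \<in> lmeasurable"
  by (rule lmeasurable_open[OF discretization_domain(2,1)])

lemma test_function_C1: "test_function D \<psi> \<Longrightarrow> C1 \<psi>"
  by (simp add: test_function_def C1_def)

text \<open>This is what puts constants into \<open>H1\<close>: their weak gradient is 0. Test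
  functions are smooth everywhere, so on the torus the empty arrangement is enough; between walls
  they have compact support.\<close>

lemma test_function_integral_gradient:
  fixes D :: "('d::finite) discretization"
  assumes D: "discretization_ok D" and \<psi>: "test_function D \<psi>"
  shows "(LINT x|lebesgue_on (Omega D). gradient \<psi> x $ i) = 0"
proof (cases "bdry D")
  case (Torus L)
  then obtain a where L: "0 < L" "Omega D = box a (a + (\<chi> i. L))"
    using D by (auto simp: discretization_ok_def)
  obtain R where R: "\<And>x. x \<in> Omega D \<Longrightarrow> norm x < R"
    using discretization_domain(2)[OF D] unfolding bounded_pos_less by blast
  let ?U = "ball (0::real^'d) (R + 1)"
  show ?thesis
  proof (rule torus_integral_gradient[OF L, where P = "{}" and U = ?U])
    show "arrangement {}" by (simp add: arrangement_def)
    show "x + w \<in> ?U" if "x \<in> Omega D" "norm w \<le> 1" for x w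
      using R[OF that(1)] that(2) norm_triangle_ineq[of x w] by simp
    show "piecewise_C1 ?U (\<Union>(hyp ` {})) \<psi>"
      by (rule C1_imp_piecewise_C1[OF test_function_C1[OF \<psi>]]) simp
    show "continuous_on UNIV \<psi>" by (rule C1_continuous[OF test_function_C1[OF \<psi>]])
    show "periodic_fun L \<psi>" using \<psi> Torus by (simp add: test_function_def)
  qed simp
next
  case (Walls \<Gamma>1 \<Gamma>2)
  then have "compact (closure {x. \<psi> x \<noteq> 0})" "closure {x. \<psi> x \<noteq> 0} \<subseteq> Omega D"
    using \<psi> by (auto simp: test_function_def)
  then show ?thesis
    by (rule compact_support_integral_gradient[OF test_function_C1[OF \<psi>] _ _ discretization_domain(1)[OF D]])
qed

lemma test_function_bounded:
  assumes D: "discretization_ok D" and \<psi>: "test_function D \<psi>"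
  obtains B where "\<And>x. x \<in> Omega D \<Longrightarrow> \<bar>\<psi> x\<bar> \<le> B" "\<And>x i. x \<in> Omega D \<Longrightarrow> \<bar>gradient \<psi> x $ i\<bar> \<le> B"
proof -
  have "compact (closure (Omega D))" using discretization_domain(2)[OF D] by (simp add: compact_closure)
  from C1_bounded_on_compact[OF test_function_C1[OF \<psi>] this] obtain B
    where B: "\<And>x. x \<in> closure (Omega D) \<Longrightarrow> \<bar>\<psi> x\<bar> \<le> B" "\<And>x. x \<in> closure (Omega D) \<Longrightarrow> norm (gradient \<psi> x) \<le> B"
    by blast
  show ?thesis
  proof (rule that)
    fix x i assume "x \<in> Omega D"
    then have x: "x \<in> closure (Omega D)" using closure_subset by blast
    show "\<bar>\<psi> x\<bar> \<le> B" by (rule B(1)[OF x])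
    show "\<bar>gradient \<psi> x $ i\<bar> \<le> B" by (rule order_trans[OF component_le_norm_cart B(2)[OF x]])
  qed
qed

lemma test_function_measurable:
  assumes "test_function D \<psi>"
  shows "\<psi> \<in> borel_measurable (lebesgue_on S)" "(\<lambda>x. gradient \<psi> x $ i) \<in> borel_measurable (lebesgue_on S)"
proof -
  note C = test_function_C1[OF assms]
  show "\<psi> \<in> borel_measurable (lebesgue_on S)"
    by (intro borel_imp_measurable_lebesgue_on borel_measurable_continuous_onI C1_continuous C)
  show "(\<lambda>x. gradient \<psi> x $ i) \<in> borel_measurable (lebesgue_on S)"
    by (intro borel_imp_measurable_lebesgue_on borel_measurable_continuous_onI continuous_intros
        C1_gradient_continuous C)
qed

text \<open>On a set of finite measure \<open>\<bar>f x\<bar> \<le> 1 + (f x)\<^sup>2\<close>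
  reduces integrability to square integrability.\<close>

lemma square_integrable_mult_bounded:
  assumes f: "square_integrable S f" and S: "S \<in> lmeasurable"
    and b: "b \<in> borel_measurable (lebesgue_on S)" "\<And>x. x \<in> S \<Longrightarrow> \<bar>b x\<bar> \<le> B"
  shows "integrable (lebesgue_on S) (\<lambda>x. f x * b x)"
proof (rule Bochner_Integration.integrable_bound)
  interpret finite_measure "lebesgue_on S" by (rule finite_measure_lebesgue_on[OF S])
  show "integrable (lebesgue_on S) (\<lambda>x. \<bar>B\<bar> * (1 + (f x)\<^sup>2))"
    using f by (simp add: square_integrable_def)
  show "(\<lambda>x. f x * b x) \<in> borel_measurable (lebesgue_on S)"
    using f b unfolding square_integrable_def by (auto intro: borel_measurable_times)
  show "AE x in lebesgue_on S. norm (f x * b x) \<le> norm (\<bar>B\<bar> * (1 + (f x)\<^sup>2))"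
  proof (rule AE_I2)
    fix x assume "x \<in> space (lebesgue_on S)"
    then have "\<bar>b x\<bar> \<le> \<bar>B\<bar>" using b(2)[of x] by simp
    moreover have "\<bar>f x\<bar> \<le> 1 + (f x)\<^sup>2"
    proof -
      have "0 \<le> (\<bar>f x\<bar> - 1)\<^sup>2" by simp
      then have "2 * \<bar>f x\<bar> \<le> 1 + (f x)\<^sup>2" by (simp add: power2_diff)
      then show ?thesis by linarith
    qed
    ultimately have "\<bar>b x\<bar> * \<bar>f x\<bar> \<le> \<bar>B\<bar> * (1 + (f x)\<^sup>2)" by (intro mult_mono) auto
    then show "norm (f x * b x) \<le> norm (\<bar>B\<bar> * (1 + (f x)\<^sup>2))"
      by (simp add: abs_mult mult.commute)
  qed
qed

lemma square_integrable_add: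
  assumes "square_integrable S f" "square_integrable S g" shows "square_integrable S (\<lambda>x. f x + g x)"
  unfolding square_integrable_def
proof
  show m: "(\<lambda>x. f x + g x) \<in> borel_measurable (lebesgue_on S)"
    using assms unfolding square_integrable_def by (auto intro: borel_measurable_add)
  show "integrable (lebesgue_on S) (\<lambda>x. (f x + g x)\<^sup>2)"
  proof (rule Bochner_Integration.integrable_bound)
    show "integrable (lebesgue_on S) (\<lambda>x. 2 * (f x)\<^sup>2 + 2 * (g x)\<^sup>2)"
      using assms by (simp add: square_integrable_def)
    show "AE x in lebesgue_on S. norm ((f x + g x)\<^sup>2) \<le> norm (2 * (f x)\<^sup>2 + 2 * (g x)\<^sup>2)"
    proof (rule AE_I2)
      fix x
      have "0 \<le> (f x - g x)\<^sup>2" by simp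
      then have "(f x + g x)\<^sup>2 \<le> 2 * (f x)\<^sup>2 + 2 * (g x)\<^sup>2" by (simp add: power2_diff power2_sum)
      then show "norm ((f x + g x)\<^sup>2) \<le> norm (2 * (f x)\<^sup>2 + 2 * (g x)\<^sup>2)" by simp
    qed
  qed (use m in simp)
qed

lemma square_integrable_cmult:
  "square_integrable S f \<Longrightarrow> square_integrable S (\<lambda>x. c * f x)"
  unfolding square_integrable_def
  by (auto simp: power_mult_distrib intro: borel_measurable_times)

lemma square_integrable_bounded:
  assumes "S \<in> lmeasurable" "f \<in> borel_measurable (lebesgue_on S)" "\<And>x. x \<in> S \<Longrightarrow> \<bar>f x\<bar> \<le> B"
  shows "square_integrable S f"
proof -
  interpret finite_measure "lebesgue_on S" by (rule finite_measure_lebesgue_on[OF assms(1)])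
  have "integrable (lebesgue_on S) (\<lambda>x. (f x)\<^sup>2)"
  proof (rule integrable_const_bound[where B = "B\<^sup>2"])
    show "AE x in lebesgue_on S. norm ((f x)\<^sup>2) \<le> B\<^sup>2"
    proof (rule AE_I2)
      fix x assume "x \<in> space (lebesgue_on S)"
      then have "\<bar>f x\<bar> \<le> B" using assms(3) by simp
      then have "\<bar>f x\<bar>\<^sup>2 \<le> B\<^sup>2" by (intro power_mono) auto
      then show "norm ((f x)\<^sup>2) \<le> B\<^sup>2" by simp
    qed
  qed (use assms(2) in simp)
  then show ?thesis using assms(2) by (simp add: square_integrable_def)
qed

lemma H1_I:
  assumes "square_integrable (Omega D) f" "\<And>i. square_integrable (Omega D) (\<lambda>x. G x $ i)"
    and "\<And>\<psi> i. test_function D \<psi> \<Longrightarrow> (LINT x|lebesgue_on (Omega D). f x * gradient \<psi> x $ i) =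
      - (LINT x|lebesgue_on (Omega D). G x $ i * \<psi> x)"
  shows "f \<in> H1 D"
  unfolding H1_def pairing_def inner_real_def using assms by blast

lemma H1_E:
  assumes "f \<in> H1 D"
  obtains G where "square_integrable (Omega D) f" "\<And>i. square_integrable (Omega D) (\<lambda>x. G x $ i)"
    "\<And>\<psi> i. test_function D \<psi> \<Longrightarrow> (LINT x|lebesgue_on (Omega D). f x * gradient \<psi> x $ i) =
      - (LINT x|lebesgue_on (Omega D). G x $ i * \<psi> x)"
  using assms unfolding H1_def pairing_def inner_real_def by blast

lemma H1_add:
  assumes D: "discretization_ok D" and "f \<in> H1 D" "g \<in> H1 D" shows "(\<lambda>x. f x + g x) \<in> H1 D"
proof -
  obtain F where F: "square_integrable (Omega D) f" "\<And>i. square_integrable (Omega D) (\<lambda>x. F x $ i)"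
    "\<And>\<psi> i. test_function D \<psi> \<Longrightarrow> (LINT x|lebesgue_on (Omega D). f x * gradient \<psi> x $ i) =
      - (LINT x|lebesgue_on (Omega D). F x $ i * \<psi> x)" using H1_E[OF assms(2)] by blast
  obtain G where G: "square_integrable (Omega D) g" "\<And>i. square_integrable (Omega D) (\<lambda>x. G x $ i)"
    "\<And>\<psi> i. test_function D \<psi> \<Longrightarrow> (LINT x|lebesgue_on (Omega D). g x * gradient \<psi> x $ i) =
      - (LINT x|lebesgue_on (Omega D). G x $ i * \<psi> x)" using H1_E[OF assms(3)] by blast
  show ?thesis
  proof (rule H1_I[where G = "\<lambda>x. F x + G x"])
    show "square_integrable (Omega D) (\<lambda>x. f x + g x)" by (rule square_integrable_add[OF F(1) G(1)])
    show "square_integrable (Omega D) (\<lambda>x. (F x + G x) $ i)" for i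
      using square_integrable_add[OF F(2) G(2)] by simp
    fix \<psi> i assume \<psi>: "test_function D \<psi>"
    obtain B where B: "\<And>x. x \<in> Omega D \<Longrightarrow> \<bar>\<psi> x\<bar> \<le> B" "\<And>x i. x \<in> Omega D \<Longrightarrow> \<bar>gradient \<psi> x $ i\<bar> \<le> B"
      using test_function_bounded[OF D \<psi>] by blast
    note I1 = square_integrable_mult_bounded[OF _ discretization_lmeasurable[OF D] test_function_measurable(2)[OF \<psi>] B(2)]
    note I2 = square_integrable_mult_bounded[OF _ discretization_lmeasurable[OF D] test_function_measurable(1)[OF \<psi>] B(1)]
    show "(LINT x|lebesgue_on (Omega D). (f x + g x) * gradient \<psi> x $ i) =
      - (LINT x|lebesgue_on (Omega D). (F x + G x) $ i * \<psi> x)"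
      using F(3)[OF \<psi>, of i] G(3)[OF \<psi>, of i] I1[OF F(1)] I1[OF G(1)] I2[OF F(2)] I2[OF G(2)]
      by (simp add: distrib_right)
  qed
qed

lemma H1_cmult:
  assumes "f \<in> H1 D" shows "(\<lambda>x. c * f x) \<in> H1 D"
proof -
  obtain F where F: "square_integrable (Omega D) f" "\<And>i. square_integrable (Omega D) (\<lambda>x. F x $ i)"
    "\<And>\<psi> i. test_function D \<psi> \<Longrightarrow> (LINT x|lebesgue_on (Omega D). f x * gradient \<psi> x $ i) =
      - (LINT x|lebesgue_on (Omega D). F x $ i * \<psi> x)" using H1_E[OF assms] by blast
  show ?thesis
  proof (rule H1_I[where G = "\<lambda>x. c *\<^sub>R F x"])
    show "square_integrable (Omega D) (\<lambda>x. (c *\<^sub>R F x) $ i)" for i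
      using square_integrable_cmult[OF F(2)] by simp
    show "(LINT x|lebesgue_on (Omega D). c * f x * gradient \<psi> x $ i) =
      - (LINT x|lebesgue_on (Omega D). (c *\<^sub>R F x) $ i * \<psi> x)" if "test_function D \<psi>" for \<psi> i
      using F(3)[OF that, of i] by (simp add: mult.assoc)
  qed (rule square_integrable_cmult[OF F(1)])
qed

lemma H1_const: assumes D: "discretization_ok D" shows "(\<lambda>x. c) \<in> H1 D"
proof (rule H1_I[where G = "\<lambda>x. 0"])
  show "square_integrable (Omega D) (\<lambda>x. c)"
    by (rule square_integrable_bounded[OF discretization_lmeasurable[OF D], of _ "\<bar>c\<bar>"]) auto
  show "square_integrable (Omega D) (\<lambda>x. 0 $ i)" for i
    by (rule square_integrable_bounded[OF discretization_lmeasurable[OF D], of _ 0]) auto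
  show "(LINT x|lebesgue_on (Omega D). c * gradient \<psi> x $ i) = - (LINT x|lebesgue_on (Omega D). 0 $ i * \<psi> x)"
    if "test_function D \<psi>" for \<psi> i
    using test_function_integral_gradient[OF D that] by simp
qed

text \<open>The product of a coordinate with a compactly supported test function is again smooth
  with compact support, so its derivatives integrate to zero. Coordinates enter as test functions
  for gravity; on a torus they are not periodic.\<close>

lemma H1_nth:
  fixes D :: "('d::finite) discretization"
  assumes D: "discretization_ok D" and W: "bdry D = Walls \<Gamma>1 \<Gamma>2" shows "(\<lambda>x. x $ j) \<in> H1 D"
proof (rule H1_I[where G = "\<lambda>x. axis j 1"])
  obtain R where R: "\<And>x. x \<in> Omega D \<Longrightarrow> norm x < R"
    using discretization_domain(2)[OF D] unfolding bounded_pos_less by blast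
  have jm: "(\<lambda>x::real^'d. x $ j) \<in> borel_measurable (lebesgue_on (Omega D))"
    by (intro borel_imp_measurable_lebesgue_on borel_measurable_continuous_onI continuous_intros)
  have jb: "\<bar>x $ j\<bar> \<le> R" if "x \<in> Omega D" for x
    using component_le_norm_cart[of x j] R[OF that] by linarith
  show sj: "square_integrable (Omega D) (\<lambda>x. x $ j)"
    by (rule square_integrable_bounded[OF discretization_lmeasurable[OF D] jm jb])
  show sa: "square_integrable (Omega D) (\<lambda>x. axis j 1 $ i)" for i
    by (rule square_integrable_bounded[OF discretization_lmeasurable[OF D], of _ "\<bar>axis j 1 $ i\<bar>"]) auto
  fix \<psi> i assume \<psi>: "test_function D \<psi>"
  note C = test_function_C1[OF \<psi>]
  have comp: "compact (closure {x. \<psi> x \<noteq> 0})" "closure {x. \<psi> x \<noteq> 0} \<subseteq> Omega D"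
    using \<psi> W by (auto simp: test_function_def)
  let ?f = "\<lambda>x. x $ j * \<psi> x"
  have sub: "closure {x. ?f x \<noteq> 0} \<subseteq> closure {x. \<psi> x \<noteq> 0}" by (rule closure_mono) auto
  have "compact (closure {x. ?f x \<noteq> 0})"
    using compact_Int_closed[OF comp(1) closed_closure[of "{x. ?f x \<noteq> 0}"]] sub by (simp only: Int_absorb1)
  then have 0: "(LINT x|lebesgue_on (Omega D). gradient ?f x $ i) = 0"
    by (rule compact_support_integral_gradient[OF C1_mult[OF C1_nth C] _ order_trans[OF sub comp(2)] discretization_domain(1)[OF D]])
  have "gradient ?f x = x $ j *\<^sub>R gradient \<psi> x + \<psi> x *\<^sub>R axis j 1" for x
    by (intro gradient_eqI has_gradient_mult has_gradient_nth C1_has_gradient[OF C])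
  then have g: "gradient ?f x $ i = x $ j * gradient \<psi> x $ i + axis j 1 $ i * \<psi> x" for x
    by simp
  obtain B where B: "\<And>x. x \<in> Omega D \<Longrightarrow> \<bar>\<psi> x\<bar> \<le> B" "\<And>x i. x \<in> Omega D \<Longrightarrow> \<bar>gradient \<psi> x $ i\<bar> \<le> B"
    using test_function_bounded[OF D \<psi>] by blast
  have I1: "integrable (lebesgue_on (Omega D)) (\<lambda>x. x $ j * gradient \<psi> x $ i)"
    by (rule square_integrable_mult_bounded[OF sj discretization_lmeasurable[OF D] test_function_measurable(2)[OF \<psi>] B(2)])
  have I2: "integrable (lebesgue_on (Omega D)) (\<lambda>x. axis j 1 $ i * \<psi> x)"
    by (rule square_integrable_mult_bounded[OF sa discretization_lmeasurable[OF D] test_function_measurable(1)[OF \<psi>] B(1)])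
  show "(LINT x|lebesgue_on (Omega D). x $ j * gradient \<psi> x $ i) =
    - (LINT x|lebesgue_on (Omega D). axis j 1 $ i * \<psi> x)"
    using 0 unfolding g Bochner_Integration.integral_add[OF I1 I2] by simp
qed

section \<open>Linear structure of the finite element space\<close>

lemma V_h_add: "discretization_ok D \<Longrightarrow> f \<in> V_h D \<Longrightarrow> g \<in> V_h D \<Longrightarrow> (\<lambda>x. f x + g x) \<in> V_h D"
  by (simp add: V_h_def H1_add continuous_field_add polynomial_on_add)

lemma V_h_cmult: "f \<in> V_h D \<Longrightarrow> (\<lambda>x. c * f x) \<in> V_h D"
  by (simp add: V_h_def H1_cmult continuous_field_cmult polynomial_on_cmult)

lemma V_h_const: "discretization_ok D \<Longrightarrow> (\<lambda>x. c) \<in> V_h D"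
  by (simp add: V_h_def H1_const continuous_field_const polynomial_on_const)

lemma V_h_diff: "discretization_ok D \<Longrightarrow> f \<in> V_h D \<Longrightarrow> g \<in> V_h D \<Longrightarrow> (\<lambda>x. f x - g x) \<in> V_h D"
  using V_h_add[of D f "\<lambda>x. (- 1) * g x"] V_h_cmult[of g D "- 1"] by simp

lemma V_h_sum:
  assumes "discretization_ok D" "\<And>i. i \<in> I \<Longrightarrow> f i \<in> V_h D" shows "(\<lambda>x. \<Sum>i\<in>I. f i x) \<in> V_h D"
  using assms(2) by (induction I rule: infinite_finite_induct) (simp_all add: V_h_const V_h_add assms(1))

lemma V_h_nth:
  assumes "discretization_ok D" "bdry D = Walls \<Gamma>1 \<Gamma>2" shows "(\<lambda>x. x $ j) \<in> V_h D"
  using assms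
  by (simp add: V_h_def H1_nth polynomial_on_nth continuous_field_def continuous_on_component continuous_on_id)

text \<open>The elements need not lie in the cube, but finitely many of their lattice translates
  cover a bounded neighbourhood of it. On the translate by \<open>z\<close> a periodic function is
  its polynomial on the element shifted by \<open>z\<close>.\<close>

lemma torus_skeleton:
  fixes D :: "('d::finite) discretization"
  assumes D: "discretization_ok D" and T: "bdry D = Torus L"
  obtains P U where "arrangement P" "open U" "\<And>x w. x \<in> Omega D \<Longrightarrow> norm w \<le> 1 \<Longrightarrow> x + w \<in> U"
    "\<And>f k. continuous_field D f \<Longrightarrow> (\<And>K. K \<in> elements D \<Longrightarrow> polynomial_on k K f) \<Longrightarrow>
      piecewise_C1 U (\<Union>(hyp ` P)) f"
proof -
  have L: "0 < L" and part: "conforming_torus_partition L (elements D)"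
    using D T by (auto simp: discretization_ok_def)
  then have Th: "finite (elements D)" "\<And>K. K \<in> elements D \<Longrightarrow> polytope K"
    "(\<Union>K\<in>elements D. \<Union>z\<in>torus_lattice L. (+) z ` K) = UNIV"
    by (auto simp: conforming_torus_partition_def element_def)
  obtain R where R: "\<And>x. x \<in> Omega D \<Longrightarrow> norm x < R"
    using discretization_domain(2)[OF D] unfolding bounded_pos_less by blast
  define U where "U = ball (0::real^'d) (R + 1)"
  \<comment> \<open>The translates of \<open>K\<close> that reach \<open>U\<close>. Boundedness of
    \<open>K\<close> and \<open>U\<close> bounds these lattice vectors, hence there are finitely
    many.\<close>
  define Z where "Z K = {z \<in> torus_lattice L. (+) z ` K \<inter> U \<noteq> {}}" for K
  have finZ: "finite (Z K)" if K: "K \<in> elements D" for K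
  proof -
    have "bounded K" using Th(2)[OF K] polytope_imp_bounded by blast
    then obtain r where r: "\<And>x. x \<in> K \<Longrightarrow> norm x \<le> r" unfolding bounded_iff by blast
    have "Z K \<subseteq> {z. z \<in> torus_lattice L \<and> norm z \<le> R + 1 + r}"
    proof
      fix z assume "z \<in> Z K"
      then obtain x where z: "z \<in> torus_lattice L" "x \<in> K" "z + x \<in> U" by (auto simp: Z_def)
      have "norm z \<le> norm (z + x) + norm x" using norm_triangle_ineq4[of "z + x" x] by simp
      then show "z \<in> {z. z \<in> torus_lattice L \<and> norm z \<le> R + 1 + r}"
        using z r[OF z(2)] by (simp add: U_def)
    qed
    then show ?thesis using finite_torus_lattice_bounded[OF L] finite_subset by blast
  qed
  define KK where "KK = (\<Union>K\<in>elements D. (\<lambda>z. (+) z ` K) ` Z K)"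
  have fin: "finite KK" unfolding KK_def using Th(1) finZ by blast
  have poly: "polytope K" if "K \<in> KK" for K
    using that Th(2) unfolding KK_def by (auto simp: polytope_translation_eq)
  have cover: "U \<subseteq> \<Union>KK"
  proof
    fix x assume x: "x \<in> U"
    have "x \<in> (\<Union>K\<in>elements D. \<Union>z\<in>torus_lattice L. (+) z ` K)" unfolding Th(3) by simp
    then obtain K z where K: "K \<in> elements D" "z \<in> torus_lattice L" "x \<in> (+) z ` K" by blast
    then have "z \<in> Z K" using x unfolding Z_def by blast
    then show "x \<in> \<Union>KK" unfolding KK_def using K by blast
  qed
  obtain P where P: "arrangement P" "\<And>K. K \<in> KK \<Longrightarrow> frontier K \<subseteq> \<Union>(hyp ` P)"
    using polytopes_frontier_arrangement[OF fin poly] by blast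
  show ?thesis
  proof (rule that[OF P(1)])
    show "open U" by (simp add: U_def)
    show "x + w \<in> U" if "x \<in> Omega D" "norm w \<le> 1" for x w
      using R[OF that(1)] that(2) norm_triangle_ineq[of x w] by (simp add: U_def)
    fix f :: "real^'d \<Rightarrow> real" and k
    assume f: "continuous_field D f" "\<And>K. K \<in> elements D \<Longrightarrow> polynomial_on k K f"
    have fc: "continuous_on UNIV f" "periodic_fun L f" using f(1) T by (auto simp: continuous_field_def)
    show "piecewise_C1 U (\<Union>(hyp ` P)) f"
    proof (rule piecewise_C1_of_pieces[OF fin polytope_imp_compact[OF poly] cover P(2)])
      show "continuous_on U f" using fc(1) continuous_on_subset by blast
      fix K' assume "K' \<in> KK"
      then obtain K z where K: "K \<in> elements D" "z \<in> torus_lattice L" "K' = (+) z ` K"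
        unfolding KK_def Z_def by blast
      obtain F where F: "C1 F" "\<forall>x\<in>K. f x = F x" using polynomial_on_C1[OF f(2)[OF K(1)]] by blast
      have "f x = F (x - z)" if "x \<in> K'" for x
      proof -
        obtain y where y: "y \<in> K" "x = y + z"
          using \<open>x \<in> K'\<close> unfolding K(3) by (metis add.commute imageE)
        have "f (y + z) = f y" using fc(2) K(2) by (simp add: periodic_fun_def)
        then show ?thesis using F(2) y by simp
      qed
      then show "\<exists>F. C1 F \<and> (\<forall>x\<in>K'. f x = F x)" using C1_translate[OF F(1)] by blast
    qed
  qed
qed

lemma walls_skeleton:
  fixes D :: "('d::finite) discretization"
  assumes D: "discretization_ok D" and W: "bdry D = Walls \<Gamma>1 \<Gamma>2"
  obtains P where "arrangement P" "\<And>K. K \<in> elements D \<Longrightarrow> frontier K \<subseteq> \<Union>(hyp ` P)"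
    "\<And>f k. continuous_field D f \<Longrightarrow> (\<And>K. K \<in> elements D \<Longrightarrow> polynomial_on k K f) \<Longrightarrow>
      piecewise_C1 (Omega D) (\<Union>(hyp ` P)) f"
proof -
  have Th: "finite (elements D)" "\<And>K. K \<in> elements D \<Longrightarrow> polytope K" "Omega D = interior (\<Union>(elements D))"
    using D W by (auto simp: discretization_ok_def conforming_partition_def element_def)
  obtain P where P: "arrangement P" "\<And>K. K \<in> elements D \<Longrightarrow> frontier K \<subseteq> \<Union>(hyp ` P)"
    using polytopes_frontier_arrangement[OF Th(1,2)] by blast
  show ?thesis
  proof (rule that[OF P])
    fix f :: "real^'d \<Rightarrow> real" and k
    assume f: "continuous_field D f" "\<And>K. K \<in> elements D \<Longrightarrow> polynomial_on k K f"
    show "piecewise_C1 (Omega D) (\<Union>(hyp ` P)) f"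
    proof (rule piecewise_C1_of_pieces[OF Th(1) polytope_imp_compact[OF Th(2)] _ P(2)])
      show "Omega D \<subseteq> \<Union>(elements D)" unfolding Th(3) by (rule interior_subset)
      have "continuous_on (closure (Omega D)) f" using f(1) W by (simp add: continuous_field_def)
      then show "continuous_on (Omega D) f" using closure_subset by (rule continuous_on_subset)
    qed (use polynomial_on_C1[OF f(2)] in auto)
  qed
qed

text \<open>Collects what the scheme needs from the geometry: one null set for both spaces, and the
  divergence theorem. The latter concerns products because \<open>q\<close> times \<open>v\<close>
  is in general of degree three and thus outside \<open>X_h\<close>.\<close>

lemma discretization_skeleton:
  fixes D :: "('d::finite) discretization"
  assumes D: "discretization_ok D"
  obtains N where "negligible N"
    "\<And>q. q \<in> V_h D \<Longrightarrow> piecewise_C1 (Omega D) N q"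
    "\<And>v i. v \<in> X_h D \<Longrightarrow> piecewise_C1 (Omega D) N (\<lambda>x. v x $ i)"
    "\<And>q v. q \<in> V_h D \<Longrightarrow> v \<in> X_h D \<Longrightarrow>
      (LINT x|lebesgue_on (Omega D). (\<Sum>i\<in>UNIV. gradient (\<lambda>x. q x * v x $ i) x $ i)) = 0"
proof (cases "bdry D")
  case (Torus L)
  obtain a where L: "0 < L" "Omega D = box a (a + (\<chi> i. L))"
    using D Torus by (auto simp: discretization_ok_def)
  obtain P U where P: "arrangement P" and U: "open U" "\<And>x w. x \<in> Omega D \<Longrightarrow> norm w \<le> 1 \<Longrightarrow> x + w \<in> U"
    and pw: "\<And>f k. continuous_field D f \<Longrightarrow> (\<And>K. K \<in> elements D \<Longrightarrow> polynomial_on k K f) \<Longrightarrow>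
      piecewise_C1 U (\<Union>(hyp ` P)) f"
    using torus_skeleton[OF D Torus] by blast
  have sub: "Omega D \<subseteq> U" using U(2)[of _ 0] by auto
  have V: "piecewise_C1 U (\<Union>(hyp ` P)) q" if "q \<in> V_h D" for q
    by (rule pw[of q 1]) (use that in \<open>simp_all add: V_h_def\<close>)
  have X: "piecewise_C1 U (\<Union>(hyp ` P)) (\<lambda>x. v x $ i)" if "v \<in> X_h D" for v i
    by (rule pw[of _ 2]) (use that in \<open>simp_all add: X_h_def continuous_field_nth\<close>)
  show ?thesis
  proof (rule that[OF arrangement_negligible[OF P]])
    show "piecewise_C1 (Omega D) (\<Union>(hyp ` P)) q" if "q \<in> V_h D" for q
      by (rule piecewise_C1_mono[OF V[OF that] sub])
    show "piecewise_C1 (Omega D) (\<Union>(hyp ` P)) (\<lambda>x. v x $ i)" if "v \<in> X_h D" for v i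
      by (rule piecewise_C1_mono[OF X[OF that] sub])
    fix q v assume q: "q \<in> V_h D" and v: "v \<in> X_h D"
    have pc: "piecewise_C1 U (\<Union>(hyp ` P)) (\<lambda>x. q x * v x $ i)" for i
      by (rule piecewise_C1_mult[OF V[OF q] X[OF v]])
    have cq: "continuous_on UNIV q" "periodic_fun L q"
      using q Torus by (auto simp: V_h_def continuous_field_def)
    have cv: "continuous_on UNIV v" "periodic_fun L v"
      using v Torus by (auto simp: X_h_def continuous_field_def)
    \<comment> \<open>Without boundary every single partial derivative integrates to zero; the
      integrability shown next allows the sum to be split.\<close>
    have 0: "(LINT x|lebesgue_on (Omega D). gradient (\<lambda>x. q x * v x $ i) x $ i) = 0" for i
    proof (rule torus_integral_gradient[OF L P U pc])
      show "continuous_on UNIV (\<lambda>x. q x * v x $ i)" by (intro continuous_intros cq cv)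
      show "periodic_fun L (\<lambda>x. q x * v x $ i)" using cq(2) cv(2) by (simp add: periodic_fun_def)
    qed
    note fm = finite_measure_lebesgue_on[OF discretization_lmeasurable[OF D]]
    have "integrable (lebesgue_on (Omega D)) (\<lambda>x. gradient (\<lambda>x. q x * v x $ i) x $ i)" for i
    proof -
      note pc' = piecewise_C1_mono[OF pc sub, of i]
      obtain B where B: "\<And>x. x \<in> Omega D - \<Union>(hyp ` P) \<Longrightarrow> norm (gradient (\<lambda>x. q x * v x $ i) x) \<le> B"
      proof (rule piecewise_C1E[OF pc'])
        fix B assume "\<And>x. x \<in> Omega D - \<Union>(hyp ` P) \<Longrightarrow> norm (gradient (\<lambda>x. q x * v x $ i) x) \<le> B"
        then show thesis by (rule that)
      qed
      have m: "gradient (\<lambda>x. q x * v x $ i) \<in> borel_measurable (lebesgue_on (Omega D))"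
        by (rule piecewise_C1_gradient_measurable[OF pc' discretization_domain(1)[OF D] arrangement_negligible[OF P]])
      show ?thesis
      proof (rule finite_measure.integrable_const_bound[OF fm])
        show "AE x in lebesgue_on (Omega D). norm (gradient (\<lambda>x. q x * v x $ i) x $ i) \<le> B"
          using AE_lebesgue_on_notin[OF arrangement_negligible[OF P] fmeasurableD[OF discretization_lmeasurable[OF D]]]
            AE_space[of "lebesgue_on (Omega D)"]
        proof eventually_elim
          case (elim x)
          then have "x \<in> Omega D - \<Union>(hyp ` P)" by simp
          from B[OF this] show ?case unfolding real_norm_def by (rule order_trans[OF component_le_norm_cart])
        qed
        show "(\<lambda>x. gradient (\<lambda>x. q x * v x $ i) x $ i) \<in> borel_measurable (lebesgue_on (Omega D))"
          using borel_measurable_inner[OF m borel_measurable_const, of "axis i 1"] by (simp add: inner_axis)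
      qed
    qed
    then show "(LINT x|lebesgue_on (Omega D). (\<Sum>i\<in>UNIV. gradient (\<lambda>x. q x * v x $ i) x $ i)) = 0"
      by (simp add: Bochner_Integration.integral_sum 0)
  qed
next
  case (Walls \<Gamma>1 \<Gamma>2)
  have Th: "finite (elements D)" "\<And>K. K \<in> elements D \<Longrightarrow> polytope K" "Omega D = interior (\<Union>(elements D))"
    and fr: "frontier (Omega D) = \<Gamma>1 \<union> \<Gamma>2"
    using D Walls by (auto simp: discretization_ok_def conforming_partition_def element_def)
  obtain P where P: "arrangement P" "\<And>K. K \<in> elements D \<Longrightarrow> frontier K \<subseteq> \<Union>(hyp ` P)"
    and pw: "\<And>f k. continuous_field D f \<Longrightarrow> (\<And>K. K \<in> elements D \<Longrightarrow> polynomial_on k K f) \<Longrightarrow>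
      piecewise_C1 (Omega D) (\<Union>(hyp ` P)) f"
    using walls_skeleton[OF D Walls] by blast
  have V: "piecewise_C1 (Omega D) (\<Union>(hyp ` P)) q" if "q \<in> V_h D" for q
    by (rule pw[of q 1]) (use that in \<open>simp_all add: V_h_def\<close>)
  have X: "piecewise_C1 (Omega D) (\<Union>(hyp ` P)) (\<lambda>x. v x $ i)" if "v \<in> X_h D" for v i
    by (rule pw[of _ 2]) (use that in \<open>simp_all add: X_h_def continuous_field_nth\<close>)
  show ?thesis
  proof (rule that[OF arrangement_negligible[OF P(1)] V X])
    fix q v assume q: "q \<in> V_h D" and v: "v \<in> X_h D"
    have cq: "continuous_on (closure (Omega D)) q" using q Walls by (simp add: V_h_def continuous_field_def)
    have cv: "continuous_on (closure (Omega D)) v" using v Walls by (simp add: X_h_def continuous_field_def)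
    \<comment> \<open>The product with \<open>q\<close> inherits both conditions, whatever the
      values of \<open>q\<close> on the walls.\<close>
    have bc: "\<And>x. x \<in> \<Gamma>1 \<Longrightarrow> v x = 0" "\<And>x n. x \<in> \<Gamma>2 \<Longrightarrow> outward_normal (Omega D) x n \<Longrightarrow> v x \<bullet> n = 0"
      using v Walls by (auto simp: X_h_def)
    have "(LINT x|lebesgue_on (Omega D). (\<Sum>i\<in>UNIV. gradient (\<lambda>x. (q x *\<^sub>R v x) $ i) x $ i)) = 0"
    proof (rule walls_integral_divergence[OF Th(1,2) P Th(3) _ fr])
      show "continuous_on (closure (Omega D)) (\<lambda>x. q x *\<^sub>R v x)" by (intro continuous_intros cq cv)
      show "piecewise_C1 (Omega D) (\<Union>(hyp ` P)) (\<lambda>x. (q x *\<^sub>R v x) $ i)" for i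
        using piecewise_C1_mult[OF V[OF q] X[OF v]] by simp
    qed (simp_all add: bc)
    then show "(LINT x|lebesgue_on (Omega D). (\<Sum>i\<in>UNIV. gradient (\<lambda>x. q x * v x $ i) x $ i)) = 0"
      by simp
  qed
qed

section \<open>Essentially bounded functions and the energy density\<close>

text \<open>Unlike square integrability, this property is preserved by products, so integrands of
  any degree can be handled by introduction rules. On a domain of finite measure it implies
  integrability.\<close>

definition essentially_bounded :: "(real^'d) set \<Rightarrow> (real^'d \<Rightarrow> 'b::euclidean_space) \<Rightarrow> bool" where
  "essentially_bounded S f \<longleftrightarrow>
     f \<in> borel_measurable (lebesgue_on S) \<and> (\<exists>B. AE x in lebesgue_on S. norm (f x) \<le> B)"

lemma essentially_boundedI:
  "f \<in> borel_measurable (lebesgue_on S) \<Longrightarrow> (AE x in lebesgue_on S. norm (f x) \<le> B) \<Longrightarrow> essentially_bounded S f"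
  unfolding essentially_bounded_def by blast

lemma essentially_boundedE:
  assumes "essentially_bounded S f"
  obtains B where "f \<in> borel_measurable (lebesgue_on S)" "AE x in lebesgue_on S. norm (f x) \<le> B" "0 \<le> B"
proof -
  obtain B where B: "f \<in> borel_measurable (lebesgue_on S)" "AE x in lebesgue_on S. norm (f x) \<le> B"
    using assms unfolding essentially_bounded_def by blast
  show ?thesis
  proof (rule that[OF B(1)])
    show "AE x in lebesgue_on S. norm (f x) \<le> max B 0" using B(2) by eventually_elim simp
  qed simp
qed

lemma essentially_bounded_integrable:
  assumes "essentially_bounded S f" "S \<in> lmeasurable" shows "integrable (lebesgue_on S) f"
  using assms unfolding essentially_bounded_def
  by (blast intro: finite_measure.integrable_const_bound[OF finite_measure_lebesgue_on])

lemma essentially_bounded_const: "essentially_bounded S (\<lambda>x. c)"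
  by (rule essentially_boundedI[of _ _ "norm c"]) auto

lemma essentially_bounded_add:
  assumes "essentially_bounded S f" "essentially_bounded S g" shows "essentially_bounded S (\<lambda>x. f x + g x)"
proof -
  obtain A where A: "f \<in> borel_measurable (lebesgue_on S)" "AE x in lebesgue_on S. norm (f x) \<le> A"
    using essentially_boundedE[OF assms(1)] .
  obtain B where B: "g \<in> borel_measurable (lebesgue_on S)" "AE x in lebesgue_on S. norm (g x) \<le> B"
    using essentially_boundedE[OF assms(2)] .
  have "AE x in lebesgue_on S. norm (f x + g x) \<le> A + B"
    using A(2) B(2) by eventually_elim (rule norm_triangle_mono)
  then show ?thesis by (rule essentially_boundedI[OF borel_measurable_add[OF A(1) B(1)]])
qed

lemma essentially_bounded_scaleR:
  assumes "essentially_bounded S c" "essentially_bounded S f" shows "essentially_bounded S (\<lambda>x. c x *\<^sub>R f x)"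
proof -
  obtain A where A: "c \<in> borel_measurable (lebesgue_on S)" "AE x in lebesgue_on S. norm (c x) \<le> A" "0 \<le> A"
    using essentially_boundedE[OF assms(1)] .
  obtain B where B: "f \<in> borel_measurable (lebesgue_on S)" "AE x in lebesgue_on S. norm (f x) \<le> B" "0 \<le> B"
    using essentially_boundedE[OF assms(2)] .
  have "AE x in lebesgue_on S. norm (c x *\<^sub>R f x) \<le> A * B"
    using A(2) B(2) by eventually_elim (simp add: mult_mono A(3) B(3))
  then show ?thesis by (rule essentially_boundedI[OF borel_measurable_scaleR[OF A(1) B(1)]])
qed

lemma essentially_bounded_mult:
  fixes f g :: "real^'d \<Rightarrow> real"
  assumes "essentially_bounded S f" "essentially_bounded S g" shows "essentially_bounded S (\<lambda>x. f x * g x)"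
  using essentially_bounded_scaleR[OF assms] by simp

lemma essentially_bounded_diff:
  assumes "essentially_bounded S f" "essentially_bounded S g" shows "essentially_bounded S (\<lambda>x. f x - g x)"
  using essentially_bounded_add[OF assms(1) essentially_bounded_scaleR[OF essentially_bounded_const[of S "- 1 :: real"] assms(2)]]
  by simp

lemma essentially_bounded_divide_const:
  fixes f :: "real^'d \<Rightarrow> real"
  assumes "essentially_bounded S f" shows "essentially_bounded S (\<lambda>x. f x / c)"
  using essentially_bounded_mult[OF assms essentially_bounded_const[of S "1 / c"]] by simp

lemma essentially_bounded_inner:
  assumes "essentially_bounded S f" "essentially_bounded S g" shows "essentially_bounded S (\<lambda>x. f x \<bullet> g x)"
proof -
  obtain A where A: "f \<in> borel_measurable (lebesgue_on S)" "AE x in lebesgue_on S. norm (f x) \<le> A" "0 \<le> A"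
    using essentially_boundedE[OF assms(1)] .
  obtain B where B: "g \<in> borel_measurable (lebesgue_on S)" "AE x in lebesgue_on S. norm (g x) \<le> B" "0 \<le> B"
    using essentially_boundedE[OF assms(2)] .
  have "AE x in lebesgue_on S. norm (f x \<bullet> g x) \<le> A * B"
    using A(2) B(2)
  proof eventually_elim
    case (elim x)
    have "norm (f x) * norm (g x) \<le> A * B" using elim by (intro mult_mono A(3)) auto
    then show ?case using Cauchy_Schwarz_ineq2[of "f x" "g x"] by simp
  qed
  then show ?thesis by (rule essentially_boundedI[OF borel_measurable_inner[OF A(1) B(1)]])
qed

lemma essentially_bounded_sum:
  "(\<And>i. i \<in> I \<Longrightarrow> essentially_bounded S (f i)) \<Longrightarrow> essentially_bounded S (\<lambda>x. \<Sum>i\<in>I. f i x)"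
  by (induction I rule: infinite_finite_induct) (simp_all add: essentially_bounded_const essentially_bounded_add)

lemma essentially_bounded_compose:
  fixes f :: "real^'d \<Rightarrow> real"
  assumes "essentially_bounded S f" and h: "continuous_on UNIV h" shows "essentially_bounded S (\<lambda>x. h (f x) :: real)"
proof -
  obtain A where A: "f \<in> borel_measurable (lebesgue_on S)" "AE x in lebesgue_on S. norm (f x) \<le> A"
    using essentially_boundedE[OF assms(1)] .
  have "bounded (h ` {-A..A})"
    using h by (intro compact_imp_bounded compact_continuous_image) (auto intro: continuous_on_subset)
  then obtain B where "\<forall>y\<in>h ` {-A..A}. norm y \<le> B" unfolding bounded_iff by blast
  then have B: "\<bar>h r\<bar> \<le> B" if "r \<in> {-A..A}" for r using that by simp
  have "AE x in lebesgue_on S. norm (h (f x)) \<le> B"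
    using A(2)
  proof eventually_elim
    case (elim x)
    then show ?case using B[of "f x"] by (simp add: abs_le_iff)
  qed
  moreover have "(\<lambda>x. h (f x)) \<in> borel_measurable (lebesgue_on S)"
    using measurable_compose[OF A(1) borel_measurable_continuous_onI[OF h]] .
  ultimately show ?thesis by (intro essentially_boundedI)
qed

lemma essentially_bounded_cong:
  assumes "essentially_bounded S g" "negligible N" "S \<in> sets lebesgue" "\<And>x. x \<in> S \<Longrightarrow> x \<notin> N \<Longrightarrow> f x = g x"
  shows "essentially_bounded S f"
proof -
  obtain B where B: "g \<in> borel_measurable (lebesgue_on S)" "AE x in lebesgue_on S. norm (g x) \<le> B"
    using essentially_boundedE[OF assms(1)] .
  have "g \<in> borel_measurable (lebesgue_on (S - N))"
    by (rule measurable_restrict_mono[OF B(1)]) auto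
  then have "f \<in> borel_measurable (lebesgue_on (S - N))"
    using assms(4) by (subst measurable_cong[where g = g]) auto
  then have "f \<in> borel_measurable (lebesgue_on S)"
    by (rule measurable_lebesgue_on_diff_negligible[OF _ assms(2,3)])
  moreover have "AE x in lebesgue_on S. norm (f x) \<le> B"
    using B(2) AE_lebesgue_on_notin[OF assms(2,3)] AE_space[of "lebesgue_on S"]
    by eventually_elim (simp add: assms(4))
  ultimately show ?thesis by (rule essentially_boundedI)
qed

lemma essentially_bounded_integral_cong:
  assumes "essentially_bounded S g" "S \<in> lmeasurable" "negligible N" "\<And>x. x \<in> S \<Longrightarrow> x \<notin> N \<Longrightarrow> f x = g x"
  shows "integral\<^sup>L (lebesgue_on S) f = integral\<^sup>L (lebesgue_on S) g"
  using integrable_cong_negligible(2)[OF essentially_bounded_integrable[OF assms(1,2)] assms(3) fmeasurableD[OF assms(2)]]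
    assms(4) by blast

lemma essentially_bounded_integral_mono:
  fixes f g :: "real^'d \<Rightarrow> real"
  assumes "essentially_bounded S f" "essentially_bounded S g" "S \<in> lmeasurable" "negligible N"
    "\<And>x. x \<in> S \<Longrightarrow> x \<notin> N \<Longrightarrow> f x \<le> g x"
  shows "integral\<^sup>L (lebesgue_on S) f \<le> integral\<^sup>L (lebesgue_on S) g"
proof (rule integral_mono_AE)
  show "AE x in lebesgue_on S. f x \<le> g x"
    using AE_lebesgue_on_notin[OF assms(4) fmeasurableD[OF assms(3)]] AE_space[of "lebesgue_on S"]
    by eventually_elim (simp add: assms(5))
qed (use assms in \<open>auto intro: essentially_bounded_integrable\<close>)

lemma piecewise_C1_essentially_bounded:
  assumes "piecewise_C1 U N f" "open U" shows "essentially_bounded U f"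
proof -
  obtain B where "\<forall>x\<in>U. \<bar>f x\<bar> \<le> B" using assms(1) unfolding piecewise_C1_def by blast
  then show ?thesis
    by (intro essentially_boundedI[OF piecewise_C1_measurable[OF assms], of B] AE_I2) simp
qed

lemma piecewise_C1_gradient_essentially_bounded:
  assumes f: "piecewise_C1 U N f" and U: "open U" and N: "negligible N"
  shows "essentially_bounded U (gradient f)"
proof -
  obtain B where B: "\<forall>x\<in>U - N. norm (gradient f x) \<le> B" using f unfolding piecewise_C1_def by blast
  have "U \<in> sets lebesgue" using U by simp
  from AE_lebesgue_on_notin[OF N this] AE_space[of "lebesgue_on U"]
  have "AE x in lebesgue_on U. norm (gradient f x) \<le> B" by eventually_elim (simp add: B)
  then show ?thesis by (rule essentially_boundedI[OF piecewise_C1_gradient_measurable[OF assms]])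
qed

lemma essentially_bounded_vec:
  fixes v :: "real^'d \<Rightarrow> real^'d"
  assumes "\<And>i. essentially_bounded S (\<lambda>x. v x $ i)" shows "essentially_bounded S v"
proof -
  have "essentially_bounded S (\<lambda>x. \<Sum>i\<in>UNIV. (v x $ i) *\<^sub>R (axis i 1 :: real^'d))"
    by (intro essentially_bounded_sum essentially_bounded_scaleR assms essentially_bounded_const)
  moreover have "(\<Sum>i\<in>UNIV. (v x $ i) *\<^sub>R (axis i 1 :: real^'d)) = v x" for x
    using basis_expansion[of "v x"] by (simp only: scalar_mult_eq_scaleR)
  ultimately show ?thesis by (simp only:)
qed

lemma essentially_bounded_nth:
  fixes v :: "real^'d \<Rightarrow> real^'d"
  assumes "essentially_bounded S v" shows "essentially_bounded S (\<lambda>x. v x $ i)"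
  using essentially_bounded_inner[OF assms essentially_bounded_const[of S "axis i 1"]] by (simp add: inner_axis)

text \<open>The divided difference, completed by the derivative on the diagonal. It is the mean of
  \<open>F'\<close> over the segment between the two values and serves as the closed form of the
  time average.\<close>

definition slope :: "(real \<Rightarrow> real) \<Rightarrow> (real \<Rightarrow> real) \<Rightarrow> real \<Rightarrow> real \<Rightarrow> real" where
  "slope F F' s\<^sub>0 s\<^sub>1 = (if s\<^sub>0 = s\<^sub>1 then F' s\<^sub>0 else (F s\<^sub>1 - F s\<^sub>0) / (s\<^sub>1 - s\<^sub>0))"

lemma slope_mult: "slope F F' s\<^sub>0 s\<^sub>1 * (s\<^sub>1 - s\<^sub>0) = F s\<^sub>1 - F s\<^sub>0"
  by (simp add: slope_def)

lemma slope_bound: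
  assumes F: "\<And>s. (F has_real_derivative F' s) (at s)" and M: "\<And>s. s \<in> {-A..A} \<Longrightarrow> \<bar>F' s\<bar> \<le> M"
    and s: "\<bar>s\<^sub>0\<bar> \<le> A" "\<bar>s\<^sub>1\<bar> \<le> A"
  shows "\<bar>slope F F' s\<^sub>0 s\<^sub>1\<bar> \<le> M"
proof (cases "s\<^sub>0 = s\<^sub>1")
  case True
  then show ?thesis using M[of s\<^sub>0] s by (simp add: slope_def abs_le_iff)
next
  case False
  have "0 \<le> M" using M[of s\<^sub>0] s by (simp add: abs_le_iff)
  have le: "\<bar>F r - F q\<bar> \<le> M * (r - q)" if "q < r" "\<bar>q\<bar> \<le> A" "\<bar>r\<bar> \<le> A" for q r
  proof (rule abs_diff_le_of_derivative_bound[where A = "{}" and f' = F'])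
    show "continuous_on {q..r} F"
      using F by (meson DERIV_isCont continuous_at_imp_continuous_on)
  qed (use that F M \<open>0 \<le> M\<close> in \<open>auto simp: abs_le_iff\<close>)
  have "\<bar>F s\<^sub>1 - F s\<^sub>0\<bar> \<le> M * \<bar>s\<^sub>1 - s\<^sub>0\<bar>"
    using le[of s\<^sub>0 s\<^sub>1] le[of s\<^sub>1 s\<^sub>0] s False by (cases "s\<^sub>0 < s\<^sub>1") (simp_all add: abs_minus_commute)
  then show ?thesis using False by (simp add: slope_def abs_divide divide_le_eq)
qed

text \<open>Measurability in space can be read off the closed form of the time average. The bound is
  the maximum of \<open>F'\<close> over the common range of both functions.\<close>

lemma essentially_bounded_slope:
  fixes p q :: "real^'d \<Rightarrow> real"
  assumes F: "\<And>s. (F has_real_derivative F' s) (at s)" and F': "continuous_on UNIV F'"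
    and p: "essentially_bounded S p" and q: "essentially_bounded S q"
  shows "essentially_bounded S (\<lambda>x. slope F F' (p x) (q x))"
proof -
  obtain A where A: "p \<in> borel_measurable (lebesgue_on S)" "AE x in lebesgue_on S. norm (p x) \<le> A"
    using essentially_boundedE[OF p] .
  obtain B where B: "q \<in> borel_measurable (lebesgue_on S)" "AE x in lebesgue_on S. norm (q x) \<le> B"
    using essentially_boundedE[OF q] .
  have "continuous_on UNIV F" using F by (meson DERIV_isCont continuous_at_imp_continuous_on)
  then have Fm: "F \<in> borel_measurable borel" by (rule borel_measurable_continuous_onI)
  have F'm: "F' \<in> borel_measurable borel" using F' by (rule borel_measurable_continuous_onI)
  have "bounded (F' ` {- max A B..max A B})"
    using F' by (intro compact_imp_bounded compact_continuous_image) (auto intro: continuous_on_subset)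
  then obtain M where "\<forall>y\<in>F' ` {- max A B..max A B}. norm y \<le> M" unfolding bounded_iff by blast
  then have M: "\<bar>F' r\<bar> \<le> M" if "r \<in> {- max A B..max A B}" for r using that by simp
  have "AE x in lebesgue_on S. norm (slope F F' (p x) (q x)) \<le> M"
    using A(2) B(2)
  proof eventually_elim
    case (elim x)
    show ?case unfolding real_norm_def
    proof (rule slope_bound[OF F, where A = "max A B"])
      show "\<bar>F' s\<bar> \<le> M" if "s \<in> {- max A B..max A B}" for s by (rule M[OF that])
    qed (use elim in \<open>simp_all add: le_max_iff_disj\<close>)
  qed
  moreover have "(\<lambda>x. slope F F' (p x) (q x)) \<in> borel_measurable (lebesgue_on S)"
    unfolding slope_def using A(1) B(1) Fm F'm by measurable
  ultimately show ?thesis by (intro essentially_boundedI)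
qed

text \<open>Along the linear path the integrand has an antiderivative, a multiple of
  \<open>F\<close> composed with the path; a constant path gives the diagonal value.\<close>

lemma average_eq_slope:
  assumes F: "\<And>s. (F has_real_derivative F' s) (at s)" and ab: "a < b"
  shows "((\<lambda>r. F' (s\<^sub>1 + (s\<^sub>1 - s\<^sub>0) * ((r - b) / (b - a)))) has_integral (b - a) * slope F F' s\<^sub>0 s\<^sub>1) {a..b}"
proof (cases "s\<^sub>0 = s\<^sub>1")
  case True
  then show ?thesis using has_integral_const_real[of "F' s\<^sub>0" a b] ab by (simp add: slope_def)
next
  case False
  define y where "y r = s\<^sub>1 + (s\<^sub>1 - s\<^sub>0) * ((r - b) / (b - a))" for r
  \<comment> \<open>The reciprocal of the speed of the path \<open>y\<close>.\<close>
  define c where "c = (b - a) / (s\<^sub>1 - s\<^sub>0)"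
  have "((\<lambda>r. F' (y r)) has_integral c * F (y b) - c * F (y a)) {a..b}"
  proof (rule fundamental_theorem_of_calculus)
    fix r assume "r \<in> {a..b}"
    have "(y has_real_derivative (s\<^sub>1 - s\<^sub>0) / (b - a)) (at r)"
    proof -
      have "((\<lambda>r. (r - b) / (b - a)) has_real_derivative 1 / (b - a)) (at r)"
        by (rule DERIV_cdivide) (auto intro!: derivative_eq_intros)
      from DERIV_add[OF DERIV_const[of "s\<^sub>1"] DERIV_cmult[OF this, of "s\<^sub>1 - s\<^sub>0"]]
      show ?thesis by (simp add: y_def[abs_def])
    qed
    from DERIV_cmult[OF DERIV_chain2[OF F this], of c]
    have "((\<lambda>r. c * F (y r)) has_real_derivative F' (y r)) (at r)"
      using ab False by (simp add: c_def)
    then show "((\<lambda>r. c * F (y r)) has_vector_derivative F' (y r)) (at r within {a..b})"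
      by (simp add: has_real_derivative_iff_has_vector_derivative has_vector_derivative_at_within)
  qed (use ab in simp)
  moreover have "(a - b) / (b - a) = - 1" using ab by (simp add: divide_eq_minus_1_iff)
  then have "y a = s\<^sub>0" "y b = s\<^sub>1" by (simp_all add: y_def)
  ultimately show ?thesis using False by (simp add: y_def[abs_def] slope_def c_def diff_divide_distrib[symmetric] right_diff_distrib[symmetric])
qed

text \<open>By symmetry of \<open>chi\<close> the two occurrences of the differentiated phase in the
  quadratic form contribute equally, hence the factor 2.\<close>

lemma dPsi0_eq:
  fixes P :: "('d, 'n::finite) physics"
  assumes F: "\<And>s. (slogs P has_real_derivative F' s) (at s)" and sym: "\<And>\<alpha> \<beta>. chi P \<alpha> \<beta> = chi P \<beta> \<alpha>"
  shows "dPsi0 P \<alpha> s = Wbar P / eps0 P * (F' (s \<alpha>) - 2 * (\<Sum>\<beta>\<in>UNIV. chi P \<alpha> \<beta> * s \<beta>))"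
proof -
  \<comment> \<open>The derivative of component \<gamma> of the updated tuple with respect to the
    new value.\<close>
  define k where "k \<gamma> = (if \<gamma> = \<alpha> then 1 else 0 :: real)" for \<gamma>
  have u: "((\<lambda>r. (s(\<alpha> := r)) \<gamma>) has_real_derivative k \<gamma>) (at (s \<alpha>))" for \<gamma>
    by (cases "\<gamma> = \<alpha>") (simp_all add: k_def)
  have 1: "((\<lambda>r. slogs P ((s(\<alpha> := r)) \<gamma>)) has_real_derivative F' (s \<gamma>) * k \<gamma>) (at (s \<alpha>))" for \<gamma>
    using DERIV_chain2[OF F u[of \<gamma>]] by simp
  have 2: "((\<lambda>r. chi P \<gamma> \<delta> * (s(\<alpha> := r)) \<gamma> * (s(\<alpha> := r)) \<delta>) has_real_derivative
      chi P \<gamma> \<delta> * k \<gamma> * s \<delta> + k \<delta> * (chi P \<gamma> \<delta> * s \<gamma>)) (at (s \<alpha>))" for \<gamma> \<delta>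
    using DERIV_mult[OF DERIV_cmult[OF u[of \<gamma>], of "chi P \<gamma> \<delta>"] u[of \<delta>]] by simp
  have "((\<lambda>r. Psi0 P (s(\<alpha> := r))) has_real_derivative Wbar P / eps0 P *
      ((\<Sum>\<gamma>\<in>UNIV. F' (s \<gamma>) * k \<gamma>) - (\<Sum>\<gamma>\<in>UNIV. \<Sum>\<delta>\<in>UNIV. chi P \<gamma> \<delta> * k \<gamma> * s \<delta> + k \<delta> * (chi P \<gamma> \<delta> * s \<gamma>))))
    (at (s \<alpha>))"
    unfolding Psi0_def by (intro DERIV_cmult DERIV_diff DERIV_sum 1 2)
  then have "dPsi0 P \<alpha> s = Wbar P / eps0 P *
      ((\<Sum>\<gamma>\<in>UNIV. F' (s \<gamma>) * k \<gamma>) - (\<Sum>\<gamma>\<in>UNIV. \<Sum>\<delta>\<in>UNIV. chi P \<gamma> \<delta> * k \<gamma> * s \<delta> + k \<delta> * (chi P \<gamma> \<delta> * s \<gamma>)))"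
    unfolding dPsi0_def by (rule DERIV_imp_deriv)
  also have "(\<Sum>\<gamma>\<in>UNIV. F' (s \<gamma>) * k \<gamma>) = F' (s \<alpha>)"
    by (simp add: k_def if_distrib[of "\<lambda>c. _ * c"] cong: if_cong)
  also have "(\<Sum>\<gamma>\<in>UNIV. \<Sum>\<delta>\<in>UNIV. chi P \<gamma> \<delta> * k \<gamma> * s \<delta> + k \<delta> * (chi P \<gamma> \<delta> * s \<gamma>))
    = 2 * (\<Sum>\<beta>\<in>UNIV. chi P \<alpha> \<beta> * s \<beta>)"
  proof -
    have "(\<Sum>\<gamma>\<in>UNIV. \<Sum>\<delta>\<in>UNIV. chi P \<gamma> \<delta> * k \<gamma> * s \<delta>) = (\<Sum>\<gamma>\<in>UNIV. k \<gamma> * (\<Sum>\<delta>\<in>UNIV. chi P \<gamma> \<delta> * s \<delta>))"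
      by (simp add: sum_distrib_left ac_simps)
    also have "\<dots> = (\<Sum>\<beta>\<in>UNIV. chi P \<alpha> \<beta> * s \<beta>)"
      by (simp add: k_def if_distrib[of "\<lambda>c. c * _"] cong: if_cong)
    finally have a: "(\<Sum>\<gamma>\<in>UNIV. \<Sum>\<delta>\<in>UNIV. chi P \<gamma> \<delta> * k \<gamma> * s \<delta>) = (\<Sum>\<beta>\<in>UNIV. chi P \<alpha> \<beta> * s \<beta>)" .
    have "(\<Sum>\<delta>\<in>UNIV. k \<delta> * (chi P \<gamma> \<delta> * s \<gamma>)) = chi P \<alpha> \<gamma> * s \<gamma>" for \<gamma>
      by (simp add: k_def if_distrib[of "\<lambda>c. c * _"] sym[of \<gamma> \<alpha>] cong: if_cong)
    then show ?thesis using a by (simp add: sum.distrib)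
  qed
  finally show ?thesis .
qed

lemma dPsi0_avg_eq:
  fixes P :: "('d, 'n::finite) physics"
  assumes F: "\<And>s. (slogs P has_real_derivative F' s) (at s)" and sym: "\<And>\<alpha> \<beta>. chi P \<alpha> \<beta> = chi P \<beta> \<alpha>"
    and ab: "a < b"
  shows "dPsi0_avg P \<alpha> a b s\<^sub>0 s\<^sub>1 =
    Wbar P / eps0 P * (slope (slogs P) F' (s\<^sub>0 \<alpha>) (s\<^sub>1 \<alpha>) - (\<Sum>\<beta>\<in>UNIV. chi P \<alpha> \<beta> * (s\<^sub>0 \<beta> + s\<^sub>1 \<beta>)))"
proof -
  define y where "y \<beta> r = s\<^sub>1 \<beta> + (s\<^sub>1 \<beta> - s\<^sub>0 \<beta>) * ((r - b) / (b - a))" for \<beta> r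
  \<comment> \<open>The linear part of the integrand is averaged by the same lemma, with half the
    square as antiderivative; its mean is the midpoint.\<close>
  have half: "slope (\<lambda>s. s\<^sup>2 / 2) (\<lambda>s. s) p q = (p + q) / 2" for p q :: real
  proof (cases "p = q")
    case False
    have "q\<^sup>2 / 2 - p\<^sup>2 / 2 = (p + q) / 2 * (q - p)" by (simp add: power2_eq_square field_simps)
    then show ?thesis using False by (simp add: slope_def)
  qed (simp add: slope_def)
  have lin: "((\<lambda>r. y \<beta> r) has_integral (b - a) * ((s\<^sub>0 \<beta> + s\<^sub>1 \<beta>) / 2)) {a..b}" for \<beta>
  proof -
    have "((\<lambda>s. s\<^sup>2 / 2) has_real_derivative s) (at s)" for s :: real
      by (auto intro!: derivative_eq_intros)
    from average_eq_slope[OF this ab, of "s\<^sub>1 \<beta>" "s\<^sub>0 \<beta>"] show ?thesis unfolding half y_def .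
  qed
  have nonlin: "((\<lambda>r. F' (y \<alpha> r)) has_integral (b - a) * slope (slogs P) F' (s\<^sub>0 \<alpha>) (s\<^sub>1 \<alpha>)) {a..b}"
    unfolding y_def by (rule average_eq_slope[OF F ab])
  have "((\<lambda>r. Wbar P / eps0 P * (F' (y \<alpha> r) - 2 * (\<Sum>\<beta>\<in>UNIV. chi P \<alpha> \<beta> * y \<beta> r))) has_integral
    Wbar P / eps0 P * ((b - a) * slope (slogs P) F' (s\<^sub>0 \<alpha>) (s\<^sub>1 \<alpha>) -
      2 * (\<Sum>\<beta>\<in>UNIV. chi P \<alpha> \<beta> * ((b - a) * ((s\<^sub>0 \<beta> + s\<^sub>1 \<beta>) / 2))))) {a..b}"
    by (intro has_integral_mult_right has_integral_diff has_integral_sum nonlin lin finite)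
  then have "integral {a..b} (\<lambda>r. dPsi0 P \<alpha> (\<lambda>\<beta>. y \<beta> r)) =
    Wbar P / eps0 P * ((b - a) * slope (slogs P) F' (s\<^sub>0 \<alpha>) (s\<^sub>1 \<alpha>) -
      2 * (\<Sum>\<beta>\<in>UNIV. chi P \<alpha> \<beta> * ((b - a) * ((s\<^sub>0 \<beta> + s\<^sub>1 \<beta>) / 2))))"
    unfolding dPsi0_eq[OF F sym] by (rule integral_unique)
  also have "\<dots> = (b - a) * (Wbar P / eps0 P * (slope (slogs P) F' (s\<^sub>0 \<alpha>) (s\<^sub>1 \<alpha>) -
      (\<Sum>\<beta>\<in>UNIV. chi P \<alpha> \<beta> * (s\<^sub>0 \<beta> + s\<^sub>1 \<beta>))))"
    by (simp add: sum_distrib_left right_diff_distrib ac_simps)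
  finally show ?thesis using ab by (simp add: dPsi0_avg_def y_def)
qed

text \<open>A slope times the increment is the difference of the values. For the interaction energy
  the midpoint plays that role: in a symmetric quadratic form the mixed terms of old and new values
  cancel.\<close>

lemma sum_dPsi0_avg:
  fixes P :: "('d, 'n::finite) physics"
  assumes F: "\<And>s. (slogs P has_real_derivative F' s) (at s)" and sym: "\<And>\<alpha> \<beta>. chi P \<alpha> \<beta> = chi P \<beta> \<alpha>"
    and ab: "a < b"
  shows "(\<Sum>\<alpha>\<in>UNIV. dPsi0_avg P \<alpha> a b s\<^sub>0 s\<^sub>1 * (s\<^sub>1 \<alpha> - s\<^sub>0 \<alpha>)) = Psi0 P s\<^sub>1 - Psi0 P s\<^sub>0"
proof -
  let ?X = "\<lambda>p q. \<Sum>\<alpha>\<in>UNIV. \<Sum>\<beta>\<in>UNIV. chi P \<alpha> \<beta> * p \<alpha> * q \<beta>"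
  have swap: "?X s\<^sub>1 s\<^sub>0 = ?X s\<^sub>0 s\<^sub>1"
    by (subst sum.swap) (simp add: sym ac_simps)
  have "(\<Sum>\<beta>\<in>UNIV. chi P \<alpha> \<beta> * (s\<^sub>0 \<beta> + s\<^sub>1 \<beta>)) * (s\<^sub>1 \<alpha> - s\<^sub>0 \<alpha>) =
    (\<Sum>\<beta>\<in>UNIV. chi P \<alpha> \<beta> * s\<^sub>1 \<alpha> * s\<^sub>0 \<beta>) + (\<Sum>\<beta>\<in>UNIV. chi P \<alpha> \<beta> * s\<^sub>1 \<alpha> * s\<^sub>1 \<beta>) -
    (\<Sum>\<beta>\<in>UNIV. chi P \<alpha> \<beta> * s\<^sub>0 \<alpha> * s\<^sub>0 \<beta>) - (\<Sum>\<beta>\<in>UNIV. chi P \<alpha> \<beta> * s\<^sub>0 \<alpha> * s\<^sub>1 \<beta>)" for \<alpha>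
    unfolding sum_distrib_right sum.distrib[symmetric] sum_subtractf[symmetric]
    by (rule sum.cong) (simp_all add: algebra_simps)
  then have "(\<Sum>\<alpha>\<in>UNIV. (\<Sum>\<beta>\<in>UNIV. chi P \<alpha> \<beta> * (s\<^sub>0 \<beta> + s\<^sub>1 \<beta>)) * (s\<^sub>1 \<alpha> - s\<^sub>0 \<alpha>))
    = ?X s\<^sub>1 s\<^sub>0 + ?X s\<^sub>1 s\<^sub>1 - ?X s\<^sub>0 s\<^sub>0 - ?X s\<^sub>0 s\<^sub>1"
    by (simp only: sum.distrib sum_subtractf)
  then have q: "(\<Sum>\<alpha>\<in>UNIV. (\<Sum>\<beta>\<in>UNIV. chi P \<alpha> \<beta> * (s\<^sub>0 \<beta> + s\<^sub>1 \<beta>)) * (s\<^sub>1 \<alpha> - s\<^sub>0 \<alpha>)) = ?X s\<^sub>1 s\<^sub>1 - ?X s\<^sub>0 s\<^sub>0"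
    using swap by simp
  have "(\<Sum>\<alpha>\<in>UNIV. dPsi0_avg P \<alpha> a b s\<^sub>0 s\<^sub>1 * (s\<^sub>1 \<alpha> - s\<^sub>0 \<alpha>)) =
    (\<Sum>\<alpha>\<in>UNIV. Wbar P / eps0 P * ((slogs P (s\<^sub>1 \<alpha>) - slogs P (s\<^sub>0 \<alpha>)) -
      (\<Sum>\<beta>\<in>UNIV. chi P \<alpha> \<beta> * (s\<^sub>0 \<beta> + s\<^sub>1 \<beta>)) * (s\<^sub>1 \<alpha> - s\<^sub>0 \<alpha>)))"
    unfolding dPsi0_avg_eq[OF assms] slope_mult[of "slogs P" F', symmetric]
    by (intro sum.cong refl) (simp only: mult.assoc left_diff_distrib)
  also have "\<dots> = Wbar P / eps0 P * ((\<Sum>\<alpha>\<in>UNIV. slogs P (s\<^sub>1 \<alpha>)) - (\<Sum>\<alpha>\<in>UNIV. slogs P (s\<^sub>0 \<alpha>)) - (?X s\<^sub>1 s\<^sub>1 - ?X s\<^sub>0 s\<^sub>0))"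
    unfolding q[symmetric] by (simp only: sum_distrib_left[symmetric] sum_subtractf)
  also have "\<dots> = Psi0 P s\<^sub>1 - Psi0 P s\<^sub>0"
    unfolding Psi0_def right_diff_distrib[symmetric] by (rule arg_cong[where f = "(*) _"]) simp
  finally show ?thesis .
qed

text \<open>The diagonal entry balances its row by definition; symmetry of the coefficients carries
  this over to the column.\<close>

lemma mobility_reg_column_sum:
  fixes P :: "('d, 'n::finite) physics"
  assumes "\<And>\<alpha> \<beta>. mob P \<alpha> \<beta> = mob P \<beta> \<alpha>"
  shows "(\<Sum>\<alpha>\<in>UNIV. mobility_reg P s \<alpha> \<beta>) = 0"
proof -
  have "(\<Sum>\<alpha>\<in>UNIV. mobility_reg P s \<alpha> \<beta>) = mobility_reg P s \<beta> \<beta> + (\<Sum>\<alpha>\<in>UNIV - {\<beta>}. mobility_reg P s \<alpha> \<beta>)"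
    by (rule sum.remove) auto
  also have "(\<Sum>\<alpha>\<in>UNIV - {\<beta>}. mobility_reg P s \<alpha> \<beta>)
    = (\<Sum>\<alpha>\<in>UNIV - {\<beta>}. - (truncate P (s \<beta>) * (mob P \<beta> \<alpha> * truncate P (s \<alpha>))))"
    by (rule sum.cong) (auto simp: mobility_reg_def assms[of _ \<beta>])
  also have "mobility_reg P s \<beta> \<beta> = (\<Sum>\<alpha>\<in>UNIV - {\<beta>}. truncate P (s \<beta>) * (mob P \<beta> \<alpha> * truncate P (s \<alpha>)))"
    by (simp add: mobility_reg_def sum_distrib_left)
  finally show ?thesis by (simp add: sum_negf)
qed

text \<open>The capillarity matrix is semi-definite on scalars; it is applied to each spatial
  component of the gradients separately.\<close>

lemma Psi_grad_nonneg:
  fixes p :: "'n::finite \<Rightarrow> real^'d"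
  assumes "0 < eps0 P" "\<And>z. 0 \<le> (\<Sum>\<alpha>\<in>UNIV. \<Sum>\<beta>\<in>UNIV. cap P \<alpha> \<beta> * z \<alpha> * z \<beta>)"
  shows "0 \<le> Psi_grad P p"
proof -
  have "(\<Sum>\<alpha>\<in>UNIV. \<Sum>\<beta>\<in>UNIV. cap P \<alpha> \<beta> * (p \<alpha> \<bullet> p \<beta>))
    = (\<Sum>\<alpha>\<in>UNIV. \<Sum>\<beta>\<in>UNIV. \<Sum>i\<in>UNIV. cap P \<alpha> \<beta> * p \<alpha> $ i * p \<beta> $ i)"
    by (simp add: inner_vec_def sum_distrib_left mult.assoc)
  also have "\<dots> = (\<Sum>\<alpha>\<in>UNIV. \<Sum>i\<in>UNIV. \<Sum>\<beta>\<in>UNIV. cap P \<alpha> \<beta> * p \<alpha> $ i * p \<beta> $ i)"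
    by (intro sum.cong refl sum.swap)
  also have "\<dots> = (\<Sum>i\<in>UNIV. \<Sum>\<alpha>\<in>UNIV. \<Sum>\<beta>\<in>UNIV. cap P \<alpha> \<beta> * p \<alpha> $ i * p \<beta> $ i)"
    by (rule sum.swap)
  also have "\<dots> \<ge> 0" by (intro sum_nonneg assms(2))
  finally show ?thesis using assms(1) by (simp add: Psi_grad_def)
qed

text \<open>The right side exceeds the left by \<open>Psi_grad\<close> of the difference
  \<open>q - p\<close>, which is nonnegative.\<close>

lemma Psi_grad_convex:
  fixes p q :: "'n::finite \<Rightarrow> real^'d"
  assumes "0 < eps0 P" "\<And>z. 0 \<le> (\<Sum>\<alpha>\<in>UNIV. \<Sum>\<beta>\<in>UNIV. cap P \<alpha> \<beta> * z \<alpha> * z \<beta>)"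
    and sym: "\<And>\<alpha> \<beta>. cap P \<alpha> \<beta> = cap P \<beta> \<alpha>"
  shows "Psi_grad P q - Psi_grad P p \<le> (\<Sum>\<alpha>\<in>UNIV. dPsi_grad P \<alpha> q \<bullet> (q \<alpha> - p \<alpha>))"
proof -
  let ?X = "\<lambda>p q :: 'n \<Rightarrow> real^'d. \<Sum>\<alpha>\<in>UNIV. \<Sum>\<beta>\<in>UNIV. cap P \<alpha> \<beta> * (p \<alpha> \<bullet> q \<beta>)"
  have swap: "?X p q = ?X q p"
    by (subst sum.swap) (simp add: sym inner_commute)
  have "?X (\<lambda>\<alpha>. q \<alpha> - p \<alpha>) (\<lambda>\<alpha>. q \<alpha> - p \<alpha>) = ?X q q - ?X q p - ?X p q + ?X p p"
    by (simp add: inner_diff_left inner_diff_right sum_subtractf[symmetric] sum.distrib[symmetric] algebra_simps)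
  moreover have "0 \<le> Psi_grad P (\<lambda>\<alpha>. q \<alpha> - p \<alpha>)" by (rule Psi_grad_nonneg[OF assms(1,2)])
  ultimately have "0 \<le> eps0 P / 2 * (?X q q - 2 * ?X q p + ?X p p)"
    using swap by (simp add: Psi_grad_def)
  moreover have "(\<Sum>\<alpha>\<in>UNIV. dPsi_grad P \<alpha> q \<bullet> (q \<alpha> - p \<alpha>)) = eps0 P * (?X q q - ?X q p)"
  proof -
    have "(\<Sum>\<alpha>\<in>UNIV. dPsi_grad P \<alpha> q \<bullet> (q \<alpha> - p \<alpha>)) = eps0 P * (?X q q - ?X p q)"
      unfolding dPsi_grad_def inner_scaleR_left inner_sum_left inner_diff_right right_diff_distrib sum_subtractf
        sum_distrib_left by (simp add: inner_commute)
    then show ?thesis using swap by simp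
  qed
  moreover have "eps0 P / 2 * (?X q q - 2 * ?X q p + ?X p p) =
    eps0 P * (?X q q - ?X q p) - (Psi_grad P q - Psi_grad P p)"
    by (simp add: Psi_grad_def algebra_simps)
  ultimately show ?thesis by linarith
qed

section \<open>One time step\<close>

text \<open>
  The step goes from time \<open>a\<close> to time \<open>b\<close>; \<open>\<phi>e\<close> are the phases in the mobility, \<open>u\<close> is the convecting
  field and \<open>St\<close> the viscous stress. The last two stay unspecified: convection drops out because it is
  skew, and the stress enters the dissipation unchanged.
\<close>

locale scheme_step =
  fixes D :: "('d::finite) discretization" and P :: "('d, 'n::finite) physics"
    and a b :: real
    and \<phi>0 \<phi>1 \<phi>e g :: "'n \<Rightarrow> real^'d \<Rightarrow> real" and v0 v1 u :: "real^'d \<Rightarrow> real^'d"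
    and lam :: "real^'d \<Rightarrow> real" and St :: "real^'d \<Rightarrow> real^'d^'d"
  assumes D: "discretization_ok D" and P: "physics_ok P" and ab: "a < b"
    and \<phi>0: "\<And>\<alpha>. \<phi>0 \<alpha> \<in> V_h D" and \<phi>1: "\<And>\<alpha>. \<phi>1 \<alpha> \<in> V_h D" and \<phi>e: "\<And>\<alpha>. \<phi>e \<alpha> \<in> V_h D"
    and g: "\<And>\<alpha>. g \<alpha> \<in> V_h D" and v0: "v0 \<in> X_h D" and v1: "v1 \<in> X_h D" and lam: "lam \<in> Q_h D"
    and momentum: "pairing (Omega D)
           (\<lambda>x. ((mixture_density_reg P (\<lambda>\<alpha>. \<phi>1 \<alpha> x) - mixture_density_reg P (\<lambda>\<alpha>. \<phi>0 \<alpha> x)) / (b - a)) *\<^sub>R ((1/2) *\<^sub>R v1 x)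
              + mixture_density_reg P (\<lambda>\<alpha>. \<phi>0 \<alpha> x) *\<^sub>R ((1/(b - a)) *\<^sub>R (v1 x - v0 x))) v1
         + convection (Omega D) u v1 v1
         + pairing (Omega D) St (vgradient v1)
         - pairing (Omega D) lam (divergence v1)
         + (\<Sum>\<alpha>\<in>UNIV. pairing (Omega D)
              (\<lambda>x. \<phi>0 \<alpha> x *\<^sub>R gradient (\<lambda>x. dens P \<alpha> * g \<alpha> x - lam x) x) v1)
         + pairing (Omega D) (\<lambda>x. (mixture_density P (\<lambda>\<alpha>. \<phi>0 \<alpha> x) * grav P) *\<^sub>R gradient (height P) x) v1
         = 0"
    and phase: "\<And>\<alpha> \<psi>. \<psi> \<in> V_h D \<Longrightarrow>
         pairing (Omega D) (\<lambda>x. (\<phi>1 \<alpha> x - \<phi>0 \<alpha> x) / (b - a)) \<psi>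
         - pairing (Omega D) (\<lambda>x. \<phi>0 \<alpha> x *\<^sub>R v1 x) (gradient \<psi>)
         + pairing (Omega D) (\<lambda>x. (1 / dens P \<alpha>) *\<^sub>R
             (\<Sum>\<beta>\<in>UNIV. mobility_reg P (\<lambda>\<gamma>. \<phi>e \<gamma> x) \<alpha> \<beta> *\<^sub>R gradient (g \<beta>) x)) (gradient \<psi>)
         = 0"
    and potential: "\<And>\<alpha> \<xi>. \<xi> \<in> V_h D \<Longrightarrow>
         pairing (Omega D) (\<lambda>x. dens P \<alpha> * g \<alpha> x) \<xi>
         - pairing (Omega D) (\<lambda>x. dPsi0_avg P \<alpha> a b (\<lambda>\<alpha>. \<phi>0 \<alpha> x) (\<lambda>\<alpha>. \<phi>1 \<alpha> x)) \<xi>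
         - pairing (Omega D) (\<lambda>x. dPsi_grad P \<alpha> (\<lambda>\<beta>. gradient (\<phi>1 \<beta>) x)) (gradient \<xi>)
         - pairing (Omega D) lam \<xi>
         = 0"
    and incompressible: "\<And>q. q \<in> Q_h D \<Longrightarrow>
         pairing (Omega D) (divergence v1) q
         + pairing (Omega D) (\<lambda>x. \<Sum>\<alpha>\<in>UNIV. \<Sum>\<beta>\<in>UNIV.
             (mobility_reg P (\<lambda>\<gamma>. \<phi>e \<gamma> x) \<alpha> \<beta> / dens P \<alpha>) *\<^sub>R gradient (g \<beta>) x) (gradient q)
         = 0"
begin

section \<open>Integrability of the integrands\<close>

abbreviation "\<Omega> \<equiv> Omega D"
abbreviation "\<tau> \<equiv> b - a"
abbreviation "Mob x \<equiv> mobility_reg P (\<lambda>\<gamma>. \<phi>e \<gamma> x)"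

text \<open>The existential statement of \<open>discretization_skeleton\<close> is turned into a
  constant by choice, so that all lemmas of the locale refer to the same null set.\<close>

definition N where "N = (SOME N. negligible N \<and>
    (\<forall>q\<in>V_h D. piecewise_C1 \<Omega> N q) \<and> (\<forall>v\<in>X_h D. \<forall>i. piecewise_C1 \<Omega> N (\<lambda>x. v x $ i)) \<and>
    (\<forall>q\<in>V_h D. \<forall>v\<in>X_h D. (LINT x|lebesgue_on \<Omega>. (\<Sum>i\<in>UNIV. gradient (\<lambda>x. q x * v x $ i) x $ i)) = 0))"

lemma N:
  shows N_negligible: "negligible N"
    and N_V: "q \<in> V_h D \<Longrightarrow> piecewise_C1 \<Omega> N q"
    and N_X: "v \<in> X_h D \<Longrightarrow> piecewise_C1 \<Omega> N (\<lambda>x. v x $ i)"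
    and N_div: "q \<in> V_h D \<Longrightarrow> v \<in> X_h D \<Longrightarrow>
      (LINT x|lebesgue_on \<Omega>. (\<Sum>i\<in>UNIV. gradient (\<lambda>x. q x * v x $ i) x $ i)) = 0"
proof -
  have "\<exists>N. negligible N \<and>
    (\<forall>q\<in>V_h D. piecewise_C1 \<Omega> N q) \<and> (\<forall>v\<in>X_h D. \<forall>i. piecewise_C1 \<Omega> N (\<lambda>x. v x $ i)) \<and>
    (\<forall>q\<in>V_h D. \<forall>v\<in>X_h D. (LINT x|lebesgue_on \<Omega>. (\<Sum>i\<in>UNIV. gradient (\<lambda>x. q x * v x $ i) x $ i)) = 0)"
    by (rule discretization_skeleton[OF D]) blast
  from someI_ex[OF this] show "negligible N" "q \<in> V_h D \<Longrightarrow> piecewise_C1 \<Omega> N q"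
    "v \<in> X_h D \<Longrightarrow> piecewise_C1 \<Omega> N (\<lambda>x. v x $ i)"
    "q \<in> V_h D \<Longrightarrow> v \<in> X_h D \<Longrightarrow>
      (LINT x|lebesgue_on \<Omega>. (\<Sum>i\<in>UNIV. gradient (\<lambda>x. q x * v x $ i) x $ i)) = 0"
    unfolding N_def[symmetric] by blast+
qed

lemma \<Omega>_open: "open \<Omega>" and \<Omega>_lm: "\<Omega> \<in> lmeasurable" and \<Omega>_sets: "\<Omega> \<in> sets lebesgue"
  using discretization_domain(1)[OF D] discretization_lmeasurable[OF D] fmeasurableD by auto

lemma lamV: "lam \<in> V_h D" using lam by (simp add: Q_h_def)

lemma V_gradient: "q \<in> V_h D \<Longrightarrow> x \<in> \<Omega> \<Longrightarrow> x \<notin> N \<Longrightarrow> has_gradient q (gradient q x) x"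
  by (rule piecewise_C1_has_gradient[OF N_V])

lemma V_eb: "q \<in> V_h D \<Longrightarrow> essentially_bounded \<Omega> q"
  by (rule piecewise_C1_essentially_bounded[OF N_V \<Omega>_open])

lemma V_grad_eb: "q \<in> V_h D \<Longrightarrow> essentially_bounded \<Omega> (gradient q)"
  by (rule piecewise_C1_gradient_essentially_bounded[OF N_V \<Omega>_open N_negligible])

lemma X_eb: "v \<in> X_h D \<Longrightarrow> essentially_bounded \<Omega> v"
  by (rule essentially_bounded_vec) (rule piecewise_C1_essentially_bounded[OF N_X \<Omega>_open])

lemma divergence_X:
  "v \<in> X_h D \<Longrightarrow> x \<in> \<Omega> \<Longrightarrow> x \<notin> N \<Longrightarrow> divergence v x = (\<Sum>i\<in>UNIV. gradient (\<lambda>x. v x $ i) x $ i)"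
  by (intro divergence_eqI piecewise_C1_has_gradient[OF N_X])

lemma div_eb: assumes "v \<in> X_h D" shows "essentially_bounded \<Omega> (divergence v)"
proof (rule essentially_bounded_cong[OF _ N_negligible \<Omega>_sets divergence_X[OF assms]])
  show "essentially_bounded \<Omega> (\<lambda>x. \<Sum>i\<in>UNIV. gradient (\<lambda>x. v x $ i) x $ i)"
    by (intro essentially_bounded_sum essentially_bounded_nth
        piecewise_C1_gradient_essentially_bounded[OF N_X[OF assms] \<Omega>_open N_negligible])
qed

text \<open>Built for \<open>intro\<close>: the rules take an integrand apart down to members of the
  finite element spaces, which the locale assumptions then recognise.\<close>

lemmas eb_intros = essentially_bounded_const essentially_bounded_add essentially_bounded_diff
  essentially_bounded_mult essentially_bounded_scaleR essentially_bounded_inner essentially_bounded_sum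
  essentially_bounded_divide_const V_eb V_grad_eb X_eb div_eb \<phi>0 \<phi>1 \<phi>e g v0 v1 lamV

lemma eb_integrable: "essentially_bounded \<Omega> f \<Longrightarrow> integrable (lebesgue_on \<Omega>) f"
  by (rule essentially_bounded_integrable[OF _ \<Omega>_lm])

lemma eb_truncate: "q \<in> V_h D \<Longrightarrow> essentially_bounded \<Omega> (\<lambda>x. truncate P (q x))"
  by (rule essentially_bounded_compose[OF V_eb]) (auto simp: truncate_def intro!: continuous_intros)

lemma eb_density: "(\<And>\<alpha>. f \<alpha> \<in> V_h D) \<Longrightarrow> essentially_bounded \<Omega> (\<lambda>x. mixture_density P (\<lambda>\<alpha>. f \<alpha> x))"
  unfolding mixture_density_def by (intro eb_intros)

lemma eb_density_reg: "(\<And>\<alpha>. f \<alpha> \<in> V_h D) \<Longrightarrow> essentially_bounded \<Omega> (\<lambda>x. mixture_density_reg P (\<lambda>\<alpha>. f \<alpha> x))"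
  unfolding mixture_density_reg_def by (intro eb_intros eb_truncate)

lemma eb_mob: "essentially_bounded \<Omega> (\<lambda>x. Mob x \<alpha> \<beta>)"
proof (cases "\<alpha> = \<beta>")
  case True
  then show ?thesis unfolding mobility_reg_def by (simp, intro eb_intros eb_truncate)
next
  case False
  then show ?thesis unfolding mobility_reg_def
    using essentially_bounded_mult[OF essentially_bounded_mult[OF essentially_bounded_const[of \<Omega> "- mob P \<alpha> \<beta>"]
      eb_truncate[OF \<phi>e[of \<alpha>]]] eb_truncate[OF \<phi>e[of \<beta>]]] by simp
qed

lemma dens_pos: "0 < dens P \<alpha>" and mob_sym: "mob P \<alpha> \<beta> = mob P \<beta> \<alpha>" and eps0: "0 < eps0 P"
  and cap_sym: "cap P \<alpha> \<beta> = cap P \<beta> \<alpha>" and chi_sym: "chi P \<alpha> \<beta> = chi P \<beta> \<alpha>"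
  and cap_psd: "0 \<le> (\<Sum>\<alpha>\<in>UNIV. \<Sum>\<beta>\<in>UNIV. cap P \<alpha> \<beta> * z \<alpha> * z \<beta>)"
  and reg: "polynomial_regularization (slogs P)" and cutoff: "0 < cutoff P" "cutoff P < 1"
  using P unfolding physics_ok_def by blast+

lemma density_reg_nonneg: "0 \<le> mixture_density_reg P s"
  unfolding mixture_density_reg_def truncate_def
  by (intro sum_nonneg mult_nonneg_nonneg) (use dens_pos cutoff in \<open>auto simp: less_imp_le\<close>)

lemma eb_Psi0:
  assumes "\<And>\<alpha>. f \<alpha> \<in> V_h D" shows "essentially_bounded \<Omega> (\<lambda>x. Psi0 P (\<lambda>\<alpha>. f \<alpha> x))"
proof -
  obtain F' where F': "\<And>s. (slogs P has_real_derivative F' s) (at s)"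
    using reg unfolding polynomial_regularization_def by blast
  then have c: "continuous_on UNIV (slogs P)" by (meson DERIV_isCont continuous_at_imp_continuous_on)
  show ?thesis unfolding Psi0_def
    by (intro eb_intros essentially_bounded_compose[OF V_eb c] assms)
qed

lemma eb_Psi_grad: "(\<And>\<alpha>. f \<alpha> \<in> V_h D) \<Longrightarrow> essentially_bounded \<Omega> (\<lambda>x. Psi_grad P (\<lambda>\<alpha>. gradient (f \<alpha>) x))"
  unfolding Psi_grad_def by (intro eb_intros)

lemma eb_dPsi_grad: "essentially_bounded \<Omega> (\<lambda>x. dPsi_grad P \<alpha> (\<lambda>\<beta>. gradient (\<phi>1 \<beta>) x))"
  unfolding dPsi_grad_def by (intro eb_intros)

text \<open>The closed form by \<open>slope\<close> replaces the integral over time, from which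
  measurability in space would be hard to see.\<close>

lemma eb_dPsi0_avg: "essentially_bounded \<Omega> (\<lambda>x. dPsi0_avg P \<alpha> a b (\<lambda>\<alpha>. \<phi>0 \<alpha> x) (\<lambda>\<alpha>. \<phi>1 \<alpha> x))"
proof -
  obtain F' where F': "continuous_on UNIV F'" "\<And>s. (slogs P has_real_derivative F' s) (at s)"
    using reg unfolding polynomial_regularization_def by blast
  show ?thesis unfolding dPsi0_avg_eq[OF F'(2) chi_sym ab]
    by (intro eb_intros essentially_bounded_slope[OF F'(2,1)])
qed

lemma eb_height: "essentially_bounded \<Omega> (height P)"
proof -
  have "piecewise_C1 \<Omega> N (\<lambda>x. x $ vert P)"
    by (rule C1_imp_piecewise_C1[OF C1_nth discretization_domain(2)[OF D]])
  from piecewise_C1_essentially_bounded[OF this \<Omega>_open] show ?thesis by (simp add: height_def[abs_def])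
qed

lemma gradient_height: "gradient (height P) x = axis (vert P) 1"
  unfolding height_def[abs_def] by (rule gradient_eqI[OF has_gradient_nth])

text \<open>The product rule for \<open>q\<close> times \<open>v\<close>, whose divergence
  integrates to zero; the boundary conditions come from \<open>v\<close> alone.\<close>

lemma integration_by_parts:
  assumes q: "q \<in> V_h D" and v: "v \<in> X_h D"
  shows "pairing \<Omega> v (gradient q) = - pairing \<Omega> (divergence v) q"
proof -
  have eb1: "essentially_bounded \<Omega> (\<lambda>x. v x \<bullet> gradient q x)" and eb2: "essentially_bounded \<Omega> (\<lambda>x. divergence v x * q x)"
    by (intro eb_intros q v)+
  have "0 = (LINT x|lebesgue_on \<Omega>. (\<Sum>i\<in>UNIV. gradient (\<lambda>x. q x * v x $ i) x $ i))"
    using N_div[OF q v] by simp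
  also have "\<dots> = (LINT x|lebesgue_on \<Omega>. v x \<bullet> gradient q x + divergence v x * q x)"
  proof (rule essentially_bounded_integral_cong[OF essentially_bounded_add[OF eb1 eb2] \<Omega>_lm N_negligible])
    fix x assume x: "x \<in> \<Omega>" "x \<notin> N"
    have "gradient (\<lambda>x. q x * v x $ i) x = q x *\<^sub>R gradient (\<lambda>x. v x $ i) x + v x $ i *\<^sub>R gradient q x" for i
      by (intro gradient_eqI has_gradient_mult V_gradient[OF q x] piecewise_C1_has_gradient[OF N_X[OF v] x])
    then show "(\<Sum>i\<in>UNIV. gradient (\<lambda>x. q x * v x $ i) x $ i) = v x \<bullet> gradient q x + divergence v x * q x"
      unfolding divergence_X[OF v x]
      by (simp add: sum.distrib inner_vec_def sum_distrib_left mult.commute[of _ "q x"])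
  qed
  also have "\<dots> = pairing \<Omega> v (gradient q) + pairing \<Omega> (divergence v) q"
    unfolding pairing_def inner_real_def
    by (rule Bochner_Integration.integral_add[OF eb_integrable[OF eb1] eb_integrable[OF eb2]])
  finally show ?thesis by simp
qed

lemma gradient_const_zero: "gradient (\<lambda>x. c) = (\<lambda>x. 0)"
  by (rule ext) (rule gradient_eqI[OF has_gradient_const])

text \<open>For the constant test function 1 both flux terms contain a zero gradient.\<close>

lemma phase_volume: "pairing \<Omega> (\<phi>1 \<alpha>) (\<lambda>_. 1) = pairing \<Omega> (\<phi>0 \<alpha>) (\<lambda>_. 1)"
proof -
  have "pairing \<Omega> (\<lambda>x. (\<phi>1 \<alpha> x - \<phi>0 \<alpha> x) / \<tau>) (\<lambda>_. 1) = 0"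
    using phase[OF V_h_const[OF D, of 1], of \<alpha>] by (simp add: gradient_const_zero pairing_def)
  then show ?thesis
    using ab eb_integrable[OF V_eb[OF \<phi>1[of \<alpha>]]] eb_integrable[OF V_eb[OF \<phi>0[of \<alpha>]]]
    by (simp add: pairing_def)
qed

definition "mobility_flux \<alpha> x = (\<Sum>\<beta>\<in>UNIV. Mob x \<alpha> \<beta> *\<^sub>R gradient (g \<beta>) x)"

lemma eb_flux: "essentially_bounded \<Omega> (mobility_flux \<alpha>)"
  unfolding mobility_flux_def[abs_def] by (intro eb_intros eb_mob)

text \<open>Brings the constraint into the form in which the diffusive terms of the phase equations
  appear after summation over the phases.\<close>

lemma incompressible_flux:
  assumes "q \<in> Q_h D"
  shows "pairing \<Omega> (divergence v1) q +
    (LINT x|lebesgue_on \<Omega>. (\<Sum>\<alpha>\<in>UNIV. ((1 / dens P \<alpha>) *\<^sub>R mobility_flux \<alpha> x) \<bullet> gradient q x)) = 0"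
proof -
  have "(\<Sum>\<alpha>\<in>UNIV. \<Sum>\<beta>\<in>UNIV. (Mob x \<alpha> \<beta> / dens P \<alpha>) *\<^sub>R gradient (g \<beta>) x)
    = (\<Sum>\<alpha>\<in>UNIV. (1 / dens P \<alpha>) *\<^sub>R mobility_flux \<alpha> x)" for x
    by (simp add: mobility_flux_def scaleR_sum_right)
  then show ?thesis using incompressible[OF assms] by (simp add: pairing_def inner_sum_left)
qed

lemma sum_phases_preserved:
  assumes one: "\<And>x. x \<in> \<Omega> \<Longrightarrow> (\<Sum>\<alpha>\<in>UNIV. \<phi>0 \<alpha> x) = 1" and x: "x \<in> \<Omega>"
  shows "(\<Sum>\<alpha>\<in>UNIV. \<phi>1 \<alpha> x) = 1"
proof -
  define s where "s x = (\<Sum>\<alpha>\<in>UNIV. \<phi>1 \<alpha> x) - (\<Sum>\<alpha>\<in>UNIV. \<phi>0 \<alpha> x)" for x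
  have sV: "s \<in> V_h D"
    unfolding s_def[abs_def] by (intro V_h_diff V_h_sum D \<phi>0 \<phi>1)
  \<comment> \<open>The constraint can be tested only with functions of mean zero; conservation of
    the phase volumes makes \<open>s\<close> one of them.\<close>
  have mean: "pairing \<Omega> s (\<lambda>_. 1) = 0"
  proof -
    have "pairing \<Omega> s (\<lambda>_. 1) = (\<Sum>\<alpha>\<in>UNIV. pairing \<Omega> (\<phi>1 \<alpha>) (\<lambda>_. 1)) - (\<Sum>\<alpha>\<in>UNIV. pairing \<Omega> (\<phi>0 \<alpha>) (\<lambda>_. 1))"
      unfolding pairing_def s_def
      using eb_integrable[OF V_eb[OF \<phi>1]] eb_integrable[OF V_eb[OF \<phi>0]]
      by (simp add: Bochner_Integration.integral_sum)
    then show ?thesis by (simp add: phase_volume)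
  qed
  then have sQ: "s \<in> Q_h D" using sV by (simp add: Q_h_def)
  define A where "A \<alpha> x = (\<phi>1 \<alpha> x - \<phi>0 \<alpha> x) / \<tau> * s x" for \<alpha> x
  \<comment> \<open>As the old phases sum to one, these terms add up to the inner product of
    \<open>v1\<close> with the gradient of \<open>s\<close>.\<close>
  define B where "B \<alpha> x = \<phi>0 \<alpha> x *\<^sub>R v1 x \<bullet> gradient s x" for \<alpha> x
  define C where "C \<alpha> x = ((1 / dens P \<alpha>) *\<^sub>R mobility_flux \<alpha> x) \<bullet> gradient s x" for \<alpha> x
  have eb: "essentially_bounded \<Omega> (A \<alpha>)" "essentially_bounded \<Omega> (B \<alpha>)" "essentially_bounded \<Omega> (C \<alpha>)" for \<alpha>
    unfolding A_def[abs_def] B_def[abs_def] C_def[abs_def] by (intro eb_intros eb_flux sV)+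
  note int = eb_integrable[OF eb(1)] eb_integrable[OF eb(2)] eb_integrable[OF eb(3)]
  have "(LINT x|lebesgue_on \<Omega>. A \<alpha> x) - (LINT x|lebesgue_on \<Omega>. B \<alpha> x) + (LINT x|lebesgue_on \<Omega>. C \<alpha> x) = 0" for \<alpha>
    using phase[OF sV, of \<alpha>] by (simp only: pairing_def inner_real_def A_def B_def C_def mobility_flux_def)
  then have "(\<Sum>\<alpha>\<in>UNIV. (LINT x|lebesgue_on \<Omega>. A \<alpha> x) - (LINT x|lebesgue_on \<Omega>. B \<alpha> x) + (LINT x|lebesgue_on \<Omega>. C \<alpha> x)) = 0"
    by simp
  then have "(LINT x|lebesgue_on \<Omega>. (\<Sum>\<alpha>\<in>UNIV. A \<alpha> x)) - (LINT x|lebesgue_on \<Omega>. (\<Sum>\<alpha>\<in>UNIV. B \<alpha> x))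
    + (LINT x|lebesgue_on \<Omega>. (\<Sum>\<alpha>\<in>UNIV. C \<alpha> x)) = 0"
    using int by (simp add: Bochner_Integration.integral_sum sum.distrib sum_subtractf)
  moreover have "(LINT x|lebesgue_on \<Omega>. (\<Sum>\<alpha>\<in>UNIV. A \<alpha> x)) = (LINT x|lebesgue_on \<Omega>. (s x)\<^sup>2) / \<tau>"
  proof -
    have "(\<Sum>\<alpha>\<in>UNIV. A \<alpha> x) = (s x)\<^sup>2 / \<tau>" for x
      unfolding A_def sum_distrib_right[symmetric] sum_divide_distrib[symmetric] sum_subtractf s_def
      by (simp add: power2_eq_square)
    then show ?thesis by simp
  qed
  moreover have "(LINT x|lebesgue_on \<Omega>. (\<Sum>\<alpha>\<in>UNIV. B \<alpha> x)) = - pairing \<Omega> (divergence v1) s"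
  proof -
    have "(LINT x|lebesgue_on \<Omega>. (\<Sum>\<alpha>\<in>UNIV. B \<alpha> x)) = pairing \<Omega> v1 (gradient s)"
      unfolding pairing_def
    proof (rule Bochner_Integration.integral_cong[OF refl])
      fix x assume "x \<in> space (lebesgue_on \<Omega>)"
      then show "(\<Sum>\<alpha>\<in>UNIV. B \<alpha> x) = v1 x \<bullet> gradient s x"
        using one[of x] by (simp add: B_def sum_distrib_right[symmetric])
    qed
    then show ?thesis using integration_by_parts[OF sV v1] by simp
  qed
  moreover have "pairing \<Omega> (divergence v1) s + (LINT x|lebesgue_on \<Omega>. (\<Sum>\<alpha>\<in>UNIV. C \<alpha> x)) = 0"
    unfolding C_def by (rule incompressible_flux[OF sQ])
  ultimately have "(LINT x|lebesgue_on \<Omega>. (s x)\<^sup>2) / \<tau> = 0" by linarith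
  then have s0: "(LINT x|lebesgue_on \<Omega>. (s x)\<^sup>2) = 0" using ab by simp
  have "integrable (lebesgue_on \<Omega>) (\<lambda>x. (s x)\<^sup>2)"
    unfolding power2_eq_square by (intro eb_integrable eb_intros sV)
  then have AE: "AE x in lebesgue_on \<Omega>. (s x)\<^sup>2 = 0"
    using s0 integral_nonneg_eq_0_iff_AE[of "lebesgue_on \<Omega>" "\<lambda>x. (s x)\<^sup>2"] by simp
  \<comment> \<open>So far \<open>s\<close> vanishes almost everywhere. By continuity the points
    where it does not vanish form an open set, and a nonempty open set is not negligible.\<close>
  have cont: "continuous_on \<Omega> s" by (rule piecewise_C1_continuous[OF N_V[OF sV]])
  have "s x = 0"
  proof (rule ccontr)
    assume "s x \<noteq> 0"
    have op: "open (\<Omega> \<inter> s -` (- {0}))"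
      by (rule continuous_open_preimage[OF cont \<Omega>_open]) (simp add: open_Compl)
    have "AE y in lebesgue. y \<in> \<Omega> \<longrightarrow> (s y)\<^sup>2 = 0"
      using AE \<Omega>_sets by (simp add: AE_restrict_space_iff)
    then have "AE y in lebesgue. y \<notin> \<Omega> \<inter> s -` (- {0})" by eventually_elim auto
    then have "\<Omega> \<inter> s -` (- {0}) \<in> null_sets lebesgue"
      using op by (subst (asm) AE_iff_null_sets[symmetric]) auto
    then have "negligible (\<Omega> \<inter> s -` (- {0}))" by (simp add: negligible_iff_null_sets)
    moreover have "x \<in> \<Omega> \<inter> s -` (- {0})" using x \<open>s x \<noteq> 0\<close> by simp
    ultimately show False using open_not_negligible[OF op] by blast
  qed
  then show ?thesis using one[OF x] by (simp add: s_def)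
qed

text \<open>Pointwise the two sides differ by the old regularized density times
  \<open>\<bar>v1 - v0\<bar>\<^sup>2 / (2 * \<tau>)\<close>, read with the Euclidean norm. This is
  nonnegative because truncation keeps that density nonnegative. Weighting the density increment
  with half of the new velocity makes the remaining terms an exact difference.\<close>

lemma integral_kinetic:
  "(1 / \<tau>) * ((LINT x|lebesgue_on \<Omega>. mixture_density_reg P (\<lambda>\<alpha>. \<phi>1 \<alpha> x) / 2 * (norm (v1 x))\<^sup>2)
      - (LINT x|lebesgue_on \<Omega>. mixture_density_reg P (\<lambda>\<alpha>. \<phi>0 \<alpha> x) / 2 * (norm (v0 x))\<^sup>2))
   \<le> pairing \<Omega> (\<lambda>x. ((mixture_density_reg P (\<lambda>\<alpha>. \<phi>1 \<alpha> x) - mixture_density_reg P (\<lambda>\<alpha>. \<phi>0 \<alpha> x)) / \<tau>) *\<^sub>R ((1/2) *\<^sub>R v1 x)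
              + mixture_density_reg P (\<lambda>\<alpha>. \<phi>0 \<alpha> x) *\<^sub>R ((1/\<tau>) *\<^sub>R (v1 x - v0 x))) v1"
proof -
  define r1 r0 where "r1 x = mixture_density_reg P (\<lambda>\<alpha>. \<phi>1 \<alpha> x)" and "r0 x = mixture_density_reg P (\<lambda>\<alpha>. \<phi>0 \<alpha> x)" for x
  have eb: "essentially_bounded \<Omega> r1" "essentially_bounded \<Omega> r0"
    unfolding r1_def[abs_def] r0_def[abs_def] by (intro eb_density_reg \<phi>0 \<phi>1)+
  have k: "essentially_bounded \<Omega> (\<lambda>x. r1 x / 2 * (norm (v1 x))\<^sup>2)" "essentially_bounded \<Omega> (\<lambda>x. r0 x / 2 * (norm (v0 x))\<^sup>2)"
    unfolding power2_norm_eq_inner by (intro eb_intros eb)+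
  have "(1 / \<tau>) * ((LINT x|lebesgue_on \<Omega>. r1 x / 2 * (norm (v1 x))\<^sup>2) - (LINT x|lebesgue_on \<Omega>. r0 x / 2 * (norm (v0 x))\<^sup>2))
    = (LINT x|lebesgue_on \<Omega>. (1 / \<tau>) * (r1 x / 2 * (norm (v1 x))\<^sup>2 - r0 x / 2 * (norm (v0 x))\<^sup>2))"
    unfolding Bochner_Integration.integral_mult_right_zero
      Bochner_Integration.integral_diff[OF eb_integrable[OF k(1)] eb_integrable[OF k(2)]] ..
  also have "\<dots> \<le> (LINT x|lebesgue_on \<Omega>. (((r1 x - r0 x) / \<tau>) *\<^sub>R ((1/2) *\<^sub>R v1 x) + r0 x *\<^sub>R ((1/\<tau>) *\<^sub>R (v1 x - v0 x))) \<bullet> v1 x)"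
  proof (rule essentially_bounded_integral_mono[OF _ _ \<Omega>_lm N_negligible])
    show "essentially_bounded \<Omega> (\<lambda>x. (1 / \<tau>) * (r1 x / 2 * (norm (v1 x))\<^sup>2 - r0 x / 2 * (norm (v0 x))\<^sup>2))"
      by (intro essentially_bounded_mult essentially_bounded_diff essentially_bounded_const k)
    show "essentially_bounded \<Omega> (\<lambda>x. (((r1 x - r0 x) / \<tau>) *\<^sub>R ((1/2) *\<^sub>R v1 x) + r0 x *\<^sub>R ((1/\<tau>) *\<^sub>R (v1 x - v0 x))) \<bullet> v1 x)"
      by (intro eb_intros eb)
    fix x
    define c where "c = 1 / \<tau>"
    have c: "z / \<tau> = c * z" for z by (simp add: c_def)
    have "0 \<le> c * (r0 x / 2) * ((v1 x - v0 x) \<bullet> (v1 x - v0 x))"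
      unfolding r0_def c_def using ab by (intro mult_nonneg_nonneg divide_nonneg_nonneg density_reg_nonneg) auto
    also have "\<dots> = (((r1 x - r0 x) / \<tau>) *\<^sub>R ((1/2) *\<^sub>R v1 x) + r0 x *\<^sub>R ((1/\<tau>) *\<^sub>R (v1 x - v0 x))) \<bullet> v1 x
       - (1 / \<tau>) * (r1 x / 2 * (norm (v1 x))\<^sup>2 - r0 x / 2 * (norm (v0 x))\<^sup>2)"
    proof -
      define X Y Z where "X = v1 x \<bullet> v1 x" and "Y = v0 x \<bullet> v0 x" and "Z = v0 x \<bullet> v1 x"
      have sq: "(v1 x - v0 x) \<bullet> (v1 x - v0 x) = X - 2 * Z + Y"
        by (simp add: X_def Y_def Z_def inner_diff_left inner_diff_right inner_commute)
      have l: "(((r1 x - r0 x) / \<tau>) *\<^sub>R ((1/2) *\<^sub>R v1 x) + r0 x *\<^sub>R ((1/\<tau>) *\<^sub>R (v1 x - v0 x))) \<bullet> v1 x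
        = c * (r1 x - r0 x) * (X / 2) + r0 x * (c * (X - Z))"
        unfolding c by (simp add: inner_add_left inner_diff_left X_def Z_def)
      have n: "(norm (v1 x))\<^sup>2 = X" "(norm (v0 x))\<^sup>2 = Y" by (simp_all add: X_def Y_def power2_norm_eq_inner)
      show ?thesis unfolding l sq n unfolding c by (simp add: field_simps)
    qed
    finally show "(1 / \<tau>) * (r1 x / 2 * (norm (v1 x))\<^sup>2 - r0 x / 2 * (norm (v0 x))\<^sup>2)
      \<le> (((r1 x - r0 x) / \<tau>) *\<^sub>R ((1/2) *\<^sub>R v1 x) + r0 x *\<^sub>R ((1/\<tau>) *\<^sub>R (v1 x - v0 x))) \<bullet> v1 x" by simp
  qed
  finally show ?thesis by (simp only: pairing_def r1_def r0_def)
qed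

lemma integral_gravity:
  assumes "(\<exists>L. bdry D = Torus L) \<longrightarrow> grav P = 0"
  shows "pairing \<Omega> (\<lambda>x. (mixture_density P (\<lambda>\<alpha>. \<phi>0 \<alpha> x) * grav P) *\<^sub>R gradient (height P) x) v1
    = (1 / \<tau>) * ((LINT x|lebesgue_on \<Omega>. mixture_density P (\<lambda>\<alpha>. \<phi>1 \<alpha> x) * grav P * height P x)
      - (LINT x|lebesgue_on \<Omega>. mixture_density P (\<lambda>\<alpha>. \<phi>0 \<alpha> x) * grav P * height P x))"
proof (cases "grav P = 0")
  case True
  then show ?thesis by (simp add: pairing_def)
next
  case False
  \<comment> \<open>With nonzero gravity the hypothesis excludes the torus, so the height is an
    admissible test function.\<close>
  then obtain \<Gamma>1 \<Gamma>2 where W: "bdry D = Walls \<Gamma>1 \<Gamma>2" using assms by (cases "bdry D") auto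
  let ?e = "axis (vert P) (1::real) :: real^'d"
  define \<psi> where "\<psi> \<alpha> x = dens P \<alpha> * grav P * height P x" for \<alpha> x
  have \<psi>V: "\<psi> \<alpha> \<in> V_h D" for \<alpha>
    unfolding \<psi>_def[abs_def] height_def by (intro V_h_cmult V_h_nth[OF D W])
  have \<psi>g: "gradient (\<psi> \<alpha>) x = (dens P \<alpha> * grav P) *\<^sub>R ?e" for \<alpha> x
    unfolding \<psi>_def[abs_def] height_def by (intro gradient_eqI has_gradient_cmult has_gradient_nth)
  define A where "A \<alpha> x = (\<phi>1 \<alpha> x - \<phi>0 \<alpha> x) / \<tau> * \<psi> \<alpha> x" for \<alpha> x
  define B where "B \<alpha> x = \<phi>0 \<alpha> x *\<^sub>R v1 x \<bullet> gradient (\<psi> \<alpha>) x" for \<alpha> x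
  define C where "C \<alpha> x = ((1 / dens P \<alpha>) *\<^sub>R mobility_flux \<alpha> x) \<bullet> gradient (\<psi> \<alpha>) x" for \<alpha> x
  have eb: "essentially_bounded \<Omega> (A \<alpha>)" "essentially_bounded \<Omega> (B \<alpha>)" "essentially_bounded \<Omega> (C \<alpha>)" for \<alpha>
    unfolding A_def[abs_def] B_def[abs_def] C_def[abs_def] by (intro eb_intros eb_flux \<psi>V)+
  note int = eb_integrable[OF eb(1)] eb_integrable[OF eb(2)] eb_integrable[OF eb(3)]
  have "(LINT x|lebesgue_on \<Omega>. A \<alpha> x) - (LINT x|lebesgue_on \<Omega>. B \<alpha> x) + (LINT x|lebesgue_on \<Omega>. C \<alpha> x) = 0" for \<alpha>
    using phase[OF \<psi>V, of \<alpha> \<alpha>] by (simp only: pairing_def inner_real_def A_def B_def C_def mobility_flux_def)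
  then have "(\<Sum>\<alpha>\<in>UNIV. (LINT x|lebesgue_on \<Omega>. A \<alpha> x) - (LINT x|lebesgue_on \<Omega>. B \<alpha> x) + (LINT x|lebesgue_on \<Omega>. C \<alpha> x)) = 0"
    by simp
  then have "(LINT x|lebesgue_on \<Omega>. (\<Sum>\<alpha>\<in>UNIV. A \<alpha> x)) - (LINT x|lebesgue_on \<Omega>. (\<Sum>\<alpha>\<in>UNIV. B \<alpha> x))
    + (LINT x|lebesgue_on \<Omega>. (\<Sum>\<alpha>\<in>UNIV. C \<alpha> x)) = 0"
    using int by (simp add: Bochner_Integration.integral_sum sum.distrib sum_subtractf)
  \<comment> \<open>The density in the test function cancels the reciprocal density of the diffusive
    term, so that summation over \<alpha> produces column sums of the mobility matrix.\<close>
  moreover have "(\<Sum>\<alpha>\<in>UNIV. C \<alpha> x) = 0" for x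
  proof -
    have "(\<Sum>\<alpha>\<in>UNIV. mobility_flux \<alpha> x) = (\<Sum>\<beta>\<in>UNIV. (\<Sum>\<alpha>\<in>UNIV. Mob x \<alpha> \<beta>) *\<^sub>R gradient (g \<beta>) x)"
      unfolding mobility_flux_def scaleR_sum_left by (rule sum.swap)
    also have "\<dots> = 0" by (simp add: mobility_reg_column_sum[OF mob_sym])
    finally have 0: "(\<Sum>\<alpha>\<in>UNIV. mobility_flux \<alpha> x) = 0" .
    have "C \<alpha> x = grav P * (mobility_flux \<alpha> x \<bullet> ?e)" for \<alpha>
      using dens_pos[of \<alpha>] by (simp add: C_def \<psi>g)
    then have "(\<Sum>\<alpha>\<in>UNIV. C \<alpha> x) = grav P * ((\<Sum>\<alpha>\<in>UNIV. mobility_flux \<alpha> x) \<bullet> ?e)"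
      by (simp only: sum_distrib_left[symmetric] inner_sum_left)
    then show ?thesis by (simp add: 0)
  qed
  moreover have "(\<Sum>\<alpha>\<in>UNIV. B \<alpha> x) = (mixture_density P (\<lambda>\<alpha>. \<phi>0 \<alpha> x) * grav P) *\<^sub>R gradient (height P) x \<bullet> v1 x" for x
    by (simp add: B_def \<psi>g gradient_height mixture_density_def sum_distrib_right sum_distrib_left inner_commute[of ?e] ac_simps)
  moreover have "(LINT x|lebesgue_on \<Omega>. (\<Sum>\<alpha>\<in>UNIV. A \<alpha> x))
    = (1 / \<tau>) * ((LINT x|lebesgue_on \<Omega>. mixture_density P (\<lambda>\<alpha>. \<phi>1 \<alpha> x) * grav P * height P x)
      - (LINT x|lebesgue_on \<Omega>. mixture_density P (\<lambda>\<alpha>. \<phi>0 \<alpha> x) * grav P * height P x))"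
  proof -
    have e1: "essentially_bounded \<Omega> (\<lambda>x. mixture_density P (\<lambda>\<alpha>. \<phi>1 \<alpha> x) * grav P * height P x)"
      and e0: "essentially_bounded \<Omega> (\<lambda>x. mixture_density P (\<lambda>\<alpha>. \<phi>0 \<alpha> x) * grav P * height P x)"
      by (intro eb_intros eb_density eb_height)+
    have "(\<Sum>\<alpha>\<in>UNIV. A \<alpha> x) = (1 / \<tau>) * (mixture_density P (\<lambda>\<alpha>. \<phi>1 \<alpha> x) * grav P * height P x
       - mixture_density P (\<lambda>\<alpha>. \<phi>0 \<alpha> x) * grav P * height P x)" for x
    proof -
      have "A \<alpha> x = (1 / \<tau>) * (dens P \<alpha> * \<phi>1 \<alpha> x * grav P * height P x - dens P \<alpha> * \<phi>0 \<alpha> x * grav P * height P x)" for \<alpha>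
        by (simp add: A_def \<psi>_def algebra_simps diff_divide_distrib)
      then show ?thesis
        by (simp only: mixture_density_def sum_distrib_right sum_distrib_left[symmetric] sum_subtractf)
    qed
    then show ?thesis
      unfolding Bochner_Integration.integral_diff[OF eb_integrable[OF e1] eb_integrable[OF e0], symmetric]
        Bochner_Integration.integral_mult_right_zero[symmetric] by simp
  qed
  ultimately show ?thesis by (simp add: pairing_def)
qed

text \<open>The potential equation is tested with the discrete time derivative of its phase. The
  bulk part \<open>SA\<close> is exact; the inequality stems from convexity of the gradient energy
  in \<open>SB\<close>.\<close>

lemma integral_chemical:
  "(1 / \<tau>) * (((LINT x|lebesgue_on \<Omega>. Psi0 P (\<lambda>\<alpha>. \<phi>1 \<alpha> x)) + (LINT x|lebesgue_on \<Omega>. Psi_grad P (\<lambda>\<alpha>. gradient (\<phi>1 \<alpha>) x)))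
     - ((LINT x|lebesgue_on \<Omega>. Psi0 P (\<lambda>\<alpha>. \<phi>0 \<alpha> x)) + (LINT x|lebesgue_on \<Omega>. Psi_grad P (\<lambda>\<alpha>. gradient (\<phi>0 \<alpha>) x))))
   \<le> (\<Sum>\<alpha>\<in>UNIV. pairing \<Omega> (\<lambda>x. (\<phi>1 \<alpha> x - \<phi>0 \<alpha> x) / \<tau>) (\<lambda>x. dens P \<alpha> * g \<alpha> x - lam x))"
proof -
  define \<xi> where "\<xi> \<alpha> x = (1 / \<tau>) * (\<phi>1 \<alpha> x - \<phi>0 \<alpha> x)" for \<alpha> x
  have \<xi>V: "\<xi> \<alpha> \<in> V_h D" for \<alpha> unfolding \<xi>_def[abs_def] by (intro V_h_cmult V_h_diff D \<phi>0 \<phi>1)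
  define A where "A \<alpha> x = dPsi0_avg P \<alpha> a b (\<lambda>\<alpha>. \<phi>0 \<alpha> x) (\<lambda>\<alpha>. \<phi>1 \<alpha> x) * \<xi> \<alpha> x" for \<alpha> x
  define B where "B \<alpha> x = dPsi_grad P \<alpha> (\<lambda>\<beta>. gradient (\<phi>1 \<beta>) x) \<bullet> gradient (\<xi> \<alpha>) x" for \<alpha> x
  have eb: "essentially_bounded \<Omega> (A \<alpha>)" "essentially_bounded \<Omega> (B \<alpha>)" for \<alpha>
    unfolding A_def[abs_def] B_def[abs_def] by (intro eb_intros eb_dPsi0_avg eb_dPsi_grad \<xi>V)+
  note int = eb_integrable[OF eb(1)] eb_integrable[OF eb(2)]
  have T: "pairing \<Omega> (\<lambda>x. (\<phi>1 \<alpha> x - \<phi>0 \<alpha> x) / \<tau>) (\<lambda>x. dens P \<alpha> * g \<alpha> x - lam x)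
    = (LINT x|lebesgue_on \<Omega>. A \<alpha> x) + (LINT x|lebesgue_on \<Omega>. B \<alpha> x)" for \<alpha>
  proof -
    have e1: "essentially_bounded \<Omega> (\<lambda>x. dens P \<alpha> * g \<alpha> x * \<xi> \<alpha> x)" and e2: "essentially_bounded \<Omega> (\<lambda>x. lam x * \<xi> \<alpha> x)"
      by (intro eb_intros \<xi>V)+
    have "pairing \<Omega> (\<lambda>x. (\<phi>1 \<alpha> x - \<phi>0 \<alpha> x) / \<tau>) (\<lambda>x. dens P \<alpha> * g \<alpha> x - lam x)
      = (LINT x|lebesgue_on \<Omega>. dens P \<alpha> * g \<alpha> x * \<xi> \<alpha> x - lam x * \<xi> \<alpha> x)"
    proof -
      have "(\<phi>1 \<alpha> x - \<phi>0 \<alpha> x) / \<tau> * (dens P \<alpha> * g \<alpha> x - lam x) = dens P \<alpha> * g \<alpha> x * \<xi> \<alpha> x - lam x * \<xi> \<alpha> x" for x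
      proof -
        have eq: "(\<phi>1 \<alpha> x - \<phi>0 \<alpha> x) / \<tau> = \<xi> \<alpha> x" by (simp add: \<xi>_def)
        show ?thesis unfolding eq by (simp add: right_diff_distrib mult.commute)
      qed
      then show ?thesis by (simp only: pairing_def inner_real_def)
    qed
    also have "\<dots> = pairing \<Omega> (\<lambda>x. dens P \<alpha> * g \<alpha> x) (\<xi> \<alpha>) - pairing \<Omega> lam (\<xi> \<alpha>)"
      unfolding pairing_def inner_real_def
      by (rule Bochner_Integration.integral_diff[OF eb_integrable[OF e1] eb_integrable[OF e2]])
    also have "\<dots> = (LINT x|lebesgue_on \<Omega>. A \<alpha> x) + (LINT x|lebesgue_on \<Omega>. B \<alpha> x)"
      using potential[OF \<xi>V, of \<alpha> \<alpha>] unfolding A_def B_def by (simp only: pairing_def inner_real_def)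
    finally show ?thesis .
  qed
  have eP: "essentially_bounded \<Omega> (\<lambda>x. Psi0 P (\<lambda>\<alpha>. \<phi>1 \<alpha> x))" "essentially_bounded \<Omega> (\<lambda>x. Psi0 P (\<lambda>\<alpha>. \<phi>0 \<alpha> x))"
    "essentially_bounded \<Omega> (\<lambda>x. Psi_grad P (\<lambda>\<alpha>. gradient (\<phi>1 \<alpha>) x))" "essentially_bounded \<Omega> (\<lambda>x. Psi_grad P (\<lambda>\<alpha>. gradient (\<phi>0 \<alpha>) x))"
    by (intro eb_Psi0 eb_Psi_grad \<phi>0 \<phi>1)+
  have SA: "(LINT x|lebesgue_on \<Omega>. (\<Sum>\<alpha>\<in>UNIV. A \<alpha> x)) =
    (1 / \<tau>) * ((LINT x|lebesgue_on \<Omega>. Psi0 P (\<lambda>\<alpha>. \<phi>1 \<alpha> x)) - (LINT x|lebesgue_on \<Omega>. Psi0 P (\<lambda>\<alpha>. \<phi>0 \<alpha> x)))"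
  proof -
    obtain F' where F': "\<And>s. (slogs P has_real_derivative F' s) (at s)"
      using reg unfolding polynomial_regularization_def by blast
    have "(\<Sum>\<alpha>\<in>UNIV. A \<alpha> x) = (1 / \<tau>) * (Psi0 P (\<lambda>\<alpha>. \<phi>1 \<alpha> x) - Psi0 P (\<lambda>\<alpha>. \<phi>0 \<alpha> x))" for x
      unfolding sum_dPsi0_avg[OF F' chi_sym ab, symmetric] sum_distrib_left
      by (simp add: A_def \<xi>_def)
    then show ?thesis
      unfolding Bochner_Integration.integral_diff[OF eb_integrable[OF eP(1)] eb_integrable[OF eP(2)], symmetric]
        Bochner_Integration.integral_mult_right_zero[symmetric] by simp
  qed
  have SB: "(1 / \<tau>) * ((LINT x|lebesgue_on \<Omega>. Psi_grad P (\<lambda>\<alpha>. gradient (\<phi>1 \<alpha>) x)) - (LINT x|lebesgue_on \<Omega>. Psi_grad P (\<lambda>\<alpha>. gradient (\<phi>0 \<alpha>) x)))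
    \<le> (LINT x|lebesgue_on \<Omega>. (\<Sum>\<alpha>\<in>UNIV. B \<alpha> x))"
    unfolding Bochner_Integration.integral_diff[OF eb_integrable[OF eP(3)] eb_integrable[OF eP(4)], symmetric]
      Bochner_Integration.integral_mult_right_zero[symmetric]
  proof (rule essentially_bounded_integral_mono[OF _ _ \<Omega>_lm N_negligible])
    show "essentially_bounded \<Omega> (\<lambda>x. 1 / \<tau> * (Psi_grad P (\<lambda>\<alpha>. gradient (\<phi>1 \<alpha>) x) - Psi_grad P (\<lambda>\<alpha>. gradient (\<phi>0 \<alpha>) x)))"
      by (intro essentially_bounded_mult essentially_bounded_diff essentially_bounded_const eP)
    show "essentially_bounded \<Omega> (\<lambda>x. \<Sum>\<alpha>\<in>UNIV. B \<alpha> x)" by (intro essentially_bounded_sum eb)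
    fix x assume x: "x \<in> \<Omega>" "x \<notin> N"
    have "gradient (\<xi> \<alpha>) x = (1 / \<tau>) *\<^sub>R (gradient (\<phi>1 \<alpha>) x - gradient (\<phi>0 \<alpha>) x)" for \<alpha>
      unfolding \<xi>_def[abs_def]
      by (intro gradient_eqI has_gradient_cmult has_gradient_diff V_gradient \<phi>0 \<phi>1 x)
    then have "(\<Sum>\<alpha>\<in>UNIV. B \<alpha> x) = (1 / \<tau>) * (\<Sum>\<alpha>\<in>UNIV. dPsi_grad P \<alpha> (\<lambda>\<beta>. gradient (\<phi>1 \<beta>) x) \<bullet> (gradient (\<phi>1 \<alpha>) x - gradient (\<phi>0 \<alpha>) x))"
      by (simp add: B_def sum_distrib_left)
    then show "1 / \<tau> * (Psi_grad P (\<lambda>\<alpha>. gradient (\<phi>1 \<alpha>) x) - Psi_grad P (\<lambda>\<alpha>. gradient (\<phi>0 \<alpha>) x)) \<le> (\<Sum>\<alpha>\<in>UNIV. B \<alpha> x)"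
      using ab Psi_grad_convex[OF eps0 cap_psd cap_sym, of "\<lambda>\<alpha>. gradient (\<phi>1 \<alpha>) x" "\<lambda>\<alpha>. gradient (\<phi>0 \<alpha>) x"]
      by (simp add: divide_right_mono)
  qed
  have "(\<Sum>\<alpha>\<in>UNIV. pairing \<Omega> (\<lambda>x. (\<phi>1 \<alpha> x - \<phi>0 \<alpha> x) / \<tau>) (\<lambda>x. dens P \<alpha> * g \<alpha> x - lam x))
    = (LINT x|lebesgue_on \<Omega>. (\<Sum>\<alpha>\<in>UNIV. A \<alpha> x)) + (LINT x|lebesgue_on \<Omega>. (\<Sum>\<alpha>\<in>UNIV. B \<alpha> x))"
    using int by (simp add: T sum.distrib Bochner_Integration.integral_sum)
  then show ?thesis using SA SB by (simp add: right_diff_distrib distrib_left)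
qed

text \<open>In the part with \<open>g\<close> the densities cancel, which leaves the mobility
  dissipation. The part with \<open>lam\<close> is the flux term of the constraint and can be
  exchanged for the divergence of the velocity.\<close>

lemma integral_mobility:
  "(\<Sum>\<alpha>\<in>UNIV. pairing \<Omega> (\<lambda>x. (1 / dens P \<alpha>) *\<^sub>R mobility_flux \<alpha> x) (gradient (\<lambda>x. dens P \<alpha> * g \<alpha> x - lam x)))
   = (\<Sum>\<alpha>\<in>UNIV. \<Sum>\<beta>\<in>UNIV. pairing \<Omega> (\<lambda>x. Mob x \<alpha> \<beta> *\<^sub>R gradient (g \<beta>) x) (gradient (g \<alpha>)))
     + pairing \<Omega> (divergence v1) lam"
proof -
  define A where "A \<alpha> \<beta> x = Mob x \<alpha> \<beta> *\<^sub>R gradient (g \<beta>) x \<bullet> gradient (g \<alpha>) x" for \<alpha> \<beta> x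
  define B where "B \<alpha> x = ((1 / dens P \<alpha>) *\<^sub>R mobility_flux \<alpha> x) \<bullet> gradient lam x" for \<alpha> x
  have eb: "essentially_bounded \<Omega> (A \<alpha> \<beta>)" "essentially_bounded \<Omega> (B \<alpha>)" for \<alpha> \<beta>
    unfolding A_def[abs_def] B_def[abs_def] by (intro eb_intros eb_mob eb_flux)+
  note int = eb_integrable[OF eb(1)] eb_integrable[OF eb(2)]
  have "pairing \<Omega> (\<lambda>x. (1 / dens P \<alpha>) *\<^sub>R mobility_flux \<alpha> x) (gradient (\<lambda>x. dens P \<alpha> * g \<alpha> x - lam x))
    = (LINT x|lebesgue_on \<Omega>. (\<Sum>\<beta>\<in>UNIV. A \<alpha> \<beta> x) - B \<alpha> x)" for \<alpha>
    unfolding pairing_def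
  proof (rule essentially_bounded_integral_cong[OF _ \<Omega>_lm N_negligible])
    show "essentially_bounded \<Omega> (\<lambda>x. (\<Sum>\<beta>\<in>UNIV. A \<alpha> \<beta> x) - B \<alpha> x)"
      by (intro essentially_bounded_diff essentially_bounded_sum eb)
    fix x assume x: "x \<in> \<Omega>" "x \<notin> N"
    have "gradient (\<lambda>x. dens P \<alpha> * g \<alpha> x - lam x) x = dens P \<alpha> *\<^sub>R gradient (g \<alpha>) x - gradient lam x"
      by (intro gradient_eqI has_gradient_cmult has_gradient_diff V_gradient g lamV x)
    then show "(1 / dens P \<alpha>) *\<^sub>R mobility_flux \<alpha> x \<bullet> gradient (\<lambda>x. dens P \<alpha> * g \<alpha> x - lam x) x
      = (\<Sum>\<beta>\<in>UNIV. A \<alpha> \<beta> x) - B \<alpha> x"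
      using dens_pos[of \<alpha>]
      by (simp add: A_def B_def mobility_flux_def inner_diff_right inner_sum_left diff_divide_distrib)
  qed
  then have "(\<Sum>\<alpha>\<in>UNIV. pairing \<Omega> (\<lambda>x. (1 / dens P \<alpha>) *\<^sub>R mobility_flux \<alpha> x) (gradient (\<lambda>x. dens P \<alpha> * g \<alpha> x - lam x)))
    = (\<Sum>\<alpha>\<in>UNIV. \<Sum>\<beta>\<in>UNIV. (LINT x|lebesgue_on \<Omega>. A \<alpha> \<beta> x)) - (LINT x|lebesgue_on \<Omega>. (\<Sum>\<alpha>\<in>UNIV. B \<alpha> x))"
    using int by (simp add: Bochner_Integration.integral_sum sum_subtractf)
  moreover have "pairing \<Omega> (divergence v1) lam + (LINT x|lebesgue_on \<Omega>. (\<Sum>\<alpha>\<in>UNIV. B \<alpha> x)) = 0"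
    unfolding B_def by (rule incompressible_flux[OF lam])
  ultimately show ?thesis by (simp add: A_def pairing_def)
qed

lemma energy_split:
  assumes f: "\<And>\<alpha>. f \<alpha> \<in> V_h D" and v: "v \<in> X_h D"
  shows "energy D P v f = (LINT x|lebesgue_on \<Omega>. Psi0 P (\<lambda>\<alpha>. f \<alpha> x)) + (LINT x|lebesgue_on \<Omega>. Psi_grad P (\<lambda>\<alpha>. gradient (f \<alpha>) x))
    + (LINT x|lebesgue_on \<Omega>. mixture_density_reg P (\<lambda>\<alpha>. f \<alpha> x) / 2 * (norm (v x))\<^sup>2)
    + (LINT x|lebesgue_on \<Omega>. mixture_density P (\<lambda>\<alpha>. f \<alpha> x) * grav P * height P x)"
proof -
  have "essentially_bounded \<Omega> (\<lambda>x. mixture_density_reg P (\<lambda>\<alpha>. f \<alpha> x) / 2 * (norm (v x))\<^sup>2)"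
    unfolding power2_norm_eq_inner by (intro eb_intros eb_density_reg f v)
  note kin = eb_integrable[OF this]
  have "essentially_bounded \<Omega> (\<lambda>x. mixture_density P (\<lambda>\<alpha>. f \<alpha> x) * grav P * height P x)"
    by (intro eb_intros eb_density eb_height f)
  note pot = eb_integrable[OF this]
  have Psi: "integrable (lebesgue_on \<Omega>) (\<lambda>x. Psi0 P (\<lambda>\<alpha>. f \<alpha> x))"
    "integrable (lebesgue_on \<Omega>) (\<lambda>x. Psi_grad P (\<lambda>\<alpha>. gradient (f \<alpha>) x))"
    by (intro eb_integrable eb_Psi0 eb_Psi_grad f)+
  show ?thesis
    by (simp only: energy_def Bochner_Integration.integral_add Bochner_Integration.integrable_add Psi kin pot)
qed

lemma energy_dissipation:
  assumes "(\<exists>L. bdry D = Torus L) \<longrightarrow> grav P = 0"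
  shows "energy D P v1 \<phi>1 + \<tau> * (pairing \<Omega> St (vgradient v1) +
      (\<Sum>\<alpha>\<in>UNIV. \<Sum>\<beta>\<in>UNIV. pairing \<Omega> (\<lambda>x. Mob x \<alpha> \<beta> *\<^sub>R gradient (g \<beta>) x) (gradient (g \<alpha>))))
    \<le> energy D P v0 \<phi>0"
proof -
  have \<psi>V: "(\<lambda>x. dens P \<alpha> * g \<alpha> x - lam x) \<in> V_h D" for \<alpha>
    by (intro V_h_diff V_h_cmult D g lamV)
  have comm: "pairing \<Omega> (\<lambda>x. \<phi>0 \<alpha> x *\<^sub>R v1 x) (gradient (\<lambda>x. dens P \<alpha> * g \<alpha> x - lam x))
    = pairing \<Omega> (\<lambda>x. \<phi>0 \<alpha> x *\<^sub>R gradient (\<lambda>x. dens P \<alpha> * g \<alpha> x - lam x) x) v1" for \<alpha>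
    unfolding pairing_def by (simp add: inner_commute)
  \<comment> \<open>The force that the potentials exert in the momentum equation is the convective
    term of the phase equation tested with the same function; its old phase value at both places
    makes them match.\<close>
  have ph: "pairing \<Omega> (\<lambda>x. \<phi>0 \<alpha> x *\<^sub>R gradient (\<lambda>x. dens P \<alpha> * g \<alpha> x - lam x) x) v1
    = pairing \<Omega> (\<lambda>x. (\<phi>1 \<alpha> x - \<phi>0 \<alpha> x) / \<tau>) (\<lambda>x. dens P \<alpha> * g \<alpha> x - lam x)
      + pairing \<Omega> (\<lambda>x. (1 / dens P \<alpha>) *\<^sub>R mobility_flux \<alpha> x) (gradient (\<lambda>x. dens P \<alpha> * g \<alpha> x - lam x))" for \<alpha>
    using phase[OF \<psi>V[of \<alpha>], of \<alpha>] comm[of \<alpha>] unfolding mobility_flux_def by linarith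
  \<comment> \<open>With equal last arguments the two halves of the form are identical, whatever the
    convecting field.\<close>
  have cv: "convection \<Omega> u v1 v1 = 0" by (simp add: convection_def)
  have ld: "pairing \<Omega> lam (divergence v1) = pairing \<Omega> (divergence v1) lam"
    unfolding pairing_def by (simp add: mult.commute)
  let ?D = "pairing \<Omega> St (vgradient v1) +
      (\<Sum>\<alpha>\<in>UNIV. \<Sum>\<beta>\<in>UNIV. pairing \<Omega> (\<lambda>x. Mob x \<alpha> \<beta> *\<^sub>R gradient (g \<beta>) x) (gradient (g \<alpha>)))"
  \<comment> \<open>The pairing of \<open>lam\<close> with the divergence, subtracted in the
    momentum equation, is cancelled by the one from \<open>integral_mobility\<close>. Kinetic and
    chemical terms enter as lower bounds, gravity as an identity.\<close>
  have "(1 / \<tau>) * (energy D P v1 \<phi>1 - energy D P v0 \<phi>0) + ?D \<le> 0"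
    using momentum integral_kinetic integral_chemical
    unfolding cv ld ph sum.distrib integral_mobility integral_gravity[OF assms] energy_split[OF \<phi>1 v1] energy_split[OF \<phi>0 v0]
      right_diff_distrib distrib_left
    by linarith
  then have "\<tau> * ((1 / \<tau>) * (energy D P v1 \<phi>1 - energy D P v0 \<phi>0) + ?D) \<le> 0"
    using ab by (intro mult_nonneg_nonpos) auto
  moreover have "\<tau> * ((1 / \<tau>) * (energy D P v1 \<phi>1 - energy D P v0 \<phi>0) + ?D) = energy D P v1 \<phi>1 - energy D P v0 \<phi>0 + \<tau> * ?D"
    using ab by (simp add: distrib_left)
  ultimately show ?thesis by linarith
qed

end

text \<open>Each time step is an instance of \<open>scheme_step\<close>; statements that refer to
  the initial data follow by induction over the steps. The condition on gravity reflects that the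
  height is not periodic and hence cannot be a test function on a torus.\<close>

theorem theorem4p2:
  fixes D :: "('d::finite) discretization"
    and P :: "('d, 'n::finite) physics"
    and t :: "nat \<Rightarrow> real" and T :: real and nT :: nat
    and c d e :: "nat \<Rightarrow> nat"
    and \<phi> :: "nat \<Rightarrow> 'n \<Rightarrow> real^'d \<Rightarrow> real"
    and v :: "nat \<Rightarrow> real^'d \<Rightarrow> real^'d"
    and g :: "nat \<Rightarrow> 'n \<Rightarrow> real^'d \<Rightarrow> real"
    and lam :: "nat \<Rightarrow> real^'d \<Rightarrow> real"
  assumes dim: "CARD('d) \<in> {2, 3}"
    and disc: "discretization_ok D"
    and phys: "physics_ok P"
    and grid: "t 0 = 0" "\<forall>n<nT. t n < t (Suc n)" "t nT = T"
    and levels: "\<forall>n<nT. c n \<in> {n, Suc n} \<and> d n \<in> {n, Suc n} \<and> e n \<in> {n, Suc n}"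
    and sol: "is_solution D P t nT c d e \<phi> v g lam"
  shows "(\<forall>n<nT.
            (\<forall>\<alpha>. pairing (Omega D) (\<phi> (Suc n) \<alpha>) (\<lambda>_. 1) = pairing (Omega D) (\<phi> 0 \<alpha>) (\<lambda>_. 1)) \<and>
            (\<forall>\<alpha>. pairing (Omega D) (\<lambda>x. dens P \<alpha> * \<phi> (Suc n) \<alpha> x) (\<lambda>_. 1)
               = pairing (Omega D) (\<lambda>x. dens P \<alpha> * \<phi> 0 \<alpha> x) (\<lambda>_. 1)) \<and>
            pairing (Omega D) (\<lambda>x. \<Sum>\<alpha>\<in>UNIV. \<phi> (Suc n) \<alpha> x) (\<lambda>_. 1)
               = pairing (Omega D) (\<lambda>x. \<Sum>\<alpha>\<in>UNIV. \<phi> 0 \<alpha> x) (\<lambda>_. 1) \<and>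
            pairing (Omega D) (\<lambda>x. mixture_density P (\<lambda>\<alpha>. \<phi> (Suc n) \<alpha> x)) (\<lambda>_. 1)
               = pairing (Omega D) (\<lambda>x. mixture_density P (\<lambda>\<alpha>. \<phi> 0 \<alpha> x)) (\<lambda>_. 1) \<and>
            (((\<exists>L. bdry D = Torus L) \<longrightarrow> grav P = 0) \<longrightarrow>
               energy D P (v (Suc n)) (\<phi> (Suc n))
                 + (t (Suc n) - t n) * dissipation D P (d n) (e n) (Suc n) \<phi> v g
               \<le> energy D P (v n) (\<phi> n))) \<and>
         ((\<forall>x\<in>Omega D. (\<Sum>\<alpha>\<in>UNIV. \<phi> 0 \<alpha> x) = 1) \<longrightarrow>
            (\<forall>k\<in>{1..nT}. \<forall>x\<in>Omega D. (\<Sum>\<alpha>\<in>UNIV. \<phi> k \<alpha> x) = 1))"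
proof -
  have V: "\<phi> n \<alpha> \<in> V_h D" "v n \<in> X_h D" if "n \<le> nT" for n \<alpha>
    using sol that unfolding is_solution_def by blast+
  have step: "scheme_step D P (t n) (t (Suc n)) (\<phi> n) (\<phi> (Suc n)) (\<phi> (e n)) (g (Suc n)) (v n) (v (Suc n))
     (\<lambda>x. mixture_density P (\<lambda>\<alpha>. \<phi> (c n) \<alpha> x) *\<^sub>R v (c n) x) (lam (Suc n))
     (\<lambda>x. stress P (\<lambda>\<alpha>. \<phi> (d n) \<alpha> x) (vgradient (v (Suc n)) x))" if n: "n < nT" for n
  proof -
    have e: "e n \<le> nT" using levels n by (auto simp: Suc_le_eq)
    have G: "\<forall>\<alpha>. g (Suc n) \<alpha> \<in> V_h D" "lam (Suc n) \<in> Q_h D"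
      using sol n unfolding is_solution_def by blast+
    note eqs = sol[unfolded is_solution_def Let_def, THEN conjunct2, THEN conjunct2, rule_format, OF n]
    show ?thesis
    \<comment> \<open>The first ten assumptions of the locale concern the data and membership in the
      spaces; goals 11 to 14 are the four equations of the scheme.\<close>
    proof (unfold_locales, goal_cases)
      case 11
      show ?case using eqs[THEN conjunct1, rule_format, OF V(2)] n by simp
    next
      case 12
      then show ?case using eqs[THEN conjunct2, THEN conjunct1] by blast
    next
      case 13
      then show ?case using eqs[THEN conjunct2, THEN conjunct2, THEN conjunct1] by blast
    next
      case 14
      then show ?case using eqs[THEN conjunct2, THEN conjunct2, THEN conjunct2] by blast
    qed (use disc phys grid n e V G in auto)
  qed
  have volume: "pairing (Omega D) (\<phi> n \<alpha>) (\<lambda>_. 1) = pairing (Omega D) (\<phi> 0 \<alpha>) (\<lambda>_. 1)" if "n \<le> nT" for n \<alpha>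
    using that
  proof (induction n)
    case (Suc n)
    then show ?case using scheme_step.phase_volume[OF step[of n], of \<alpha>] by simp
  qed simp
  have int: "integrable (lebesgue_on (Omega D)) (\<phi> n \<alpha>)" if "n \<le> nT" for n \<alpha>
  proof -
    have "square_integrable (Omega D) (\<phi> n \<alpha>)" using V(1)[OF that] by (simp add: V_h_def H1_def)
    from square_integrable_mult_bounded[OF this discretization_lmeasurable[OF disc], of "\<lambda>_. 1" 1]
    show ?thesis by simp
  qed
  \<comment> \<open>Unit weights give the total volume, the densities as weights the total
    mass.\<close>
  have weighted: "pairing (Omega D) (\<lambda>x. \<Sum>\<alpha>\<in>UNIV. w \<alpha> * \<phi> n \<alpha> x) (\<lambda>_. 1)
    = (\<Sum>\<alpha>\<in>UNIV. w \<alpha> * pairing (Omega D) (\<phi> n \<alpha>) (\<lambda>_. 1))" if "n \<le> nT" for n w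
    using int[OF that] by (simp add: pairing_def Bochner_Integration.integral_sum)
  have total: "pairing (Omega D) (\<lambda>x. \<Sum>\<alpha>\<in>UNIV. w \<alpha> * \<phi> (Suc n) \<alpha> x) (\<lambda>_. 1)
    = pairing (Omega D) (\<lambda>x. \<Sum>\<alpha>\<in>UNIV. w \<alpha> * \<phi> 0 \<alpha> x) (\<lambda>_. 1)" if "n < nT" for n w
    using that volume[of "Suc n"] by (simp add: weighted)
  have one: "\<forall>x\<in>Omega D. (\<Sum>\<alpha>\<in>UNIV. \<phi> k \<alpha> x) = 1"
    if "\<forall>x\<in>Omega D. (\<Sum>\<alpha>\<in>UNIV. \<phi> 0 \<alpha> x) = 1" "k \<le> nT" for k
    using that(2)
  proof (induction k)
    case (Suc k)
    then show ?case using scheme_step.sum_phases_preserved[OF step[of k]] by simp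
  qed (use that in simp)
  show ?thesis
  proof (intro conjI allI impI ballI)
    fix n assume n: "n < nT"
    show vol: "pairing (Omega D) (\<phi> (Suc n) \<alpha>) (\<lambda>_. 1) = pairing (Omega D) (\<phi> 0 \<alpha>) (\<lambda>_. 1)" for \<alpha>
      using volume[of "Suc n"] n by simp
    show "pairing (Omega D) (\<lambda>x. dens P \<alpha> * \<phi> (Suc n) \<alpha> x) (\<lambda>_. 1)
       = pairing (Omega D) (\<lambda>x. dens P \<alpha> * \<phi> 0 \<alpha> x) (\<lambda>_. 1)" for \<alpha>
      using vol[of \<alpha>] by (simp add: pairing_def)
    show "pairing (Omega D) (\<lambda>x. \<Sum>\<alpha>\<in>UNIV. \<phi> (Suc n) \<alpha> x) (\<lambda>_. 1)
       = pairing (Omega D) (\<lambda>x. \<Sum>\<alpha>\<in>UNIV. \<phi> 0 \<alpha> x) (\<lambda>_. 1)"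
      using total[OF n, of "\<lambda>_. 1"] by simp
    show "pairing (Omega D) (\<lambda>x. mixture_density P (\<lambda>\<alpha>. \<phi> (Suc n) \<alpha> x)) (\<lambda>_. 1)
       = pairing (Omega D) (\<lambda>x. mixture_density P (\<lambda>\<alpha>. \<phi> 0 \<alpha> x)) (\<lambda>_. 1)"
      unfolding mixture_density_def by (rule total[OF n])
    assume "(\<exists>L. bdry D = Torus L) \<longrightarrow> grav P = 0"
    from scheme_step.energy_dissipation[OF step[OF n] this]
    show "energy D P (v (Suc n)) (\<phi> (Suc n)) + (t (Suc n) - t n) * dissipation D P (d n) (e n) (Suc n) \<phi> v g
       \<le> energy D P (v n) (\<phi> n)"
      by (simp only: dissipation_def)
  next
    fix k x assume "\<forall>x\<in>Omega D. (\<Sum>\<alpha>\<in>UNIV. \<phi> 0 \<alpha> x) = 1" "k \<in> {1..nT}" "x \<in> Omega D"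
    then show "(\<Sum>\<alpha>\<in>UNIV. \<phi> k \<alpha> x) = 1" using one[of k] by simp
  qed
qed

end
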